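(* Let $k\geq 2$ and $N$ be integers with $4\mid N$, let $\chi$ be a Dirichlet character modulo $N$, and let $f=\sum_{n\geq1}a(n)q^n\in S_{k+1/2}(N,\chi)$ be a non-zero cuspidal Hecke eigenform of weight $k+\tfrac12$. Let $t$ be a squarefree positive integer with $a(t)\neq 0$, and let $F_t=\sum_{n\geq1}A_t(n)q^n\in S_{2k}(N/2,\chi^2)$ be the Shimura lift of $f$ attached to $t$. Suppose that $F_t$ does not have complex multiplication. Let $q$ be a natural number. Suppose that for every Dirichlet character $\varepsilon$ modulo $q$ and every root of unity $\xi\in\operatorname{Im}\varepsilon$ there are constants $C_{\varepsilon,\xi}>0$ and $\alpha_{\varepsilon,\xi}>0$ such that for all intervals $[a,b]\subseteq[-1,1]$ and all $x\geq 2$, $$\left|\frac{\#\left\{p\leq x\text{ prime}\mid p\nmid N,\ \varepsilon(p)=\xi,\ \frac{A_t(p)}{2a(t)p^{\frac{2k-1}{2}}\chi(p)}\in[a,b]\right\}}{\pi(x)}-\frac{\mu([a,b])}{\#\operatorname{Im}\varepsilon}\right|\leq \frac{C_{\varepsilon,\xi}}{x^{\alpha_{\varepsilon,\xi}}}.$$ Then for every integer $d$ with $(d,q)=1$, the sets $$\left\{n\in\mathbb{N}\mid (n,N)=1,\ n\equiv d\ (\mathrm{mod}\ q),\ \tfrac{a(tn^2)}{\chi(n)}>0\right\}\quad\text{and}\quad \left\{n\in\mathbb{N}\mid (n,N)=1,\ n\equiv d\ (\mathrm{mod}\ q),\ \tfrac{a(tn^2)}{\chi(n)}<0\right\}$$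 have equal positive natural densities, and each of these densities is half of the natural density of $$\left\{n\in\mathbb{N}\mid (n,N)=1,\ n\equiv d\ (\mathrm{mod}\ q),\ \tfrac{a(tn^2)}{\chi(n)}\neq 0\right\}.$$
   Context: The Shimura lift $F_t$ is the Hecke eigenform of weight $2k$ whose coefficients satisfy $A_t(n)=\sum_{e\mid n}\chi_{t,N}(e)e^{k-1}a\!\left(\frac{n^2}{e^2}t\right)$, where $\chi_{t,N}(e)=\chi(e)\left(\frac{(-1)^kN^2t}{e}\right)$; one has $F_t=a(t)F$ with $F$ a normalized Hecke eigenform, $a(t)\in\mathbb{R}$, and for primes $p\nmid N$ the number $\frac{A_t(p)}{2a(t)p^{(2k-1)/2}\chi(p)}$ is real and lies in $[-1,1]$. For $(n,N)=1$ the number $a(tn^2)/\chi(n)$ is real. $\mu$ denotes the Sato–Tate measure $\frac{2}{\pi}\sqrt{1-s^2}\,ds$ on $[-1,1]$; $\pi(x)$ is the number of primes $\leq x$; $\operatorname{Im}\varepsilon$ is the image of the character $\varepsilon$ (on integers coprime to $q$) and $\#\operatorname{Im}\varepsilon$ its cardinality. A set $A\subseteq\mathbb{N}$ has natural density $\lim_{x\to\infty}\#\{n\leq x: n\in A\}/x$ when this limit exists. *)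

theory Defs
  imports "HOL-Complex_Analysis.Complex_Analysis" "HOL-Number_Theory.Number_Theory"
    "HOL-Computational_Algebra.Squarefree"
begin

text \<open>
  Characters are functions on \<open>int\<close> (extended by zero), because the lower right entry of a
  modular matrix may be negative.
\<close>

definition dirichlet_character :: "nat \<Rightarrow> (int \<Rightarrow> complex) \<Rightarrow> bool" where
  "dirichlet_character m chi \<longleftrightarrow>
     (\<forall>n. chi (n + int m) = chi n) \<and>
     (\<forall>n n'. chi (n * n') = chi n * chi n') \<and>
     (\<forall>n. chi n \<noteq> 0 \<longleftrightarrow> coprime n (int m))"

definition character_image :: "nat \<Rightarrow> (int \<Rightarrow> complex) \<Rightarrow> complex set" where
  "character_image m chi = chi ` {n. coprime n (int m)}"

definition kronecker_prime :: "int \<Rightarrow> nat \<Rightarrow> int" where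
  "kronecker_prime D p =
     (if p = 2 then (if even D then 0 else if D mod 8 \<in> {1, 7} then 1 else -1)
      else Legendre D (int p))"

definition kronecker_symbol :: "int \<Rightarrow> nat \<Rightarrow> int" where
  "kronecker_symbol D n = (\<Prod>p\<in>#prime_factorization n. kronecker_prime D p)"

definition upper_half_plane :: "complex set" where
  "upper_half_plane = {z. Im z > 0}"

text \<open>A quadruple \<open>(a, b, c, d)\<close> stands for the matrix with rows \<open>(a, b)\<close> and \<open>(c, d)\<close>.\<close>

type_synonym mat22 = "int \<times> int \<times> int \<times> int"

definition Gamma0 :: "nat \<Rightarrow> mat22 set" where
  "Gamma0 M = {(a, b, c, d). a * d - b * c = 1 \<and> int M dvd c}"

definition moebius :: "mat22 \<Rightarrow> complex \<Rightarrow> complex" where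
  "moebius = (\<lambda>(a, b, c, d) z. (of_int a * z + of_int b) / (of_int c * z + of_int d))"

definition cocycle :: "mat22 \<Rightarrow> complex \<Rightarrow> complex" where
  "cocycle = (\<lambda>(a, b, c, d) z. of_int c * z + of_int d)"

definition lower_right :: "mat22 \<Rightarrow> int" where
  "lower_right = (\<lambda>(a, b, c, d). d)"

text \<open>\<open>qexp z\<close> is the nome \<open>q = e\<^sup>2\<^sup>\<pi>\<^sup>i\<^sup>z\<close>.\<close>

definition qexp :: "complex \<Rightarrow> complex" where
  "qexp z = exp (2 * complex_of_real pi * \<i> * z)"

definition theta :: "complex \<Rightarrow> complex" where
  "theta z = (\<Sum>\<^sub>\<infinity>n\<in>(UNIV :: int set). qexp (of_int (n\<^sup>2) * z))"

text \<open>
  Shimura's factor of automorphy \<open>j(\<gamma>, z) = \<theta>(\<gamma>z) / \<theta>(z)\<close>, used for \<open>\<gamma>\<close> in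
  \<open>\<Gamma>\<^sub>0(4)\<close>; the theta function has no zeros in the upper half plane.
\<close>

definition theta_factor :: "mat22 \<Rightarrow> complex \<Rightarrow> complex" where
  "theta_factor \<gamma> z = theta (moebius \<gamma> z) / theta z"

text \<open>
  \<open>J\<close> is the slash factor of the weight in question, only needed up to constants of modulus one.
  At every cusp the slashed function must have a power series in \<open>q\<^sup>1\<^sup>/\<^sup>h\<close>
  without constant term; in half-integral weight a further root of unity picked up under
  translation by the cusp width is absorbed by enlarging \<open>h\<close>.
\<close>

definition vanishes_at_cusps ::
    "(mat22 \<Rightarrow> complex \<Rightarrow> complex) \<Rightarrow> (complex \<Rightarrow> complex) \<Rightarrow> bool" where
  "vanishes_at_cusps J f \<longleftrightarrow>
     (\<forall>\<gamma>\<in>Gamma0 1. \<exists>h::nat. h > 0 \<and> (\<exists>c::nat \<Rightarrow> complex. c 0 = 0 \<and>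
        (\<forall>z\<in>upper_half_plane.
           (\<lambda>n. c n * qexp (of_nat n * z / of_nat h)) sums (f (moebius \<gamma> z) / J \<gamma> z))))"

definition cusp_form_int ::
    "nat \<Rightarrow> nat \<Rightarrow> (int \<Rightarrow> complex) \<Rightarrow> (complex \<Rightarrow> complex) \<Rightarrow> bool" where
  "cusp_form_int w M \<psi> F \<longleftrightarrow>
     F holomorphic_on upper_half_plane \<and>
     (\<forall>\<gamma>\<in>Gamma0 M. \<forall>z\<in>upper_half_plane.
        F (moebius \<gamma> z) = \<psi> (lower_right \<gamma>) * cocycle \<gamma> z ^ w * F z) \<and>
     vanishes_at_cusps (\<lambda>\<gamma> z. cocycle \<gamma> z ^ w) F"

text \<open>The space \<open>S\<^sub>k\<^sub>+\<^sub>1\<^sub>/\<^sub>2(N, chi)\<close>, for \<open>4 dvd N\<close>.\<close>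

definition cusp_form_half ::
    "nat \<Rightarrow> nat \<Rightarrow> (int \<Rightarrow> complex) \<Rightarrow> (complex \<Rightarrow> complex) \<Rightarrow> bool" where
  "cusp_form_half k N chi f \<longleftrightarrow>
     f holomorphic_on upper_half_plane \<and>
     (\<forall>\<gamma>\<in>Gamma0 N. \<forall>z\<in>upper_half_plane.
        f (moebius \<gamma> z) = chi (lower_right \<gamma>) * theta_factor \<gamma> z ^ (2 * k + 1) * f z) \<and>
     vanishes_at_cusps (\<lambda>\<gamma> z. csqrt (cocycle \<gamma> z) ^ (2 * k + 1)) f"

definition q_expansion :: "(complex \<Rightarrow> complex) \<Rightarrow> (nat \<Rightarrow> complex) \<Rightarrow> bool" where
  "q_expansion f a \<longleftrightarrow> a 0 = 0 \<and>
     (\<forall>z\<in>upper_half_plane. (\<lambda>n. a n * qexp (of_nat n * z)) sums f z)"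

text \<open>
  The \<open>n\<close>-th coefficient of \<open>f | T(p\<^sup>2)\<close> by Shimura's formula. The library's \<open>Legendre\<close> is the
  right symbol for odd \<open>p\<close> only; for \<open>p = 2\<close> the factor \<open>chi 2\<close> is \<open>0\<close>, as the level is even.
\<close>

definition hecke_half_coeff ::
    "nat \<Rightarrow> (int \<Rightarrow> complex) \<Rightarrow> nat \<Rightarrow> (nat \<Rightarrow> complex) \<Rightarrow> nat \<Rightarrow> complex" where
  "hecke_half_coeff k chi p a n =
     a (p\<^sup>2 * n)
     + chi (int p) * of_int (Legendre ((-1) ^ k * int n) (int p)) * of_nat p ^ (k - 1) * a n
     + (if p\<^sup>2 dvd n then chi (int (p\<^sup>2)) * of_nat p ^ (2 * k - 1) * a (n div p\<^sup>2) else 0)"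

definition hecke_eigenform_half ::
    "nat \<Rightarrow> (int \<Rightarrow> complex) \<Rightarrow> (nat \<Rightarrow> complex) \<Rightarrow> bool" where
  "hecke_eigenform_half k chi a \<longleftrightarrow>
     (\<forall>p. prime p \<longrightarrow> (\<exists>ev. \<forall>n\<ge>1. hecke_half_coeff k chi p a n = ev * a n))"

definition shimura_character ::
    "nat \<Rightarrow> nat \<Rightarrow> (int \<Rightarrow> complex) \<Rightarrow> nat \<Rightarrow> nat \<Rightarrow> complex" where
  "shimura_character k N chi t e =
     chi (int e) * of_int (kronecker_symbol ((-1) ^ k * (int N)\<^sup>2 * int t) e)"

definition shimura_lift ::
    "nat \<Rightarrow> nat \<Rightarrow> (int \<Rightarrow> complex) \<Rightarrow> nat \<Rightarrow> (nat \<Rightarrow> complex) \<Rightarrow>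
     (complex \<Rightarrow> complex) \<Rightarrow> (nat \<Rightarrow> complex) \<Rightarrow> bool" where
  "shimura_lift k N chi t a F A \<longleftrightarrow>
     cusp_form_int (2 * k) (N div 2) (\<lambda>d. chi d ^ 2) F \<and>
     q_expansion F A \<and>
     (\<forall>n\<ge>1. A n = (\<Sum>e | e dvd n.
        shimura_character k N chi t e * of_nat e ^ (k - 1) * a ((n div e)\<^sup>2 * t)))"

text \<open>
  Complex multiplication of an eigenform in terms of its prime coefficients: the form agrees,
  up to finitely many primes, with its twist by a nontrivial character. The condition is
  invariant under scaling the form.
\<close>

definition has_CM :: "(nat \<Rightarrow> complex) \<Rightarrow> bool" where
  "has_CM A \<longleftrightarrow>
     (\<exists>m \<phi>. m > 0 \<and> dirichlet_character m \<phi> \<and>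
        (\<exists>n. coprime n (int m) \<and> \<phi> n \<noteq> 1) \<and>
        finite {p. prime p \<and> \<phi> (int p) * A p \<noteq> A p})"

definition sato_tate :: "real measure" where
  "sato_tate =
     density lborel (\<lambda>s. ennreal (2 / pi * sqrt (1 - s\<^sup>2) * indicator {-1..1} s))"

definition prime_pi :: "real \<Rightarrow> nat" where
  "prime_pi x = card {p::nat. prime p \<and> real p \<le> x}"

definition has_natural_density :: "nat set \<Rightarrow> real \<Rightarrow> bool" where
  "has_natural_density A \<delta> \<longleftrightarrow>
     ((\<lambda>x::real. real (card {n \<in> A. real n \<le> x}) / x) \<longlongrightarrow> \<delta>) at_top"

end

theory Submission
  imports Defs
begin

text \<open>
  By Shimura's formula, \<open>n \<mapsto> a (t * n\<^sup>2) / (a t * chi n)\<close> is multiplicative on the integers prime to \<open>N\<close>;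
  let \<open>h\<close> be its sign. At a prime \<open>p\<close> the sign is that of the Sato--Tate angle, up to a shift by at most
  \<open>1 / (2 * sqrt p)\<close>, so the hypothesis and the symmetry of the measure give
  \<open>(\<Sum>p\<le>x. h p * \<epsilon> p) = O(x powr (1 - \<beta>))\<close> for every \<open>\<epsilon>\<close> modulo \<open>q\<close>. As characters separate residue classes,
  the same holds for the sum over the primes in each class prime to \<open>q\<close>. This saving makes the mean
  value theorem elementary: expanding \<open>ln n\<close> in \<open>\<Sum>n\<le>x. h n * ln n\<close> over prime divisors leaves
  prime sums of length \<open>x / m\<close> weighted by \<open>h m\<close>, whence \<open>h\<close> has mean value \<open>0\<close> on the progression \<open>d\<close> modulo \<open>q\<close>.
  The zeros of \<open>h\<close> are the unitary multiples of certain prime powers whose reciprocals have a finite sum, and a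
  limit of periodic sieves gives the support of \<open>h\<close> a positive density.
\<close>

subsection \<open>Dirichlet characters separate residue classes\<close>

text \<open>The power saving is used twice. Multiplied back by the number of primes, the hypothesis
  balances positive and negative angles up to \<open>O(x powr (1 - \<beta>))\<close>, because the
  main terms for \<open>{0..1}\<close> and \<open>{-1..0}\<close> are equal and cancel. This error
  survives the weight \<open>ln p\<close>, and adding up the resulting prime sums over cofactors
  \<open>m \<le> x\<close> costs only the harmonic factor \<open>ln x\<close>, the very factor by
  which the weighted mean value is finally divided. Applied to an interval shrinking around
  \<open>0\<close>, the same saving makes the reciprocals of the primes with \<open>h p = 0\<close>
  summable, which density zero among the primes alone would not give. The obstacle is that
  \<open>h\<close> is multiplicative but not completely so: \<open>h p = 0\<close> says nothing
  about \<open>h (p ^ 2)\<close>. Zeros are therefore located by the exact prime power divisors of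
  \<open>n\<close>, and zeros at proper prime powers, about which nothing is known, are harmless
  because the reciprocals of all proper prime powers are summable. Dividing by \<open>a t\<close>
  normalises \<open>h 1 = 1\<close>; if \<open>a t\<close> is negative, the two sets of the theorem
  are exchanged at the end.\<close>

text \<open>
  A partial character is a character of a subgroup of \<open>(\<int>/q)\<^sup>*\<close>, encoded on a set \<open>H\<close> of integers that is
  saturated under congruence; closure under inverses is automatic because units have finite order.
\<close>

definition partial_character :: "nat \<Rightarrow> int set \<Rightarrow> (int \<Rightarrow> complex) \<Rightarrow> bool" where
  "partial_character q H \<psi> \<longleftrightarrow>
     H \<subseteq> {n. coprime n (int q)} \<and> 1 \<in> H \<and> \<psi> 1 = 1 \<and>
     (\<forall>x\<in>H. \<forall>y\<in>H. x * y \<in> H \<and> \<psi> (x * y) = \<psi> x * \<psi> y) \<and>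
     (\<forall>x\<in>H. \<forall>y. [x = y] (mod int q) \<longrightarrow> y \<in> H \<and> \<psi> y = \<psi> x)"

text \<open>Euler's theorem for the nonnegative representative of \<open>x\<close>. It supplies
  inverses as powers, which is how the encoding of subgroups obtains them.\<close>

lemma unit_power_eq_one:
  fixes x :: int
  assumes "coprime x (int q)" "q > 0"
  obtains r :: nat where "r > 0" "[x ^ r = 1] (mod int q)"
proof -
  define y where "y = nat (x mod int q)"
  have y: "int y = x mod int q" using assms by (simp add: y_def)
  have "coprime (int y) (int q)" using assms unfolding y by simp
  hence "coprime y q" by simp
  hence "[y ^ totient q = 1] (mod q)" by (rule euler_theorem)
  hence "[int y ^ totient q = 1] (mod int q)"
    by (metis cong_int_iff of_nat_1 of_nat_power)
  hence "[x ^ totient q = 1] (mod int q)"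
    unfolding y by (simp add: cong_def power_mod)
  with that[of "totient q"] assms show ?thesis by simp
qed

context
  fixes q :: nat and H :: "int set" and \<psi> :: "int \<Rightarrow> complex"
  assumes pc: "partial_character q H \<psi>" and q: "q > 0"
begin

lemma partial_character_coprime: "x \<in> H \<Longrightarrow> coprime x (int q)"
  using pc by (auto simp: partial_character_def)

lemma partial_character_mult: "x \<in> H \<Longrightarrow> y \<in> H \<Longrightarrow> x * y \<in> H \<and> \<psi> (x * y) = \<psi> x * \<psi> y"
  using pc unfolding partial_character_def by metis

lemma partial_character_cong: "x \<in> H \<Longrightarrow> [x = y] (mod int q) \<Longrightarrow> y \<in> H \<and> \<psi> y = \<psi> x"
  using pc unfolding partial_character_def by blast

lemma partial_character_one: "1 \<in> H \<and> \<psi> 1 = 1"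
  using pc unfolding partial_character_def by blast

lemma partial_character_power: "x \<in> H \<Longrightarrow> x ^ n \<in> H \<and> \<psi> (x ^ n) = \<psi> x ^ n"
  by (induction n) (use partial_character_mult partial_character_one in auto)

text \<open>Multiplying by \<open>x ^ (r - 1)\<close>, where \<open>x ^ r\<close> is congruent to
  \<open>1\<close>, removes the factor \<open>x\<close>: closure under inverses in the form of
  cancellation.\<close>

lemma partial_character_cancel:
  assumes "x \<in> H" "x * y \<in> H"
  shows "y \<in> H"
proof -
  obtain r where r: "r > 0" "[x ^ r = 1] (mod int q)"
    using unit_power_eq_one partial_character_coprime assms q by blast
  have "x ^ (r - 1) * (x * y) \<in> H"
    using assms partial_character_power partial_character_mult by blast
  moreover have "x ^ (r - 1) * (x * y) = x ^ r * y"
    using r(1) by (cases r) (auto simp: algebra_simps)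
  moreover have "[x ^ r * y = 1 * y] (mod int q)"
    using r by (intro cong_mult) auto
  ultimately have "x ^ r * y \<in> H" "[x ^ r * y = y] (mod int q)" by (simp_all only: mult_1)
  thus ?thesis using partial_character_cong by blast
qed

text \<open>A power of \<open>\<psi> x\<close> equals \<open>\<psi> 1 = 1\<close>, so the values are
  roots of unity.\<close>

lemma partial_character_nonzero:
  assumes "x \<in> H" shows "\<psi> x \<noteq> 0"
proof -
  obtain r where r: "r > 0" "[x ^ r = 1] (mod int q)"
    using unit_power_eq_one partial_character_coprime assms q by blast
  have "\<psi> x ^ r = 1"
    using partial_character_power[OF assms, of r] partial_character_cong[of "x ^ r" 1] r
      partial_character_one by auto
  thus ?thesis using r by (auto simp: power_0_left)
qed

text \<open>The one-generator step in extending characters of finite abelian groups. The subgroup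
  generated by \<open>H\<close> and \<open>g\<close> consists of the classes of
  \<open>h * g ^ j\<close>, and sending such a class to \<open>\<psi> h * w ^ j\<close> is well
  defined because \<open>w ^ m = \<psi> (g ^ m)\<close> for the order \<open>m\<close> of
  \<open>g\<close> modulo \<open>H\<close>. Every root \<open>w\<close> of this equation is
  admissible; this freedom in the value at \<open>g\<close> is what makes separation
  possible.\<close>

lemma partial_character_extend:
  assumes g: "coprime g (int q)"
    and m: "m = (LEAST m. m > 0 \<and> g ^ m \<in> H)"
    and w: "w ^ m = \<psi> (g ^ m)"
  obtains H' \<psi>' where "partial_character q H' \<psi>'" "H \<subseteq> H'" "g \<in> H'"
    "\<And>x. x \<in> H \<Longrightarrow> \<psi>' x = \<psi> x" "\<psi>' g = w"
proof -
  obtain r where r: "r > 0" "[g ^ r = 1] (mod int q)"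
    using unit_power_eq_one g q by blast
  have "g ^ r \<in> H" using partial_character_cong[of 1 "g ^ r"] partial_character_one r
    by (auto simp: cong_sym_eq)
  with r have m0: "m > 0" and gm: "g ^ m \<in> H"
    unfolding m using LeastI[of "\<lambda>m. m > 0 \<and> g ^ m \<in> H" r] by auto
  have m_le: "m \<le> j" if "j > 0" "g ^ j \<in> H" for j
    unfolding m using that by (intro Least_le) auto
  \<comment> \<open>Division with remainder: \<open>g ^ (j mod m)\<close> lies in \<open>H\<close>
    as well, and minimality of \<open>m\<close> forces the remainder to be \<open>0\<close>.\<close>
  have dvd: "m dvd j" if "g ^ j \<in> H" for j
  proof -
    have "(g ^ m) ^ (j div m) * g ^ (j mod m) = g ^ j"
      by (simp flip: power_mult power_add)
    with that have "g ^ (j mod m) \<in> H"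
      using partial_character_cancel[of "(g ^ m) ^ (j div m)" "g ^ (j mod m)"]
        partial_character_power[OF gm] by auto
    with m_le[of "j mod m"] m0 have "j mod m = 0"
      by (metis mod_less_divisor not_le neq0_conv)
    thus ?thesis by auto
  qed
  have pow: "\<psi> (g ^ j) = w ^ j" if "g ^ j \<in> H" for j
  proof -
    obtain i where "j = m * i" using dvd[OF \<open>g ^ j \<in> H\<close>] by (auto elim: dvdE)
    thus ?thesis using partial_character_power[OF gm, of i] w
      by (simp add: power_mult)
  qed
  \<comment> \<open>With \<open>i \<le> j\<close> the unit \<open>g ^ i\<close> can be cancelled
    without negative exponents; what remains forces \<open>g ^ (j - i)\<close> into
    \<open>H\<close>, where its value is already known.\<close>
  have wd_le: "\<psi> h * w ^ i = \<psi> h' * w ^ j"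
    if h: "h \<in> H" "h' \<in> H" "[h * g ^ i = h' * g ^ j] (mod int q)" "i \<le> j" for h h' i j
  proof -
    have "[g ^ i * h = g ^ i * (h' * g ^ (j - i))] (mod int q)"
      using h by (simp add: algebra_simps flip: power_add)
    hence *: "[h = h' * g ^ (j - i)] (mod int q)"
      using g by (subst (asm) cong_mult_lcancel) auto
    with h have **: "h' * g ^ (j - i) \<in> H" "\<psi> (h' * g ^ (j - i)) = \<psi> h"
      using partial_character_cong by blast+
    hence gj: "g ^ (j - i) \<in> H" using partial_character_cancel h by blast
    hence "\<psi> h = \<psi> h' * w ^ (j - i)"
      using ** partial_character_mult[OF h(2) gj] pow[OF gj] by simp
    thus ?thesis using \<open>i \<le> j\<close> by (simp flip: power_add)
  qed
  have wd: "\<psi> h * w ^ i = \<psi> h' * w ^ j"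
    if h: "h \<in> H" "h' \<in> H" "[h * g ^ i = h' * g ^ j] (mod int q)" for h h' i j
  proof (cases "i \<le> j")
    case True thus ?thesis using wd_le h by blast
  next
    case False
    with wd_le[OF h(2,1) cong_sym[OF h(3)]] show ?thesis by simp
  qed
  define H' where "H' = {n. \<exists>h\<in>H. \<exists>j. [n = h * g ^ j] (mod int q)}"
  define \<psi>' where "\<psi>' n = (SOME z. \<exists>h\<in>H. \<exists>j. [n = h * g ^ j] (mod int q) \<and> z = \<psi> h * w ^ j)" for n
  have chi': "n \<in> H'" "\<psi>' n = \<psi> h * w ^ j" if "h \<in> H" "[n = h * g ^ j] (mod int q)" for n h j
  proof -
    show "n \<in> H'" using that by (auto simp: H'_def)
    show "\<psi>' n = \<psi> h * w ^ j"
      unfolding \<psi>'_def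
    proof (rule some_equality)
      fix z assume "\<exists>h\<in>H. \<exists>j. [n = h * g ^ j] (mod int q) \<and> z = \<psi> h * w ^ j"
      then obtain h' j' where h': "h' \<in> H" "[n = h' * g ^ j'] (mod int q)" "z = \<psi> h' * w ^ j'"
        by blast
      hence "[h' * g ^ j' = h * g ^ j] (mod int q)" using that by (metis cong_sym cong_trans)
      with wd[OF h'(1) that(1)] h' show "z = \<psi> h * w ^ j" by simp
    qed (use that in blast)
  qed
  show ?thesis
  proof
    show "H \<subseteq> H'" "\<And>x. x \<in> H \<Longrightarrow> \<psi>' x = \<psi> x"
      using chi'[of _ _ 0] by auto
    show "g \<in> H'" "\<psi>' g = w"
      using chi'[of 1 g 1] partial_character_one by auto
    show "partial_character q H' \<psi>'"
      unfolding partial_character_def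
    proof (intro conjI ballI allI impI subsetI CollectI)
      fix x assume "x \<in> H'"
      then obtain h j where "h \<in> H" "[x = h * g ^ j] (mod int q)"
        by (auto simp: H'_def)
      thus "coprime x (int q)" using partial_character_coprime g
        by (metis cong_imp_coprime cong_sym coprime_mult_left_iff coprime_power_left_iff)
    next
      show "1 \<in> H'" "\<psi>' 1 = 1" using chi'[of 1 1 0] partial_character_one by auto
    next
      fix x y assume "x \<in> H'" "y \<in> H'"
      then obtain h j h' j' where
        hj: "h \<in> H" "[x = h * g ^ j] (mod int q)" "h' \<in> H" "[y = h' * g ^ j'] (mod int q)"
        by (auto simp: H'_def)
      have "[x * y = (h * g ^ j) * (h' * g ^ j')] (mod int q)"
        using hj by (intro cong_mult) auto
      hence "[x * y = (h * h') * g ^ (j + j')] (mod int q)"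
        by (simp add: power_add mult_ac)
      from chi'[OF _ this] chi'[OF hj(1,2)] chi'[OF hj(3,4)] partial_character_mult[OF hj(1,3)]
      show "x * y \<in> H'" "\<psi>' (x * y) = \<psi>' x * \<psi>' y"
        by (auto simp: power_add)
    next
      fix x y assume "x \<in> H'" and xy: "[x = y] (mod int q)"
      then obtain h j where hj: "h \<in> H" "[x = h * g ^ j] (mod int q)"
        by (auto simp: H'_def)
      hence "[y = h * g ^ j] (mod int q)" using xy by (metis cong_sym cong_trans)
      from chi'[OF hj(1) this] chi'[OF hj]
      show "y \<in> H'" "\<psi>' y = \<psi>' x" by auto
    qed
  qed
qed

end

text \<open>Induction on the number of residues modulo \<open>q\<close> outside \<open>H\<close>:
  adjoining a unit \<open>g\<close> outside \<open>H\<close> removes at least its residue. The value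
  required at \<open>g\<close> exists because every complex number has an \<open>m\<close>-th
  root.\<close>

lemma partial_character_total:
  assumes "partial_character q H \<psi>" "q > 0"
  obtains \<epsilon> where "dirichlet_character q \<epsilon>" "\<And>x. x \<in> H \<Longrightarrow> \<epsilon> x = \<psi> x"
  using assms
proof (induction "card ({0..<int q} - H)" arbitrary: H \<psi> thesis rule: less_induct)
  case less
  note pc = less.prems(2) and q = less.prems(3)
  show ?case
  proof (cases "{n. coprime n (int q)} \<subseteq> H")
    case True
    define \<epsilon> where "\<epsilon> n = (if coprime n (int q) then \<psi> n else 0)" for n
    have eq: "\<epsilon> x = \<psi> x" if "x \<in> H" for x
      using partial_character_coprime[OF pc q that] by (simp add: \<epsilon>_def)
    have "dirichlet_character q \<epsilon>"
      unfolding dirichlet_character_def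
    proof (intro conjI allI)
      fix n
      have "coprime (n + int q) (int q) \<longleftrightarrow> coprime n (int q)"
        by (simp only: coprime_iff_gcd_eq_1 gcd_add1)
      moreover have "[n = n + int q] (mod int q)" by (simp add: cong_def)
      ultimately show "\<epsilon> (n + int q) = \<epsilon> n"
        using partial_character_cong[OF pc q, of n "n + int q"] True by (auto simp: \<epsilon>_def)
    next
      fix n n' show "\<epsilon> (n * n') = \<epsilon> n * \<epsilon> n'"
        using partial_character_mult[OF pc q, of n n'] True by (auto simp: \<epsilon>_def)
    next
      fix n show "(\<epsilon> n \<noteq> 0) = coprime n (int q)"
        using partial_character_nonzero[OF pc q, of n] True by (auto simp: \<epsilon>_def)
    qed
    with eq less.prems(1) show ?thesis by blast
  next
    case False
    then obtain g where g: "coprime g (int q)" "g \<notin> H" by auto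
    define m where "m = (LEAST m. m > 0 \<and> g ^ m \<in> H)"
    obtain r where r: "r > 0" "[g ^ r = 1] (mod int q)"
      using unit_power_eq_one g q by blast
    have "g ^ r \<in> H" 
      using partial_character_cong[OF pc q, of 1 "g ^ r"] partial_character_one[OF pc q] r
      by (auto simp: cong_sym_eq)
    with r have "m > 0"
      unfolding m_def using LeastI[of "\<lambda>m. m > 0 \<and> g ^ m \<in> H" r] by auto
    then obtain w where w: "w ^ m = \<psi> (g ^ m)" using exists_complex_root[of m "\<psi> (g ^ m)"] by (metis less_not_refl)
    obtain H' \<psi>' where H': "partial_character q H' \<psi>'" "H \<subseteq> H'" "g \<in> H'"
      "\<And>x. x \<in> H \<Longrightarrow> \<psi>' x = \<psi> x"
      using partial_character_extend[OF pc q g(1) m_def w] by metis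
    have "g mod int q \<in> H'" using partial_character_cong[OF H'(1) q H'(3)] by (simp add: cong_def)
    moreover have "g mod int q \<notin> H"
      using partial_character_cong[OF pc q, of "g mod int q" g] g by (auto simp: cong_def)
    moreover have "g mod int q \<in> {0..<int q}" using q by simp
    ultimately have "{0..<int q} - H' \<subset> {0..<int q} - H"
      using H'(2) by blast
    hence "card ({0..<int q} - H') < card ({0..<int q} - H)"
      by (intro psubset_card_mono) auto
    from less.hyps[OF this _ H'(1) q] obtain \<epsilon> where
      "dirichlet_character q \<epsilon>" "\<And>x. x \<in> H' \<Longrightarrow> \<epsilon> x = \<psi>' x" by blast
    thus ?thesis using less.prems(1) H' by (metis subsetD)
  qed
qed

lemma dirichlet_character_cong:
  assumes "dirichlet_character q \<epsilon>" "[m = n] (mod int q)"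
  shows "\<epsilon> m = \<epsilon> n"
proof -
  have step: "\<epsilon> (x + int q) = \<epsilon> x" for x using assms by (simp add: dirichlet_character_def)
  have pos: "\<epsilon> (x + int q * int j) = \<epsilon> x" for x j
    by (induction j) (use step[of "x + int q * int j" for j] in \<open>auto simp: algebra_simps\<close>)
  obtain k where k: "n = m + int q * k" using assms by (auto simp: cong_iff_lin)
  show ?thesis
  proof (cases "k \<ge> 0")
    case True thus ?thesis using pos[of m "nat k"] k by simp
  next
    case False thus ?thesis using pos[of n "nat (-k)"] k by simp
  qed
qed

lemma dirichlet_character_one:
  assumes "dirichlet_character q \<epsilon>" shows "\<epsilon> 1 = 1"
proof -
  have "\<forall>n n'. \<epsilon> (n * n') = \<epsilon> n * \<epsilon> n'" "\<forall>n. (\<epsilon> n \<noteq> 0) = coprime n (int q)"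
    using assms by (simp_all add: dirichlet_character_def)
  from this(1)[rule_format, of 1 1] this(2)[rule_format, of 1]
  have "\<epsilon> 1 = \<epsilon> 1 * \<epsilon> 1" "\<epsilon> 1 \<noteq> 0" by simp_all
  thus ?thesis by simp
qed

text \<open>Start from the trivial character on the class of \<open>1\<close>. Since
  \<open>c\<close> lies outside it, its order \<open>m\<close> exceeds \<open>1\<close>, so
  \<open>cis (2 * pi / m)\<close> is an \<open>m\<close>-th root of \<open>1\<close> other than
  \<open>1\<close> and may be prescribed at \<open>c\<close>.\<close>

lemma dirichlet_character_separates_one:
  assumes q: "q > 0" and c: "coprime c (int q)" "\<not> [c = 1] (mod int q)"
  obtains \<epsilon> where "dirichlet_character q \<epsilon>" "\<epsilon> c \<noteq> 1"
proof -
  define H where "H = {n. [1 = n] (mod int q)}"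
  have pc: "partial_character q H (\<lambda>_. 1)"
    unfolding partial_character_def
  proof (intro conjI ballI allI impI subsetI CollectI)
    fix x assume "x \<in> H"
    thus "coprime x (int q)" using cong_imp_coprime[of 1 x "int q"] by (simp add: H_def)
  next
    fix x y assume "x \<in> H" "y \<in> H"
    thus "x * y \<in> H" using cong_mult[of 1 x "int q" 1 y] by (simp add: H_def)
  next
    fix x y assume "x \<in> H" "[x = y] (mod int q)"
    thus "y \<in> H" using cong_trans[of 1 x "int q" y] by (simp add: H_def)
  qed (simp_all add: H_def)
  define m where "m = (LEAST m. m > 0 \<and> c ^ m \<in> H)"
  obtain r where r: "r > 0" "[c ^ r = 1] (mod int q)"
    using unit_power_eq_one c q by blast
  hence "m > 0 \<and> c ^ m \<in> H"
    unfolding m_def using LeastI[of "\<lambda>m. m > 0 \<and> c ^ m \<in> H" r]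
    by (auto simp: H_def cong_sym_eq)
  moreover have "c \<notin> H" using c by (auto simp: H_def cong_sym_eq)
  ultimately have "m > 1" by (cases "m = 1") auto
  define w where "w = cis (2 * pi / real m)"
  have "w ^ m = cis (real m * (2 * pi / real m))" by (simp only: w_def Complex.DeMoivre)
  also have "real m * (2 * pi / real m) = 2 * pi" using \<open>m > 1\<close> by simp
  finally have w: "w ^ m = 1" by simp
  have "w \<noteq> 1"
  proof
    assume "w = 1"
    hence "cos (2 * pi / m) = 1" by (auto simp: w_def complex_eq_iff)
    then obtain j :: int where j: "2 * pi / m = real_of_int j * 2 * pi" 
      by (auto simp: cos_one_2pi_int)
    hence "1 = real_of_int j * m" using \<open>m > 1\<close> by (simp add: field_simps)
    hence "1 = j * int m" by (metis of_int_1 of_int_eq_iff of_int_mult of_int_of_nat_eq)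
    hence "int m dvd 1" by (metis dvd_triv_right)
    thus False using \<open>m > 1\<close> by simp
  qed
  obtain H' \<psi>' where H': "partial_character q H' \<psi>'" "c \<in> H'" "\<psi>' c = w"
    using partial_character_extend[OF pc q c(1) m_def] w by metis
  obtain \<epsilon> where "dirichlet_character q \<epsilon>" "\<epsilon> c = w"
    using partial_character_total[OF H'(1) q] H' by metis
  with \<open>w \<noteq> 1\<close> show ?thesis using that by blast
qed

text \<open>An inverse \<open>e'\<close> of \<open>e\<close> modulo \<open>q\<close> reduces this to
  separating \<open>c * e'\<close> from \<open>1\<close>.\<close>

lemma dirichlet_character_separates:
  assumes q: "q > 0" and ce: "coprime c (int q)" "coprime e (int q)" "\<not> [c = e] (mod int q)"
  obtains \<epsilon> where "dirichlet_character q \<epsilon>" "\<epsilon> c \<noteq> \<epsilon> e"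
proof -
  obtain e' where e': "[e * e' = 1] (mod int q)"
    using ce cong_solve_coprime_int by blast
  hence cop: "coprime e' (int q)"
    by (metis cong_imp_coprime cong_sym coprime_1_left coprime_mult_left_iff)
  have "\<not> [c * e' = 1] (mod int q)"
  proof
    assume "[c * e' = 1] (mod int q)"
    hence "[c * e' = e * e'] (mod int q)" using e' by (metis cong_sym cong_trans)
    thus False using ce cop by (simp add: cong_mult_rcancel)
  qed
  then obtain \<epsilon> where eps: "dirichlet_character q \<epsilon>" "\<epsilon> (c * e') \<noteq> 1"
    using dirichlet_character_separates_one[OF q, of "c * e'"] ce cop by auto
  have mult: "\<epsilon> (x * y) = \<epsilon> x * \<epsilon> y" for x y using eps by (simp add: dirichlet_character_def)
  have "\<epsilon> (e * e') = 1"
    using dirichlet_character_cong[OF eps(1) e'] dirichlet_character_one[OF eps(1)] by simp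
  with eps mult that show ?thesis by metis
qed

section \<open>Linear combinations of characters and indicators of residue classes\<close>

inductive_set character_span :: "nat \<Rightarrow> (int \<Rightarrow> complex) set" for q where
  char: "dirichlet_character q \<epsilon> \<Longrightarrow> \<epsilon> \<in> character_span q"
| add: "\<phi> \<in> character_span q \<Longrightarrow> \<psi> \<in> character_span q \<Longrightarrow> (\<lambda>n. \<phi> n + \<psi> n) \<in> character_span q"
| scale: "\<phi> \<in> character_span q \<Longrightarrow> (\<lambda>n. z * \<phi> n) \<in> character_span q"

lemma character_span_mult_char:
  assumes "\<phi> \<in> character_span q" "dirichlet_character q \<epsilon>"
  shows "(\<lambda>n. \<phi> n * \<epsilon> n) \<in> character_span q"
  using assms(1)
proof induction
  case (char \<psi>)
  have "dirichlet_character q (\<lambda>n. \<psi> n * \<epsilon> n)"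
    using char assms(2) by (auto simp: dirichlet_character_def)
  thus ?case by (rule character_span.char)
next
  case (add \<phi> \<psi>)
  from character_span.add[OF add.IH] show ?case by (simp add: algebra_simps)
next
  case (scale \<phi> z)
  from character_span.scale[OF scale.IH, of z] show ?case by (simp add: algebra_simps)
qed

lemma dirichlet_character_principal:
  "dirichlet_character q (\<lambda>n. if coprime n (int q) then 1 else 0)"
  unfolding dirichlet_character_def
proof (intro conjI allI)
  fix n
  have "coprime (n + int q) (int q) \<longleftrightarrow> coprime n (int q)"
    by (simp only: coprime_iff_gcd_eq_1 gcd_add1)
  thus "(if coprime (n + int q) (int q) then 1 else 0 :: complex) =
      (if coprime n (int q) then 1 else 0)" by (simp only:)
qed simp_all

text \<open>Lagrange interpolation with characters: a factor
  \<open>(\<epsilon> - \<epsilon> e) / (\<epsilon> c - \<epsilon> e)\<close> vanishes at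
  \<open>e\<close> and is \<open>1\<close> at \<open>c\<close>. Multiplying by it stays in the span,
  since a product of characters is a character. This takes the place of the orthogonality
  relations.\<close>

lemma character_span_vanishing:
  assumes q: "q > 0" and c: "coprime c (int q)" and "finite R"
    and R: "\<And>e. e \<in> R \<Longrightarrow> coprime e (int q) \<and> \<not> [c = e] (mod int q)"
  shows "\<exists>\<phi>\<in>character_span q. \<phi> c = 1 \<and> (\<forall>e\<in>R. \<phi> e = 0)"
  using \<open>finite R\<close> R
proof (induction R)
  case empty
  show ?case
    by (intro bexI[OF _ character_span.char[OF dirichlet_character_principal]]) (simp add: c)
next
  case (insert e R)
  then obtain \<phi> where phi: "\<phi> \<in> character_span q" "\<phi> c = 1" "\<forall>e\<in>R. \<phi> e = 0" by auto
  obtain \<epsilon> where eps: "dirichlet_character q \<epsilon>" "\<epsilon> c \<noteq> \<epsilon> e"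
    using dirichlet_character_separates[OF q c, of e] insert.prems by auto
  define \<psi> where "\<psi> n = 1 / (\<epsilon> c - \<epsilon> e) * (\<phi> n * \<epsilon> n + (- \<epsilon> e) * \<phi> n)" for n
  have "\<psi> \<in> character_span q" unfolding \<psi>_def
    by (intro character_span.scale character_span.add character_span_mult_char phi eps)
  moreover have "\<psi> c = 1" "\<forall>e\<in>insert e R. \<psi> e = 0"
    using phi eps by (auto simp: \<psi>_def)
  ultimately show ?case by blast
qed

lemma character_span_cong:
  assumes "\<phi> \<in> character_span q" "[m = n] (mod int q)"
  shows "\<phi> m = \<phi> n"
  using assms by induction (auto dest: dirichlet_character_cong)

lemma character_span_not_coprime:
  assumes "\<phi> \<in> character_span q" "\<not> coprime n (int q)"
  shows "\<phi> n = 0"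
  using assms by induction (auto simp: dirichlet_character_def)

text \<open>On units, interpolate over \<open>R\<close>, which holds one representative of each unit
  class other than that of \<open>c\<close>. Off the units both sides vanish, since \<open>c\<close>
  is a unit.\<close>

lemma residue_indicator_in_character_span:
  assumes q: "q > 0" and c: "coprime c (int q)"
  shows "(\<lambda>n. if [n = c] (mod int q) then 1 else 0) \<in> character_span q"
proof -
  define R where "R = {e\<in>{0..<int q}. coprime e (int q) \<and> \<not> [c = e] (mod int q)}"
  have "finite R" unfolding R_def by (rule finite_subset[of _ "{0..<int q}"]) auto
  then obtain \<phi> where phi: "\<phi> \<in> character_span q" "\<phi> c = 1" "\<forall>e\<in>R. \<phi> e = 0"
    using character_span_vanishing[OF q c, of R] unfolding R_def by blast
  have "\<phi> n = (if [n = c] (mod int q) then 1 else 0)" for n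
  proof (cases "coprime n (int q)")
    case False
    hence "\<not> [n = c] (mod int q)" using c by (metis cong_imp_coprime cong_sym)
    thus ?thesis using character_span_not_coprime[OF phi(1) False] by simp
  next
    case True
    have "n mod int q \<in> R" if "\<not> [n = c] (mod int q)"
    proof -
      have "\<not> [c = n mod int q] (mod int q)" using that by (simp add: cong_def)
      thus ?thesis using q True by (simp add: R_def)
    qed
    moreover have "\<phi> (n mod int q) = \<phi> n"
      by (rule character_span_cong[OF phi(1)]) (simp add: cong_def)
    moreover have "\<phi> n = \<phi> c" if "[n = c] (mod int q)"
      using that by (rule character_span_cong[OF phi(1)])
    ultimately show ?thesis using phi(2,3) by (cases "[n = c] (mod int q)") auto
  qed
  hence "\<phi> = (\<lambda>n. if [n = c] (mod int q) then 1 else 0)" by blast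
  with phi show ?thesis by simp
qed

subsection \<open>Densities of sets sieved by unitary prime powers\<close>

definition counting :: "nat set \<Rightarrow> nat \<Rightarrow> real" where
  "counting A n = real (card {m\<in>A. m \<le> n})"

definition seq_density :: "nat set \<Rightarrow> real \<Rightarrow> bool" where
  "seq_density A \<delta> \<longleftrightarrow> (\<lambda>n. counting A n / real n) \<longlonglongrightarrow> \<delta>"

lemma counting_mono: "A \<subseteq> B \<Longrightarrow> counting A n \<le> counting B n"
  unfolding counting_def by (intro of_nat_mono card_mono) auto

lemma counting_nonneg: "counting A n \<ge> 0"
  by (simp add: counting_def)

lemma counting_Un_le: "counting (A \<union> B) n \<le> counting A n + counting B n"
proof -
  have "{m\<in>A \<union> B. m \<le> n} = {m\<in>A. m \<le> n} \<union> {m\<in>B. m \<le> n}" by auto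
  hence "card {m\<in>A \<union> B. m \<le> n} \<le> card {m\<in>A. m \<le> n} + card {m\<in>B. m \<le> n}"
    by (simp only: card_Un_le)
  thus ?thesis unfolding counting_def by linarith
qed

lemma counting_UN_le:
  "finite I \<Longrightarrow> counting (\<Union>i\<in>I. E i) n \<le> (\<Sum>i\<in>I. counting (E i) n)"
proof (induction I rule: finite_induct)
  case empty thus ?case by (simp add: counting_def)
next
  case (insert i I)
  thus ?case using counting_Un_le[of "E i" "\<Union>i\<in>I. E i" n] by simp
qed

text \<open>The count at a real \<open>x\<close> is the count at its floor, and
  \<open>floor x / x\<close> tends to \<open>1\<close>, so limits along the integers
  suffice.\<close>

lemma has_natural_densityI:
  assumes "seq_density A \<delta>"
  shows "has_natural_density A \<delta>"
proof -
  have fl: "filterlim (\<lambda>x::real. nat \<lfloor>x\<rfloor>) sequentially at_top"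
    by (intro filterlim_compose[OF filterlim_nat_sequentially filterlim_floor_sequentially])
  have 1: "((\<lambda>x::real. counting A (nat \<lfloor>x\<rfloor>) / real (nat \<lfloor>x\<rfloor>)) \<longlongrightarrow> \<delta>) at_top"
    using filterlim_compose[OF assms[unfolded seq_density_def] fl] .
  have 2: "((\<lambda>x::real. real (nat \<lfloor>x\<rfloor>) / x) \<longlongrightarrow> 1) at_top"
  proof (rule tendsto_sandwich)
    show "\<forall>\<^sub>F x::real in at_top. 1 - 1 / x \<le> real (nat \<lfloor>x\<rfloor>) / x"
      using eventually_gt_at_top[of 0]
    proof eventually_elim
      fix x :: real assume x: "x > 0"
      hence "1 - 1 / x = (x - 1) / x" by (simp add: field_simps)
      also have "\<dots> \<le> real (nat \<lfloor>x\<rfloor>) / x" using x by (intro divide_right_mono) linarith+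
      finally show "1 - 1 / x \<le> real (nat \<lfloor>x\<rfloor>) / x" .
    qed
    show "\<forall>\<^sub>F x::real in at_top. real (nat \<lfloor>x\<rfloor>) / x \<le> 1"
      using eventually_gt_at_top[of 0]
      by eventually_elim auto
    have "((\<lambda>x::real. 1 / x) \<longlongrightarrow> 0) at_top"
      by (rule tendsto_divide_0[OF tendsto_const]) (simp add: filterlim_ident filterlim_at_top_imp_at_infinity)
    from tendsto_diff[OF tendsto_const[of 1] this]
    show "((\<lambda>x::real. 1 - 1 / x) \<longlongrightarrow> 1) at_top" by simp
  qed simp
  have "((\<lambda>x::real. counting A (nat \<lfloor>x\<rfloor>) / real (nat \<lfloor>x\<rfloor>) * (real (nat \<lfloor>x\<rfloor>) / x)) \<longlongrightarrow> \<delta>) at_top"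
    using tendsto_mult[OF 1 2] by simp
  moreover have "\<forall>\<^sub>F x::real in at_top. counting A (nat \<lfloor>x\<rfloor>) / real (nat \<lfloor>x\<rfloor>) * (real (nat \<lfloor>x\<rfloor>) / x)
      = real (card {n \<in> A. real n \<le> x}) / x"
    using eventually_ge_at_top[of 1]
  proof eventually_elim
    fix x :: real assume x: "x \<ge> 1"
    have "{n \<in> A. real n \<le> x} = {n \<in> A. n \<le> nat \<lfloor>x\<rfloor>}"
      using x by (auto simp: le_nat_iff le_floor_iff)
    moreover have "nat \<lfloor>x\<rfloor> > 0" using x by linarith
    ultimately show "counting A (nat \<lfloor>x\<rfloor>) / real (nat \<lfloor>x\<rfloor>) * (real (nat \<lfloor>x\<rfloor>) / x)
      = real (card {n \<in> A. real n \<le> x}) / x"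
      unfolding counting_def by (cases "nat \<lfloor>x\<rfloor>") (simp_all del: of_nat_nat of_nat_Suc)
  qed
  ultimately show ?thesis unfolding has_natural_density_def
    by (rule Lim_transform_eventually)
qed

lemma ratio_limit_of_bounded_error:
  fixes f :: "nat \<Rightarrow> real"
  assumes "\<And>n. \<bar>f n - \<delta> * real n\<bar> \<le> K"
  shows "(\<lambda>n. f n / real n) \<longlonglongrightarrow> \<delta>"
proof -
  have "(\<lambda>n. f n / real n - \<delta>) \<longlonglongrightarrow> 0"
  proof (rule Lim_null_comparison)
    show "\<forall>\<^sub>F n in sequentially. norm (f n / real n - \<delta>) \<le> K / real n"
      using eventually_gt_at_top[of 0]
    proof eventually_elim
      fix n :: nat assume "n > 0"
      hence "f n / real n - \<delta> = (f n - \<delta> * real n) / real n" by (simp add: field_simps)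
      thus "norm (f n / real n - \<delta>) \<le> K / real n"
        using assms[of n] \<open>n > 0\<close> by (simp add: divide_right_mono)
    qed
  qed (rule lim_const_over_n)
  thus ?thesis by (simp add: LIM_zero_iff)
qed

lemma periodic_times:
  assumes "\<And>n::nat. n + M \<in> Y \<longleftrightarrow> n \<in> Y"
  shows "n + M * j \<in> Y \<longleftrightarrow> n \<in> Y"
proof (induction j)
  case (Suc j)
  thus ?case using assms[of "n + M * j"] by (simp add: add_ac)
qed simp

text \<open>Full periods contribute exactly \<open>\<kappa>\<close> each and an incomplete one a
  bounded amount. As \<open>f\<close> counts below \<open>n\<close> while \<open>counting\<close>
  includes \<open>n\<close>, the error bound grows from \<open>M\<close> to
  \<open>M + 1\<close>.\<close>

lemma seq_density_periodic:
  assumes M: "M > 0" and per: "\<And>n. n + M \<in> Y \<longleftrightarrow> n \<in> Y"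
  shows "seq_density Y (real (card (Y \<inter> {..<M})) / real M)"
proof -
  define f where "f n = card (Y \<inter> {..<n})" for n
  define \<kappa> where "\<kappa> = f M"
  have f_Suc: "f (Suc n) = f n + (if n \<in> Y then 1 else 0)" for n
    by (auto simp: f_def lessThan_Suc Int_insert_right)
  have f_le: "f n \<le> n" for n
    by (induction n) (auto simp: f_Suc, simp add: f_def)
  have shift: "f (n + M) = f n + \<kappa>" for n
    by (induction n) (auto simp: f_Suc per \<kappa>_def, simp add: f_def)
  have shift': "f (r + M * j) = f r + \<kappa> * j" for r j
  proof (induction j)
    case (Suc j)
    thus ?case using shift[of "r + M * j"] by (simp add: add_ac)
  qed simp
  have bound: "\<bar>real (f n) - real \<kappa> / M * real n\<bar> \<le> M" for n
  proof -
    define r j where "r = n mod M" and "j = n div M"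
    have n: "n = r + M * j" and r: "r < M" using M by (auto simp: r_def j_def)
    have "real (f n) - real \<kappa> / M * real n = real (f r) - real \<kappa> / M * real r"
      using M by (simp add: n shift' field_simps)
    moreover have "real (f r) \<le> M" using f_le[of r] r by linarith
    moreover have "real \<kappa> / M \<le> 1" using f_le[of M] M by (simp add: \<kappa>_def)
    hence "real \<kappa> / M * real r \<le> 1 * real r" by (intro mult_right_mono) auto
    moreover have "real \<kappa> / M * real r \<ge> 0" by simp
    ultimately show ?thesis using r by linarith
  qed
  have cnt: "counting Y n = f (Suc n)" for n
    unfolding counting_def f_def by (intro arg_cong[of _ _ "\<lambda>A. real (card A)"]) auto
  have "\<bar>counting Y n - real \<kappa> / M * real n\<bar> \<le> M + 1" for n
    using bound[of n] f_Suc[of n] by (auto simp: cnt)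
  from ratio_limit_of_bounded_error[OF this]
  show ?thesis by (simp add: seq_density_def \<kappa>_def f_def)
qed

lemma seq_density_residue_class:
  assumes M: "M > 0"
  shows "seq_density {n. [n = s] (mod M)} (1 / real M)"
proof -
  have "{n. [n = s] (mod M)} \<inter> {..<M} = {s mod M}"
    using M by (auto simp: cong_def)
  thus ?thesis using seq_density_periodic[OF M, of "{n. [n = s] (mod M)}"]
    by (simp add: cong_def)
qed

lemma seq_density_le:
  assumes "seq_density A \<alpha>" "seq_density B \<beta>" "A \<subseteq> B"
  shows "\<alpha> \<le> \<beta>"
  using assms unfolding seq_density_def
  by (intro LIMSEQ_le[of _ \<alpha> _ \<beta>]) (auto intro!: exI[of _ 0] divide_right_mono counting_mono)

lemma seq_density_nonneg:
  assumes "seq_density A \<alpha>" shows "\<alpha> \<ge> 0"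
  using assms unfolding seq_density_def
  by (rule LIMSEQ_le_const) (auto intro!: exI[of _ 0] divide_nonneg_nonneg counting_nonneg)

text \<open>The densities of the \<open>X k\<close> decrease and so converge. The error
  \<open>r k * real n\<close> is uniform in \<open>n\<close> after division by \<open>n\<close>,
  which allows the limits in \<open>k\<close> and \<open>n\<close> to be exchanged.\<close>

lemma seq_density_decreasing_limit:
  assumes dec: "\<And>k. X (Suc k) \<subseteq> X k" and sub: "\<And>k. Y \<subseteq> X k"
    and dens: "\<And>k. seq_density (X k) (\<delta> k)"
    and err: "\<And>k n. counting (X k) n \<le> counting Y n + r k * real n" and r: "r \<longlonglongrightarrow> 0"
  obtains \<delta>' where "\<delta> \<longlonglongrightarrow> \<delta>'" "seq_density Y \<delta>'"
proof -
  have "decseq \<delta>"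
    by (intro decseq_SucI seq_density_le[OF dens dens dec])
  then obtain \<delta>' where lim: "\<delta> \<longlonglongrightarrow> \<delta>'"
    using decseq_convergent[of \<delta> 0] seq_density_nonneg[OF dens] by metis
  have "(\<lambda>n. counting Y n / real n) \<longlonglongrightarrow> \<delta>'"
  proof (rule LIMSEQ_I)
    fix e :: real assume "e > 0"
    have "\<forall>\<^sub>F k in sequentially. \<bar>r k\<bar> < e / 3"
      using tendstoD[OF r, of "e / 3"] \<open>e > 0\<close> by (simp add: dist_real_def)
    moreover have "\<forall>\<^sub>F k in sequentially. \<bar>\<delta> k - \<delta>'\<bar> < e / 3"
      using tendstoD[OF lim, of "e / 3"] \<open>e > 0\<close> by (simp add: dist_real_def)
    ultimately obtain k where k: "\<bar>r k\<bar> < e / 3" "\<bar>\<delta> k - \<delta>'\<bar> < e / 3"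
      using eventually_conj eventually_happens' sequentially_bot by blast
    obtain n0 where n0: "\<And>n. n \<ge> n0 \<Longrightarrow> \<bar>counting (X k) n / real n - \<delta> k\<bar> < e / 3"
      using LIMSEQ_D[OF dens[of k, unfolded seq_density_def], of "e / 3"] \<open>e > 0\<close> by auto
    show "\<exists>n0. \<forall>n\<ge>n0. norm (counting Y n / real n - \<delta>') < e"
    proof (intro exI[of _ "max 1 n0"] allI impI)
      fix n assume n: "n \<ge> max 1 n0"
      have "counting Y n / real n \<le> counting (X k) n / real n"
        by (intro divide_right_mono counting_mono sub) auto
      moreover have "counting (X k) n / real n \<le> (counting Y n + r k * real n) / real n"
        by (intro divide_right_mono err) auto
      hence "counting (X k) n / real n \<le> counting Y n / real n + r k"
        using n by (simp add: add_divide_distrib)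
      ultimately show "norm (counting Y n / real n - \<delta>') < e"
        using n0[of n] n k unfolding real_norm_def by linarith
    qed
  qed
  with lim that show ?thesis by (simp add: seq_density_def)
qed

lemma sum_le_tail:
  fixes c :: "nat \<Rightarrow> real"
  assumes "finite I" "\<And>b. b \<in> I \<Longrightarrow> K \<le> b" "\<And>b. c b \<ge> 0" "summable c"
  shows "(\<Sum>b\<in>I. c b) \<le> (\<Sum>i. c (i + K))"
proof -
  have "(\<Sum>b\<in>I. c b) = (\<Sum>i\<in>(\<lambda>b. b - K) ` I. c (i + K))"
    using assms(2) by (subst sum.reindex) (auto simp: inj_on_def intro: eq_diff_iff[THEN iffD1])
  also have "\<dots> \<le> (\<Sum>i. c (i + K))"
    using assms by (intro sum_le_suminf) (auto simp: summable_iff_shift)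
  finally show ?thesis .
qed

text \<open>For \<open>b = p ^ j\<close> with \<open>p\<close> prime and \<open>j > 0\<close> these
  are the numbers in which \<open>p\<close> has exponent exactly \<open>j\<close>. For
  \<open>b > 1\<close> the number \<open>0\<close> is not among them.\<close>

definition unitary_multiples :: "nat \<Rightarrow> nat set" where
  "unitary_multiples b = {n. b dvd n \<and> coprime b (n div b)}"

text \<open>Adding a multiple of \<open>b * b\<close> to a multiple of \<open>b\<close> shifts the
  cofactor by a multiple of \<open>b\<close>, which preserves its coprimality to
  \<open>b\<close>.\<close>

lemma unitary_multiples_periodic:
  assumes "b > 0"
  shows "n + b * b * j \<in> unitary_multiples b \<longleftrightarrow> n \<in> unitary_multiples b"
proof (cases "b dvd n")
  case True
  then obtain m where m: "n = b * m" by auto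
  have "n + b * b * j = b * (m + b * j)" by (simp add: m algebra_simps)
  hence "(n + b * b * j) div b = m + b * j" using assms by simp
  moreover have "coprime b (m + b * j) \<longleftrightarrow> coprime b m"
    by (metis coprime_iff_gcd_eq_1 gcd_add_mult mult.commute add.commute)
  moreover have "b dvd n + b * b * j" by (simp add: m)
  ultimately show ?thesis using assms by (simp add: unitary_multiples_def m)
next
  case False
  moreover have "\<not> b dvd n + b * b * j"
    using False by (simp add: dvd_add_left_iff mult.assoc)
  ultimately show ?thesis by (simp add: unitary_multiples_def)
qed

lemma counting_unitary_multiples_le:
  assumes "b > 1"
  shows "counting (unitary_multiples b) n \<le> real n / real b"
proof -
  have "{m\<in>unitary_multiples b. m \<le> n} \<subseteq> (\<lambda>j. b * j) ` {1..n div b}"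
  proof
    fix m assume m: "m \<in> {m\<in>unitary_multiples b. m \<le> n}"
    then obtain j where j: "m = b * j" by (auto simp: unitary_multiples_def)
    with m assms have "j \<noteq> 0" by (cases "j = 0") (auto simp: unitary_multiples_def)
    moreover have "j \<le> n div b" using m assms j
      by (simp add: less_eq_div_iff_mult_less_eq mult.commute)
    ultimately show "m \<in> (\<lambda>j. b * j) ` {1..n div b}" using j by auto
  qed
  hence "card {m\<in>unitary_multiples b. m \<le> n} \<le> n div b"
    using surj_card_le[OF finite_atLeastAtMost] by fastforce
  hence "counting (unitary_multiples b) n \<le> real (n div b)"
    unfolding counting_def by (rule of_nat_mono)
  also have "\<dots> \<le> real n / real b" by (rule of_nat_div_le_of_nat)
  finally show ?thesis .
qed

text \<open>Sieving by the members of \<open>B\<close> below \<open>k\<close> leaves a periodic set.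
  The remaining members remove at most the proportion \<open>\<Sum>b\<ge>k. 1 / b\<close>, a tail of
  a convergent series.\<close>

lemma seq_density_unitary_sieve:
  fixes B D :: "nat set"
  assumes M: "M > 0" and per: "\<And>n. n + M \<in> D \<longleftrightarrow> n \<in> D"
    and B: "\<And>b. b \<in> B \<Longrightarrow> b > 1"
    and summ: "summable (\<lambda>b. if b \<in> B then 1 / real b else 0)"
  defines "X \<equiv> \<lambda>k. D - (\<Union>b\<in>B \<inter> {..<k}. unitary_multiples b)"
  obtains \<delta> \<delta>' where "\<And>k. seq_density (X k) (\<delta> k)" "\<delta> \<longlonglongrightarrow> \<delta>'"
    "seq_density (D - (\<Union>b\<in>B. unitary_multiples b)) \<delta>'"
proof -
  define c where "c = (\<lambda>b. if b \<in> B then 1 / real b else 0)"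
  define Y where "Y = D - (\<Union>b\<in>B. unitary_multiples b)"
  have "\<exists>M>0. \<forall>n. n + M \<in> X k \<longleftrightarrow> n \<in> X k" for k
  proof (induction k)
    case 0
    thus ?case using M per by (auto simp: X_def)
  next
    case (Suc k)
    then obtain L where L: "L > 0" "\<And>n. n + L \<in> X k \<longleftrightarrow> n \<in> X k" by blast
    show ?case
    proof (cases "k \<in> B")
      case True
      hence X: "X (Suc k) = X k - unitary_multiples k"
        by (auto simp: X_def lessThan_Suc Int_insert_right)
      have k: "k > 0" using B[OF True] by simp
      have "n + L * (k * k) \<in> X (Suc k) \<longleftrightarrow> n \<in> X (Suc k)" for n
        using periodic_times[OF L(2), of n "k * k"] unitary_multiples_periodic[OF k, of n L]
        by (simp add: X mult_ac)
      thus ?thesis using L(1) k by (intro exI[of _ "L * (k * k)"]) auto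
    next
      case False
      hence "X (Suc k) = X k" by (auto simp: X_def lessThan_Suc Int_insert_right)
      thus ?thesis using L by auto
    qed
  qed
  hence "\<exists>\<delta>. seq_density (X k) \<delta>" for k using seq_density_periodic by metis
  then obtain \<delta> where dens: "\<And>k. seq_density (X k) (\<delta> k)" by metis
  define r where "r k = (\<Sum>i. c (i + k))" for k
  have c0: "c i \<ge> 0" for i by (simp add: c_def)
  have summc: "summable c" using summ by (simp add: c_def)
  have "r \<longlonglongrightarrow> 0" unfolding r_def by (rule suminf_exist_split2[OF summc])
  moreover have "counting (X k) n \<le> counting Y n + r k * real n" for k n
  proof -
    \<comment> \<open>A unitary multiple of \<open>b > 1\<close> is positive and hence at least
      \<open>b\<close>, so up to \<open>n\<close> only the finitely many \<open>b \<le> n\<close>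
      matter.\<close>
    define I where "I = {b\<in>B. k \<le> b \<and> b \<le> n}"
    have "counting (X k) n \<le> counting (Y \<union> (\<Union>b\<in>I. unitary_multiples b)) n"
      unfolding counting_def
    proof (intro of_nat_mono card_mono subsetI)
      fix m assume m: "m \<in> {m \<in> X k. m \<le> n}"
      have "m \<in> (\<Union>b\<in>I. unitary_multiples b)" if mY: "m \<notin> Y"
      proof -
        obtain b where b: "b \<in> B" "m \<in> unitary_multiples b" "k \<le> b"
          using m mY unfolding X_def Y_def by (blast intro: leI)
        have "m \<noteq> 0" using b B[OF b(1)] by (cases "m = 0") (auto simp: unitary_multiples_def)
        hence "b \<le> m" using b by (auto simp: unitary_multiples_def intro: dvd_imp_le)
        with b m show ?thesis by (auto simp: I_def)
      qed
      with m show "m \<in> {m \<in> Y \<union> (\<Union>b\<in>I. unitary_multiples b). m \<le> n}" by blast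
    qed auto
    also have "\<dots> \<le> counting Y n + counting (\<Union>b\<in>I. unitary_multiples b) n"
      by (rule counting_Un_le)
    also have "counting (\<Union>b\<in>I. unitary_multiples b) n \<le> (\<Sum>b\<in>I. counting (unitary_multiples b) n)"
      by (rule counting_UN_le) (simp add: I_def)
    also have "\<dots> \<le> (\<Sum>b\<in>I. c b * real n)"
    proof (intro sum_mono)
      fix b assume "b \<in> I"
      hence b: "b \<in> B" by (simp add: I_def)
      show "counting (unitary_multiples b) n \<le> c b * real n"
        using counting_unitary_multiples_le[OF B[OF b], of n] b by (simp add: c_def)
    qed
    also have "\<dots> = (\<Sum>b\<in>I. c b) * real n" by (simp add: sum_distrib_right)
    also have "(\<Sum>b\<in>I. c b) \<le> r k"
      unfolding r_def by (rule sum_le_tail) (auto simp: I_def c0 summc)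
    finally show ?thesis by (simp add: mult_right_mono)
  qed
  moreover have "X (Suc k) \<subseteq> X k" "Y \<subseteq> X k" for k
    by (auto simp: X_def Y_def)
  ultimately obtain \<delta>' where "\<delta> \<longlonglongrightarrow> \<delta>'" "seq_density Y \<delta>'"
    using seq_density_decreasing_limit[of X Y \<delta> r] dens by metis
  with dens that show ?thesis unfolding Y_def by blast
qed


text \<open>
  Positivity of the density: in the progression \<open>n = d (mod q)\<close>, \<open>n = 1 (mod P)\<close> with \<open>P\<close> a product of
  many primes, only large elements of \<open>B\<close> can divide \<open>n\<close>.
\<close>

lemma seq_density_unitary_sieve_pos:
  fixes B :: "nat set" and d q :: nat
  assumes q: "q > 0" and d: "coprime d q"
    and B: "\<And>b. b \<in> B \<Longrightarrow> primepow b"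
    and summ: "summable (\<lambda>b. if b \<in> B then 1 / real b else 0)"
  shows "\<exists>\<delta>>0. seq_density ({n. [n = d] (mod q)} - (\<Union>b\<in>B. unitary_multiples b)) \<delta>"
proof -
  define c where "c = (\<lambda>b. if b \<in> B then 1 / real b else 0)"
  have c0: "c b \<ge> 0" for b by (simp add: c_def)
  have summc: "summable c" using summ by (simp add: c_def)
  have B1: "b > 1" if "b \<in> B" for b using primepow_gt_Suc_0[OF B[OF that]] by simp
  have "(\<lambda>k. \<Sum>i. c (i + k)) \<longlonglongrightarrow> 0" by (rule suminf_exist_split2[OF summc])
  hence "\<forall>\<^sub>F k in sequentially. \<bar>\<Sum>i. c (i + k)\<bar> < 1 / 2"
    by (auto dest!: tendstoD[where e = "1 / 2"] simp: dist_real_def)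
  \<comment> \<open>The bound \<open>1 / 2\<close> lets at least half of the progression
    \<open>D\<close>, chosen below, survive the sieve.\<close>
  then obtain K where K: "\<bar>\<Sum>i. c (i + K)\<bar> < 1 / 2"
    using eventually_happens' sequentially_bot by blast
  \<comment> \<open>Being \<open>1\<close> modulo \<open>P\<close> excludes divisibility by these
    primes; primes dividing \<open>q\<close> are already excluded because \<open>n\<close> is
    congruent to the unit \<open>d\<close>.\<close>
  define P where "P = \<Prod>{p. prime p \<and> p < K \<and> \<not> p dvd q}"
  have fin: "finite {p. prime p \<and> p < K \<and> \<not> p dvd q}" by simp
  have P0: "P > 0" unfolding P_def by (intro prod_pos) (auto intro: prime_gt_0_nat)
  have cop: "coprime q P" unfolding P_def
    by (intro prod_coprime_right) (auto intro: prime_imp_coprime simp: coprime_commute)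
  define M where "M = q * P"
  have M: "M > 0" using q P0 by (simp add: M_def)
  obtain r where r: "[r = d] (mod q)" "[r = 1] (mod P)"
    using binary_chinese_remainder_nat[OF cop] by blast
  define D where "D = {n. [n = r] (mod M)}"
  have D_q: "[n = d] (mod q)" and D_P: "[n = 1] (mod P)" if "n \<in> D" for n
    using that r cong_modulus_mult_nat[of n r q P] cong_modulus_mult_nat[of n r P q]
    by (auto simp: D_def M_def mult.commute intro: cong_trans)
  have D_not_dvd: "\<not> p dvd n" if "n \<in> D" "prime p" "p dvd q \<or> p < K" for n p
  proof
    assume pn: "p dvd n"
    show False
    proof (cases "p dvd q")
      case True
      hence "[n = d] (mod p)" using D_q[OF that(1)] cong_dvd_modulus_nat by blast
      hence "p dvd d" using pn by (simp add: cong_dvd_iff)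
      with True d \<open>prime p\<close> show False by (meson coprime_common_divisor not_prime_unit)
    next
      case False
      hence "p dvd P" using that fin unfolding P_def by (intro dvd_prodI) auto
      hence "[n = 1] (mod p)" using D_P[OF that(1)] cong_dvd_modulus_nat by blast
      hence "p dvd 1" using pn by (simp add: cong_dvd_iff)
      with \<open>prime p\<close> show False by simp
    qed
  qed
  define X where "X k = D - (\<Union>b\<in>B \<inter> {..<k}. unitary_multiples b)" for k
  have "n + M \<in> D \<longleftrightarrow> n \<in> D" for n by (simp add: D_def cong_def)
  from seq_density_unitary_sieve[OF M this B1 summ]
  obtain \<delta> \<delta>' where dens: "\<And>k. seq_density (X k) (\<delta> k)" "\<delta> \<longlonglongrightarrow> \<delta>'"
    "seq_density (D - (\<Union>b\<in>B. unitary_multiples b)) \<delta>'"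
    unfolding X_def by metis
  \<comment> \<open>\<open>e b\<close> bounds the density of the multiples of \<open>b\<close>
    inside \<open>D\<close>. If \<open>b\<close> is a power of a prime that divides \<open>q\<close>
    or is below \<open>K\<close>, there are none; otherwise \<open>b\<close> is prime to
    \<open>M\<close>, and the Chinese remainder theorem gives exactly
    \<open>1 / (b * M)\<close>.\<close>
  define e where "e b = (if b \<ge> K then c b / real M else 0)" for b
  have dvd_dens: "\<exists>\<alpha>\<le>e b. seq_density (D \<inter> {n. b dvd n}) \<alpha>" if b: "b \<in> B" for b
  proof -
    obtain p j where pj: "prime p" "j > 0" "b = p ^ j"
      using B[OF b] by (auto simp: primepow_def)
    show ?thesis
    proof (cases "p dvd q \<or> p < K")
      case True
      have "D \<inter> {n. b dvd n} = {}"
        using D_not_dvd[OF _ pj(1) True] pj by (auto dest: dvd_power_le)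
          (metis dvd_power dvd_trans)
      moreover have "e b \<ge> 0" by (simp add: e_def c0)
      ultimately show ?thesis by (intro exI[of _ 0]) (simp add: seq_density_def counting_def)
    next
      case False
      have "p \<le> b" using pj by (metis dvd_imp_le dvd_power prime_gt_0_nat zero_less_power)
      with False have bK: "b \<ge> K" by simp
      have "\<not> p dvd P"
      proof
        assume "p dvd P"
        then obtain p' where "p' \<in> {p. prime p \<and> p < K \<and> \<not> p dvd q}" "p dvd p'"
          unfolding P_def using prime_dvd_prod_iff[OF fin pj(1), of "\<lambda>x. x"] by auto
        hence "p = p'" using pj(1) by (auto intro: primes_dvd_imp_eq)
        with \<open>p' \<in> _\<close> show False using False by simp
      qed
      hence "coprime p M" using False pj(1) by (simp add: M_def prime_imp_coprime)
      hence copb: "coprime b M" by (simp add: pj)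
      obtain s where s: "[s = 0] (mod b)" "[s = r] (mod M)"
        using binary_chinese_remainder_nat[OF copb] by blast
      have "D \<inter> {n. b dvd n} = {n. [n = s] (mod (b * M))}"
      proof (intro equalityI subsetI)
        fix n assume "n \<in> D \<inter> {n. b dvd n}"
        hence "[n = s] (mod b)" "[n = s] (mod M)" using s
          by (auto simp: D_def cong_0_iff cong_sym_eq intro: cong_trans dest: cong_sym)
            (metis cong_0_iff cong_sym cong_trans)
        thus "n \<in> {n. [n = s] (mod (b * M))}"
          using coprime_cong_mult_nat copb by blast
      next
        fix n assume "n \<in> {n. [n = s] (mod (b * M))}"
        hence "[n = s] (mod b)" "[n = s] (mod M)"
          using cong_modulus_mult_nat[of n s b M] cong_modulus_mult_nat[of n s M b]
          by (auto simp: mult.commute)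
        thus "n \<in> D \<inter> {n. b dvd n}" using s cong_trans cong_0_iff
          unfolding D_def by (metis IntI mem_Collect_eq)
      qed
      moreover have "b * M > 0" using M B1[OF b] by simp
      ultimately have "seq_density (D \<inter> {n. b dvd n}) (1 / real (b * M))"
        using seq_density_residue_class by metis
      moreover have "e b = 1 / real (b * M)" using bK b by (simp add: e_def c_def)
      ultimately show ?thesis by auto
    qed
  qed
  then obtain \<alpha> where alpha: "\<And>b. b \<in> B \<Longrightarrow> \<alpha> b \<le> e b"
    "\<And>b. b \<in> B \<Longrightarrow> seq_density (D \<inter> {n. b dvd n}) (\<alpha> b)" by metis
  \<comment> \<open>Out of the density \<open>1 / M\<close> of \<open>D\<close>, multiples of
    members of \<open>B\<close> take away at most \<open>1 / M\<close> times the tail from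
    \<open>K\<close> on, which is below \<open>1 / 2\<close>.\<close>
  have "1 / (2 * real M) \<le> \<delta> k" for k
  proof -
    define I where "I = B \<inter> {..<k}"
    have finI: "finite I" by (simp add: I_def)
    have "counting D n \<le> counting (X k) n + (\<Sum>b\<in>I. counting (D \<inter> {n. b dvd n}) n)" for n
    proof -
      have "counting D n \<le> counting (X k \<union> (\<Union>b\<in>I. D \<inter> {n. b dvd n})) n"
        by (intro counting_mono) (auto simp: X_def I_def unitary_multiples_def)
      also have "\<dots> \<le> counting (X k) n + counting (\<Union>b\<in>I. D \<inter> {n. b dvd n}) n"
        by (rule counting_Un_le)
      finally show ?thesis using counting_UN_le[OF finI, of "\<lambda>b. D \<inter> {n. b dvd n}" n] by linarith
    qed
    hence le: "counting D n / n \<le> counting (X k) n / n + (\<Sum>b\<in>I. counting (D \<inter> {n. b dvd n}) n / n)" for n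
      by (metis add_divide_distrib divide_right_mono of_nat_0_le_iff sum_divide_distrib)
    have "(\<lambda>n. counting (X k) n / n + (\<Sum>b\<in>I. counting (D \<inter> {n. b dvd n}) n / n))
        \<longlonglongrightarrow> \<delta> k + (\<Sum>b\<in>I. \<alpha> b)"
      using dens(1)[of k] alpha(2) unfolding seq_density_def
      by (intro tendsto_intros) (auto simp: I_def)
    moreover have "(\<lambda>n. counting D n / n) \<longlonglongrightarrow> 1 / real M"
      using seq_density_residue_class[OF M, of r] by (simp add: seq_density_def D_def)
    ultimately have "1 / real M \<le> \<delta> k + (\<Sum>b\<in>I. \<alpha> b)"
      using le by (intro LIMSEQ_le) auto
    also have "(\<Sum>b\<in>I. \<alpha> b) \<le> (\<Sum>b\<in>I. e b)"
      using alpha(1) by (intro sum_mono) (auto simp: I_def)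
    also have "(\<Sum>b\<in>I. e b) = (\<Sum>b\<in>{b\<in>I. b \<ge> K}. e b)"
      using finI by (intro sum.mono_neutral_right) (auto simp: e_def)
    also have "\<dots> = (\<Sum>b\<in>{b\<in>I. b \<ge> K}. c b) / real M"
      by (auto simp: e_def sum_divide_distrib intro!: sum.cong)
    also have "(\<Sum>b\<in>{b\<in>I. b \<ge> K}. c b) \<le> (\<Sum>i. c (i + K))"
      by (rule sum_le_tail) (use finI in \<open>auto simp: c0 summc\<close>)
    also have "\<dots> \<le> 1 / 2" using K by simp
    finally show ?thesis using M by (simp add: divide_right_mono field_simps)
  qed
  hence "\<delta>' \<ge> 1 / (2 * real M)" using dens(2) by (intro LIMSEQ_le_const) auto
  hence pos: "\<delta>' > 0" using M by (smt (verit) divide_pos_pos of_nat_0_less_iff)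
  \<comment> \<open>The whole progression modulo \<open>q\<close> has a sieved density by the same
    argument, and this density dominates the positive one found inside \<open>D\<close>.\<close>
  have "n + q \<in> {n. [n = d] (mod q)} \<longleftrightarrow> n \<in> {n. [n = d] (mod q)}" for n
    by (simp add: cong_def)
  from seq_density_unitary_sieve[OF q this B1 summ]
  obtain \<beta> where beta: "seq_density ({n. [n = d] (mod q)} - (\<Union>b\<in>B. unitary_multiples b)) \<beta>"
    by metis
  have "D - (\<Union>b\<in>B. unitary_multiples b) \<subseteq> {n. [n = d] (mod q)} - (\<Union>b\<in>B. unitary_multiples b)"
    using D_q by auto
  from seq_density_le[OF dens(3) beta this] pos beta show ?thesis by (intro exI[of _ \<beta>]) auto
qed


section \<open>Series over prime powers and zeros of multiplicative functions\<close>

lemma ln_le_2_sqrt: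
  assumes "x > 0" shows "ln x \<le> 2 * sqrt x"
proof -
  have "ln (sqrt x) \<le> sqrt x - 1" using assms by (intro ln_le_minus_one) simp
  moreover have "ln (sqrt x) = ln x / 2" using assms by (simp add: ln_sqrt)
  ultimately show ?thesis by simp
qed

lemma summable_ln_over_square: "summable (\<lambda>n::nat. ln (real n) / real n ^ 2)"
proof (rule summable_comparison_test)
  have "norm (ln (real n) / real n ^ 2) \<le> 2 * (real n powr (- 3 / 2))" for n :: nat
  proof (cases "n = 0")
    case False
    have "ln (real n) / real n ^ 2 \<le> 2 * sqrt (real n) / real n ^ 2"
      using False by (intro divide_right_mono ln_le_2_sqrt) auto
    also have "\<dots> = 2 * (real n powr (1 / 2) / real n powr 2)"
      using False by (simp add: powr_half_sqrt)
    also have "\<dots> = 2 * (real n powr (- 3 / 2))" by (simp only: powr_diff[symmetric]) simp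
    finally show ?thesis using False by simp
  qed simp
  thus "\<exists>N. \<forall>n\<ge>N. norm (ln (real n) / real n ^ 2) \<le> 2 * (real n powr (- 3 / 2))" by blast
  show "summable (\<lambda>n::nat. 2 * (real n powr (- 3 / 2)))"
    by (intro summable_mult) (simp add: summable_real_powr_iff)
qed

lemma geometric_tail_le:
  fixes x :: real
  assumes "0 \<le> x" "x \<le> 1 / 2"
  shows "(\<Sum>j\<in>{2..<n}. x ^ j) \<le> 2 * x ^ 2"
proof (cases "n \<ge> 2")
  case True
  \<comment> \<open>The subtracted term strengthens the claim so that the induction closes.\<close>
  have "(\<Sum>j\<in>{2..<m + 2}. x ^ j) \<le> 2 * x ^ 2 - 2 * x ^ (m + 2)" for m
  proof (induction m)
    case (Suc m)
    have "2 * x * x ^ (m + 2) \<le> 1 * x ^ (m + 2)"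
      using assms by (intro mult_right_mono) auto
    moreover have "(\<Sum>j\<in>{2..<Suc m + 2}. x ^ j) = (\<Sum>j\<in>{2..<m + 2}. x ^ j) + x ^ (m + 2)"
      by (simp add: sum.atLeastLessThan_Suc)
    ultimately show ?case using Suc by (simp add: mult.assoc)
  qed (simp add: power2_eq_square)
  moreover obtain m where "n = m + 2" using True by (metis le_add_diff_inverse2)
  ultimately have "(\<Sum>j\<in>{2..<n}. x ^ j) \<le> 2 * x ^ 2 - 2 * x ^ n" by blast
  moreover have "x ^ n \<ge> 0" using assms by simp
  ultimately show ?thesis by linarith
qed simp

text \<open>For each prime the powers with exponent at least \<open>2\<close> contribute a geometric
  tail of size at most \<open>2 * ln p / p ^ 2\<close>.\<close>

lemma summable_mangoldt_higher_powers:
  "summable (\<lambda>l. if prime l then 0 else mangoldt l / real l :: real)"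
proof -
  define f where "f = (\<lambda>l. if prime l then 0 else mangoldt l / real l :: real)"
  have f0: "f l \<ge> 0" for l by (simp add: f_def mangoldt_nonneg)
  define C where "C = (\<Sum>p::nat. ln (real p) / real p ^ 2)"
  have "(\<Sum>l<X. f l) \<le> 2 * C" for X
  proof -
    define R where "R = {p::nat. prime p \<and> p < X}"
    define T where "T = R \<times> {2..<X}"
    define S where "S = {l. l < X \<and> primepow l \<and> \<not> prime l}"
    define g where "g = (\<lambda>(p::nat, j::nat). p ^ j)"
    have finR: "finite R" by (simp add: R_def)
    have finT: "finite T" by (simp add: T_def finR)
    have S: "S \<subseteq> g ` T"
    proof
      fix l assume l: "l \<in> S"
      then obtain p j where pj: "prime p" "j > 0" "l = p ^ j"
        by (auto simp: S_def primepow_def)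
      have "j \<noteq> 1" using l pj by (auto simp: S_def)
      hence j2: "j \<ge> 2" using pj by simp
      have "p ^ 1 \<le> p ^ j" using pj prime_gt_0_nat[OF pj(1)] by (intro power_increasing) auto
      hence "p < X" using l pj by (simp add: S_def)
      \<comment> \<open>Bounding the exponent by \<open>X\<close> as well places all proper prime
        powers below \<open>X\<close> in the image of a finite box.\<close>
      have "j < 2 ^ j" by (rule less_exp)
      also have "2 ^ j \<le> p ^ j" using prime_ge_2_nat[OF pj(1)] by (intro power_mono) auto
      also have "p ^ j < X" using l pj by (simp add: S_def)
      finally have "j < X" .
      with \<open>p < X\<close> j2 pj show "l \<in> g ` T"
        by (auto simp: g_def T_def R_def intro!: image_eqI[of _ _ "(p, j)"])
    qed
    have fg: "f (g (p, j)) = ln p * (1 / real p) ^ j" if "p \<in> R" "j \<in> {2..<X}" for p j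
      using that mangoldt_primepow'[of p j, where ?'a = real]
      by (auto simp: f_def g_def R_def prime_power_iff power_divide)
    have "(\<Sum>l<X. f l) = (\<Sum>l\<in>S. f l)"
      by (intro sum.mono_neutral_right) (auto simp: S_def f_def mangoldt_def)
    also have "\<dots> \<le> (\<Sum>l\<in>g ` T. f l)"
      using S finT f0 by (intro sum_mono2) auto
    also have "\<dots> \<le> (\<Sum>x\<in>T. f (g x))"
      using sum_image_le[OF finT, of f g] f0 by (simp add: o_def)
    also have "\<dots> = (\<Sum>p\<in>R. \<Sum>j\<in>{2..<X}. f (g (p, j)))"
      unfolding T_def by (subst sum.cartesian_product) (auto intro!: sum.cong)
    also have "\<dots> = (\<Sum>p\<in>R. ln p * (\<Sum>j\<in>{2..<X}. (1 / real p) ^ j))"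
      by (auto simp: fg sum_distrib_left intro!: sum.cong)
    also have "\<dots> \<le> (\<Sum>p\<in>R. ln p * (2 * (1 / real p) ^ 2))"
    proof (intro sum_mono mult_left_mono geometric_tail_le)
      fix p assume "p \<in> R"
      hence "p \<ge> 2" by (auto simp: R_def prime_ge_2_nat)
      thus "1 / real p \<le> 1 / 2" "0 \<le> 1 / real p" "ln (real p) \<ge> 0" by (simp_all add: field_simps)
    qed
    also have "\<dots> = 2 * (\<Sum>p\<in>R. ln p / real p ^ 2)"
      by (simp add: sum_distrib_left power_divide mult_ac)
    also have "(\<Sum>p\<in>R. ln p / real p ^ 2) \<le> C"
    proof -
      have "ln (real n) / real n ^ 2 \<ge> 0" for n by (cases "n = 0") auto
      thus ?thesis unfolding C_def by (intro sum_le_suminf summable_ln_over_square finR) auto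
    qed
    finally show ?thesis by simp
  qed
  hence "summable f" by (intro summableI_nonneg_bounded f0)
  thus ?thesis by (simp add: f_def)
qed

text \<open>Split off an exact prime power \<open>p ^ j\<close> from \<open>n\<close>. Either
  \<open>h\<close> vanishes there, or it vanishes at the smaller cofactor \<open>m\<close>, and a
  unitary divisor of \<open>m\<close> is unitary in \<open>n\<close> because \<open>p\<close> does
  not divide \<open>m\<close>.\<close>

lemma multiplicative_zero_iff:
  fixes h :: "nat \<Rightarrow> real"
  assumes mult: "\<And>p j m. prime p \<Longrightarrow> \<not> p dvd m \<Longrightarrow> m > 0 \<Longrightarrow>
      h (p ^ j * m) = 0 \<longleftrightarrow> h (p ^ j) = 0 \<or> h m = 0"
    and one: "h 1 \<noteq> 0" and n: "n > 0"
  shows "h n = 0 \<longleftrightarrow> (\<exists>b. primepow b \<and> h b = 0 \<and> n \<in> unitary_multiples b)"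
proof
  assume "\<exists>b. primepow b \<and> h b = 0 \<and> n \<in> unitary_multiples b"
  then obtain p j where b: "prime p" "j > 0" "h (p ^ j) = 0" "n \<in> unitary_multiples (p ^ j)"
    by (auto simp: primepow_def)
  then obtain m where m: "n = p ^ j * m" "coprime (p ^ j) m"
    using prime_gt_0_nat[OF b(1)] by (auto simp: unitary_multiples_def elim!: dvdE)
  hence "coprime p m" using b(2) by simp
  hence "\<not> p dvd m" using b(1) by (meson coprime_common_divisor dvd_refl not_prime_unit)
  with mult[OF b(1) this, of j] m n b(3) show "h n = 0" by simp
next
  show "h n = 0 \<Longrightarrow> \<exists>b. primepow b \<and> h b = 0 \<and> n \<in> unitary_multiples b"
    using n
  proof (induction n rule: less_induct)
    case (less n)
    have "n \<noteq> 1" using less.prems one by auto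
    then obtain p where p: "prime p" "p dvd n" using prime_factor_nat by blast
    obtain m where m: "n = p ^ multiplicity p n * m" "\<not> p dvd m"
      using multiplicity_decompose'[of n p] less.prems p prime_gt_1_nat[OF p(1)] by auto
    define j where "j = multiplicity p n"
    have j: "j > 0" using p less.prems by (simp add: j_def prime_multiplicity_gt_zero_iff)
    have m0: "m > 0" using m less.prems by (cases m) auto
    have nm: "n = p ^ j * m" using m by (simp add: j_def)
    have cop: "coprime (p ^ j) m" using p(1) m(2) by (simp add: prime_imp_coprime)
    from mult[OF p(1) m(2) m0, of j] less.prems nm consider "h (p ^ j) = 0" | "h m = 0" by auto
    thus ?case
    proof cases
      case 1
      have "n \<in> unitary_multiples (p ^ j)"
        using cop prime_gt_0_nat[OF p(1)] by (simp add: unitary_multiples_def nm)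
      with 1 p j show ?thesis by (auto intro!: exI[of _ "p ^ j"])
    next
      case 2
      have "1 < p ^ j" by (rule one_less_power[OF prime_gt_1_nat[OF p(1)] j])
      hence "m < n" using m0 by (simp add: nm)
      from less.IH[OF this 2 m0] obtain b where b: "primepow b" "h b = 0" "m \<in> unitary_multiples b"
        by blast
      then obtain l where l: "m = b * l" by (auto simp: unitary_multiples_def)
      have b0: "b > 0" using b(1) primepow_gt_0_nat by blast
      have "coprime b l" using b(3) b0 by (simp add: unitary_multiples_def l)
      moreover have "coprime b (p ^ j)" using cop by (auto simp: l coprime_commute)
      ultimately have "coprime b (p ^ j * l)" by simp
      moreover have "n = b * (p ^ j * l)" by (simp add: nm l)
      ultimately have "n \<in> unitary_multiples b" using b0 by (simp add: unitary_multiples_def)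
      with b show ?thesis by blast
    qed
  qed
qed

text \<open>The criterion for zeros speaks of positive \<open>n\<close>, while sieving never removes
  \<open>0\<close>; a single point does not change the density.\<close>

lemma seq_density_remove_0:
  assumes "seq_density A \<delta>" shows "seq_density (A - {0}) \<delta>"
proof -
  have "\<forall>\<^sub>F n in sequentially. norm (counting (A - {0}) n / real n - counting A n / real n) \<le> 1 / real n"
    using eventually_gt_at_top[of 0]
  proof eventually_elim
    fix n :: nat assume n: "n > 0"
    have "counting A n \<le> counting ((A - {0}) \<union> {0}) n" by (rule counting_mono) auto
    also have "\<dots> \<le> counting (A - {0}) n + counting {0} n" by (rule counting_Un_le)
    also have "counting {0} n \<le> 1"
    proof -
      have "{m \<in> {0}. m \<le> n} = {0}" by auto
      thus ?thesis by (simp add: counting_def)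
    qed
    finally have "\<bar>counting (A - {0}) n - counting A n\<bar> \<le> 1"
      using counting_mono[of "A - {0}" A n] by auto
    thus "norm (counting (A - {0}) n / real n - counting A n / real n) \<le> 1 / real n"
      using n by (simp add: divide_right_mono flip: diff_divide_distrib)
  qed
  hence "(\<lambda>n. counting (A - {0}) n / real n - counting A n / real n) \<longlonglongrightarrow> 0"
    by (rule Lim_null_comparison) (rule lim_const_over_n)
  from tendsto_add[OF this assms[unfolded seq_density_def]]
  show ?thesis by (simp add: seq_density_def)
qed

text \<open>The support is the progression sieved by all prime powers at which \<open>h\<close>
  vanishes. The primes among them are controlled by \<open>summ\<close>; the proper powers by the
  von Mangoldt series, since \<open>mangoldt\<close> is at least \<open>ln 2\<close> on prime
  powers.\<close>

lemma seq_density_nonzero_multiplicative: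
  fixes h :: "nat \<Rightarrow> real"
  assumes mult: "\<And>p j m. prime p \<Longrightarrow> \<not> p dvd m \<Longrightarrow> m > 0 \<Longrightarrow>
      h (p ^ j * m) = 0 \<longleftrightarrow> h (p ^ j) = 0 \<or> h m = 0"
    and one: "h 1 \<noteq> 0"
    and summ: "summable (\<lambda>p. if prime p \<and> h p = 0 then 1 / real p else 0)"
    and q: "q > 0" and d: "coprime d q"
  shows "\<exists>\<delta>>0. seq_density {n. n > 0 \<and> [n = d] (mod q) \<and> h n \<noteq> 0} \<delta>"
proof -
  define B where "B = {b. primepow b \<and> h b = 0}"
  define f where "f = (\<lambda>l. if prime l then 0 else mangoldt l / real l :: real)"
  have "summable (\<lambda>b. if b \<in> B then 1 / real b else 0)"
  proof (rule summable_comparison_test)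
    have "norm (if b \<in> B then 1 / real b else 0)
        \<le> (if prime b \<and> h b = 0 then 1 / real b else 0) + 1 / ln 2 * f b" for b
    proof (cases "b \<in> B \<and> \<not> prime b")
      case True
      have "aprimedivisor b > 1" 
        using True primepow_gt_Suc_0[of b] by (auto simp: B_def intro!: prime_gt_1_nat prime_aprimedivisor')
      hence "ln 2 \<le> ln (real (aprimedivisor b))" by simp
      hence "ln 2 \<le> (mangoldt b :: real)" using True by (simp add: mangoldt_def B_def)
      hence "ln 2 / real b \<le> f b" using True by (simp add: f_def divide_right_mono)
      thus ?thesis using True by (simp add: field_simps)
    next
      case False
      moreover have "f b \<ge> 0" by (simp add: f_def mangoldt_nonneg)
      ultimately show ?thesis by (auto simp: B_def)
    qed
    thus "\<exists>N. \<forall>b\<ge>N. norm (if b \<in> B then 1 / real b else 0)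
        \<le> (if prime b \<and> h b = 0 then 1 / real b else 0) + 1 / ln 2 * f b" by blast
    show "summable (\<lambda>b. (if prime b \<and> h b = 0 then 1 / real b else 0) + 1 / ln 2 * f b)"
      by (intro summable_add summable_mult summ)
        (use summable_mangoldt_higher_powers in \<open>simp add: f_def\<close>)
  qed
  from seq_density_unitary_sieve_pos[OF q d _ this]
  obtain \<delta> where \<delta>: "\<delta> > 0"
    "seq_density ({n. [n = d] (mod q)} - (\<Union>b\<in>B. unitary_multiples b)) \<delta>"
    by (auto simp: B_def)
  have "({n. [n = d] (mod q)} - (\<Union>b\<in>B. unitary_multiples b)) - {0} =
      {n. n > 0 \<and> [n = d] (mod q) \<and> h n \<noteq> 0}"
    using multiplicative_zero_iff[OF mult one] by (auto simp: B_def)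
  with seq_density_remove_0[OF \<delta>(2)] \<delta>(1) show ?thesis by auto
qed

subsection \<open>Mean values of multiplicative functions in progressions\<close>

lemma harm_le_1_plus_ln:
  assumes "n > 0" shows "(\<Sum>m=1..n. 1 / real m) \<le> 1 + ln (real n)"
  using assms
proof (induction n rule: nat_induct_non_zero)
  case (Suc n)
  have "ln (real n / real (Suc n)) \<le> real n / real (Suc n) - 1"
    using Suc by (intro ln_le_minus_one) auto
  also have "\<dots> = - (1 / real (Suc n))" by (simp add: field_simps)
  finally have "1 / real (Suc n) \<le> ln (real (Suc n)) - ln (real n)"
    using Suc by (simp add: ln_div)
  thus ?case using Suc.IH by simp
qed simp

text \<open>A weak form of Stirling's formula: \<open>x ^ x / fact x\<close> is a single term of the
  exponential series at \<open>x\<close>.\<close>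

lemma sum_ln_ratio_le:
  assumes "x > 0"
  shows "(\<Sum>n=1..x. ln (real x / real n)) \<le> real x"
proof -
  have "real x ^ x / fact x \<le> exp (real x)"
  proof -
    have "(\<lambda>n. inverse (fact n) * real x ^ n) sums exp (real x)"
      using exp_converges[of "real x"] by (simp add: field_simps)
    hence "summable (\<lambda>n. inverse (fact n) * real x ^ n)"
      "exp (real x) = (\<Sum>n. inverse (fact n) * real x ^ n)"
      by (simp_all add: sums_iff)
    hence "(\<Sum>n\<in>{x}. inverse (fact n) * real x ^ n) \<le> exp (real x)"
      using sum_le_suminf[of "\<lambda>n. inverse (fact n) * real x ^ n" "{x}"] by simp
    thus ?thesis by (simp add: field_simps)
  qed
  hence "ln (real x ^ x / fact x) \<le> real x"
    using assms by (subst (asm) ln_le_cancel_iff[symmetric]) auto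
  hence "real x * ln (real x) - ln (fact x) \<le> real x"
    using assms by (simp add: ln_div ln_realpow)
  moreover have "(\<Sum>n=1..x. ln (real x / real n)) = real x * ln (real x) - (\<Sum>n=1..x. ln (real n))"
    using assms by (simp add: ln_div sum_subtractf)
  moreover have "(\<Sum>n=1..x. ln (real n)) = ln (fact x)"
    unfolding fact_prod of_nat_prod by (subst ln_prod) auto
  ultimately show ?thesis by simp
qed

lemma card_multiples_le:
  assumes "l > 0"
  shows "real (card {n\<in>{1..x}. l dvd n}) \<le> real x / real l"
proof -
  have "{n\<in>{1..x}. l dvd n} \<subseteq> (\<lambda>j. l * j) ` {1..x div l}"
  proof
    fix n assume n: "n \<in> {n\<in>{1..x}. l dvd n}"
    then obtain j where j: "n = l * j" by auto
    with n have "j \<ge> 1" by (cases j) auto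
    moreover have "j \<le> x div l" using n assms j
      by (simp add: less_eq_div_iff_mult_less_eq mult.commute)
    ultimately show "n \<in> (\<lambda>j. l * j) ` {1..x div l}" using j by auto
  qed
  hence "card {n\<in>{1..x}. l dvd n} \<le> x div l"
    using surj_card_le[OF finite_atLeastAtMost] by fastforce
  hence "real (card {n\<in>{1..x}. l dvd n}) \<le> real (x div l)" by (rule of_nat_mono)
  also have "\<dots> \<le> real x / real l" by (rule of_nat_div_le_of_nat)
  finally show ?thesis .
qed

lemma sum_over_multiples:
  fixes f :: "nat \<Rightarrow> real"
  assumes "l > 0"
  shows "(\<Sum>n | n \<in> {1..x} \<and> l dvd n. f n) = (\<Sum>m\<in>{1..x div l}. f (l * m))"
proof (rule sum.reindex_bij_witness[where i = "\<lambda>m. l * m" and j = "\<lambda>n. n div l"])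
  fix n assume n: "n \<in> {n. n \<in> {1..x} \<and> l dvd n}"
  then obtain j where j: "n = l * j" by auto
  with n assms show "l * (n div l) = n" "n div l \<in> {1..x div l}" "f (l * (n div l)) = f n"
    by (auto simp: Suc_le_eq less_eq_div_iff_mult_less_eq mult.commute)
next
  fix m assume "m \<in> {1..x div l}"
  with assms show "l * m div l = m" "l * m \<in> {n. n \<in> {1..x} \<and> l dvd n}"
    by (auto simp: Suc_le_eq less_eq_div_iff_mult_less_eq mult.commute)
qed

text \<open>
  Writing \<open>ln n\<close> as a sum of von Mangoldt values over the divisors of \<open>n\<close> reduces the
  logarithmically weighted mean value to prime sums over the cofactors; all error terms are \<open>O(x)\<close>,
  which is \<open>o(x ln x)\<close>.
\<close>

lemma log_weighted_sum_bound:
  fixes h :: "nat \<Rightarrow> real" and d q :: nat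
  assumes q: "q > 0" and d: "coprime d q"
    and bound: "\<And>n. \<bar>h n\<bar> \<le> 1"
    and mult: "\<And>p m. prime p \<Longrightarrow> \<not> p dvd m \<Longrightarrow> h (p * m) = h p * h m"
    and K: "\<And>c y. coprime c q \<Longrightarrow>
        \<bar>\<Sum>p | prime p \<and> p \<le> y \<and> [p = c] (mod q). h p * ln (real p)\<bar> \<le> \<eta> * real y + K"
    and \<eta>: "\<eta> \<ge> 0" "K \<ge> 0"
  defines "E \<equiv> (\<Sum>l. if prime l then 0 else mangoldt l / real l :: real)
      + 2 * (\<Sum>p::nat. ln (real p) / real p ^ 2)"
  assumes x: "x > 0"
  shows "\<bar>\<Sum>n | n \<in> {1..x} \<and> [n = d] (mod q). h n * ln (real n)\<bar>
      \<le> \<eta> * real x * (1 + ln (real x)) + (K + E) * real x"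
proof -
  define h' where "h' n = (if [n = d] (mod q) then h n else 0)" for n
  define \<Lambda> where "\<Lambda> = (mangoldt :: nat \<Rightarrow> real)"
  define R where "R = {p::nat. prime p \<and> p \<le> x}"
  have finR: "finite R" unfolding R_def by (rule finite_subset[of _ "{..x}"]) auto
  have h': "\<bar>h' n\<bar> \<le> 1" for n using bound[of n] by (simp add: h'_def)
  have L0: "\<Lambda> l \<ge> 0" for l by (simp add: \<Lambda>_def mangoldt_nonneg)
  define S where "S l = (\<Sum>n | n \<in> {1..x} \<and> l dvd n. h' n)" for l
  have S: "\<bar>S l\<bar> \<le> real x / real l" if "l > 0" for l
  proof -
    have "\<bar>S l\<bar> \<le> (\<Sum>n | n \<in> {1..x} \<and> l dvd n. 1)"
      unfolding S_def by (rule order_trans[OF sum_abs]) (intro sum_mono h')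
    also have "\<dots> \<le> real x / real l" using card_multiples_le[OF that] by simp
    finally show ?thesis .
  qed
  have "(\<Sum>n | n \<in> {1..x} \<and> [n = d] (mod q). h n * ln (real n)) = (\<Sum>n=1..x. h' n * ln (real n))"
    unfolding h'_def by (rule sum.mono_neutral_cong_left) auto
  also have "\<dots> = (\<Sum>n=1..x. \<Sum>l | l \<in> {1..x} \<and> l dvd n. h' n * \<Lambda> l)"
  proof (intro sum.cong refl)
    fix n assume n: "n \<in> {1..x}"
    hence "{l. l \<in> {1..x} \<and> l dvd n} = {l. l dvd n}"
      by (auto simp: Suc_le_eq intro!: Nat.gr0I dest: dvd_imp_le)
    thus "h' n * ln (real n) = (\<Sum>l | l \<in> {1..x} \<and> l dvd n. h' n * \<Lambda> l)"
      using mangoldt_sum[of n, where ?'a = real] n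
      by (simp add: \<Lambda>_def flip: sum_distrib_left)
  qed
  also have "\<dots> = (\<Sum>l=1..x. \<Sum>n | n \<in> {1..x} \<and> l dvd n. h' n * \<Lambda> l)"
    by (rule sum.swap_restrict) auto
  also have "\<dots> = (\<Sum>l=1..x. \<Lambda> l * S l)"
    by (simp add: S_def sum_distrib_left mult.commute)
  also have "\<dots> = (\<Sum>l\<in>{1..x} - R. \<Lambda> l * S l) + (\<Sum>p\<in>R. \<Lambda> p * S p)"
    by (rule sum.subset_diff) (auto simp: R_def Suc_le_eq prime_gt_0_nat)
  finally have split: "(\<Sum>n | n \<in> {1..x} \<and> [n = d] (mod q). h n * ln (real n)) =
     (\<Sum>l\<in>{1..x} - R. \<Lambda> l * S l) + (\<Sum>p\<in>R. \<Lambda> p * S p)" .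
  define E1 where "E1 = (\<Sum>l. if prime l then 0 else mangoldt l / real l :: real)"
  define E2 where "E2 = (\<Sum>p::nat. ln (real p) / real p ^ 2)"
  \<comment> \<open>Where \<open>l\<close> is not prime the trivial bound \<open>x / l\<close> for
    \<open>S l\<close> suffices, because the von Mangoldt series over non-primes converges to
    \<open>E1\<close>.\<close>
  have "\<bar>\<Sum>l\<in>{1..x} - R. \<Lambda> l * S l\<bar> \<le> (\<Sum>l\<in>{1..x} - R. \<Lambda> l * (real x / real l))"
  proof (rule order_trans[OF sum_abs], rule sum_mono)
    fix l assume "l \<in> {1..x} - R"
    thus "\<bar>\<Lambda> l * S l\<bar> \<le> \<Lambda> l * (real x / real l)"
      unfolding abs_mult abs_of_nonneg[OF L0] by (intro mult_left_mono S L0) auto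
  qed
  also have "\<dots> = real x * (\<Sum>l\<in>{1..x} - R. if prime l then 0 else \<Lambda> l / real l)"
    unfolding sum_distrib_left by (intro sum.cong) (auto simp: R_def)
  also have "\<dots> \<le> real x * E1"
    unfolding E1_def \<Lambda>_def
    by (intro mult_left_mono sum_le_suminf summable_mangoldt_higher_powers) (auto simp: mangoldt_nonneg)
  finally have err1: "\<bar>\<Sum>l\<in>{1..x} - R. \<Lambda> l * S l\<bar> \<le> real x * E1" .
  \<comment> \<open>\<open>S'\<close> replaces \<open>h (p * m)\<close> by \<open>h p * h m\<close>.
    The two differ, by at most \<open>2\<close>, only when \<open>p\<close> divides
    \<open>m\<close>, for at most \<open>x / p ^ 2\<close> values of \<open>m\<close>; this is the
    origin of the factor \<open>2\<close> in \<open>E\<close>.\<close>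
  define S' where "S' p = (\<Sum>m | m \<in> {1..x div p} \<and> [p * m = d] (mod q). h p * h m)" for p
  have S': "\<bar>S p - S' p\<bar> \<le> 2 * real x / real p ^ 2" if p: "p \<in> R" for p
  proof -
    have p: "prime p" "p > 0" using p by (auto simp: R_def prime_gt_0_nat)
    define w where "w m = (if [p * m = d] (mod q) then h (p * m) - h p * h m else 0)" for m
    have w: "\<bar>w m\<bar> \<le> (if p dvd m then 2 else 0)" for m
    proof -
      have "\<bar>h p * h m\<bar> \<le> 1 * 1" unfolding abs_mult by (intro mult_mono bound) auto
      thus ?thesis using mult[OF p(1), of m] bound[of "p * m"] by (auto simp: w_def)
    qed
    have "S p - S' p = (\<Sum>m=1..x div p. h' (p * m)) - (\<Sum>m=1..x div p. if [p * m = d] (mod q) then h p * h m else 0)"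
      unfolding S_def S'_def sum_over_multiples[OF p(2)]
      by (subst sum.inter_filter[symmetric]) (auto intro!: sum.cong)
    also have "\<dots> = (\<Sum>m=1..x div p. w m)"
      unfolding sum_subtractf[symmetric] by (intro sum.cong) (auto simp: h'_def w_def)
    finally have "\<bar>S p - S' p\<bar> \<le> (\<Sum>m=1..x div p. if p dvd m then 2 else 0)"
      by (simp only:) (rule order_trans[OF sum_abs], intro sum_mono w)
    also have "\<dots> = 2 * real (card {m\<in>{1..x div p}. p dvd m})"
      by (subst sum.inter_filter[symmetric]) auto
    also have "\<dots> \<le> 2 * (real (x div p) / real p)"
      by (intro mult_left_mono card_multiples_le p) auto
    also have "\<dots> \<le> 2 * ((real x / real p) / real p)"
      by (intro mult_left_mono divide_right_mono of_nat_div_le_of_nat) auto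
    finally show ?thesis by (simp add: power2_eq_square)
  qed
  have "\<bar>(\<Sum>p\<in>R. \<Lambda> p * S p) - (\<Sum>p\<in>R. \<Lambda> p * S' p)\<bar> = \<bar>\<Sum>p\<in>R. \<Lambda> p * (S p - S' p)\<bar>"
    by (simp add: sum_subtractf right_diff_distrib)
  also have "\<dots> \<le> (\<Sum>p\<in>R. \<Lambda> p * (2 * real x / real p ^ 2))"
    by (rule order_trans[OF sum_abs])
      (unfold abs_mult abs_of_nonneg[OF L0], intro sum_mono mult_left_mono S' L0)
  also have "\<dots> = 2 * real x * (\<Sum>p\<in>R. ln (real p) / real p ^ 2)"
    by (auto simp: sum_distrib_left \<Lambda>_def R_def intro!: sum.cong)
  also have "\<dots> \<le> 2 * real x * E2"
  proof -
    have "ln (real n) / real n ^ 2 \<ge> 0" for n by (cases "n = 0") auto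
    thus ?thesis unfolding E2_def
      by (intro mult_left_mono sum_le_suminf summable_ln_over_square finR) auto
  qed
  finally have err2: "\<bar>(\<Sum>p\<in>R. \<Lambda> p * S p) - (\<Sum>p\<in>R. \<Lambda> p * S' p)\<bar> \<le> 2 * real x * E2" .
  \<comment> \<open>Exchanging the sums puts the primes inside. For \<open>m\<close> a unit modulo
    \<open>q\<close> they run over the class of \<open>d\<close> times an inverse of
    \<open>m\<close>, and the hypothesis applies; for other \<open>m\<close> the condition cannot
    hold, as \<open>d\<close> is a unit.\<close>
  define \<theta> where "\<theta> m = (\<Sum>p | prime p \<and> p \<le> x div m \<and> [p * m = d] (mod q). h p * ln (real p))" for m
  have "(\<Sum>p\<in>R. \<Lambda> p * S' p) = (\<Sum>p\<in>R. \<Sum>m | m \<in> {1..x} \<and> (p * m \<le> x \<and> [p * m = d] (mod q)). h m * (h p * ln (real p)))"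
  proof (intro sum.cong refl)
    fix p assume p: "p \<in> R"
    hence "prime p" "p > 0" by (auto simp: R_def prime_gt_0_nat)
    moreover from this have "{m. m \<in> {1..x div p} \<and> [p * m = d] (mod q)} =
        {m. m \<in> {1..x} \<and> (p * m \<le> x \<and> [p * m = d] (mod q))}"
      by (auto simp: less_eq_div_iff_mult_less_eq mult.commute intro: order_trans[rotated])
    ultimately show "\<Lambda> p * S' p = (\<Sum>m | m \<in> {1..x} \<and> (p * m \<le> x \<and> [p * m = d] (mod q)). h m * (h p * ln (real p)))"
      by (simp add: S'_def \<Lambda>_def sum_distrib_left mult_ac)
  qed
  also have "\<dots> = (\<Sum>m=1..x. \<Sum>p | p \<in> R \<and> (p * m \<le> x \<and> [p * m = d] (mod q)). h m * (h p * ln (real p)))"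
    by (rule sum.swap_restrict) (auto simp: finR)
  also have "\<dots> = (\<Sum>m=1..x. h m * \<theta> m)"
  proof (intro sum.cong refl)
    fix m assume m: "m \<in> {1..x}"
    hence "{p. p \<in> R \<and> (p * m \<le> x \<and> [p * m = d] (mod q))} =
        {p. prime p \<and> p \<le> x div m \<and> [p * m = d] (mod q)}"
      by (auto simp: R_def less_eq_div_iff_mult_less_eq intro: order_trans[rotated])
    thus "(\<Sum>p | p \<in> R \<and> (p * m \<le> x \<and> [p * m = d] (mod q)). h m * (h p * ln (real p))) = h m * \<theta> m"
      by (simp add: \<theta>_def sum_distrib_left)
  qed
  finally have main: "(\<Sum>p\<in>R. \<Lambda> p * S' p) = (\<Sum>m=1..x. h m * \<theta> m)" .
  have \<theta>: "\<bar>\<theta> m\<bar> \<le> \<eta> * (real x / real m) + K" if m: "m > 0" for m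
  proof (cases "coprime m q")
    case True
    from cong_solve_coprime_nat[OF this] obtain m' where m': "[m * m' = 1] (mod q)" by auto
    hence copm': "coprime m' q"
      by (metis cong_imp_coprime cong_sym coprime_1_left coprime_mult_left_iff)
    have "[p * m = d] (mod q) \<longleftrightarrow> [p = d * m'] (mod q)" for p
    proof -
      have "[p = d * m'] (mod q) \<longleftrightarrow> [p * m = d * m' * m] (mod q)"
        by (rule cong_mult_rcancel_nat[OF True, symmetric])
      moreover have "[d * m' * m = d] (mod q)"
        using cong_mult[OF cong_refl[of d] m'] by (simp add: mult_ac)
      ultimately show ?thesis by (metis cong_sym cong_trans)
    qed
    hence "\<bar>\<theta> m\<bar> \<le> \<eta> * real (x div m) + K"
      using K[of "d * m'" "x div m"] d copm' by (simp add: \<theta>_def)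
    also have "\<eta> * real (x div m) \<le> \<eta> * (real x / real m)"
      by (intro mult_left_mono of_nat_div_le_of_nat \<eta>)
    finally show ?thesis by simp
  next
    case False
    have "\<not> [p * m = d] (mod q)" for p
      using False d by (metis cong_imp_coprime cong_sym coprime_mult_left_iff)
    thus ?thesis using \<eta> by (simp add: \<theta>_def)
  qed
  have "\<bar>\<Sum>m=1..x. h m * \<theta> m\<bar> \<le> (\<Sum>m=1..x. 1 * (\<eta> * (real x / real m) + K))"
    by (rule order_trans[OF sum_abs]) (unfold abs_mult, intro sum_mono mult_mono bound \<theta>, auto)
  also have "\<dots> = \<eta> * real x * (\<Sum>m=1..x. 1 / real m) + K * real x"
    by (simp add: sum.distrib sum_distrib_left)
  also have "\<eta> * real x * (\<Sum>m=1..x. 1 / real m) \<le> \<eta> * real x * (1 + ln (real x))"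
    using \<eta> x by (intro mult_left_mono harm_le_1_plus_ln) auto
  finally have "\<bar>\<Sum>m=1..x. h m * \<theta> m\<bar> \<le> \<eta> * real x * (1 + ln (real x)) + K * real x" by simp
  moreover have "E * real x = real x * E1 + 2 * real x * E2"
    by (simp add: E_def E1_def E2_def algebra_simps)
  ultimately show ?thesis
    using err1 err2 unfolding split main by (simp add: algebra_simps abs_le_iff)
qed

text \<open>Writing \<open>ln x = ln n + ln (x / n)\<close> compares the sum times
  \<open>ln x\<close> with the logarithmically weighted one at a cost of \<open>O(x)\<close>.
  Division by \<open>x * ln x\<close> leaves \<open>\<eta> + O(1 / ln x)\<close> with
  \<open>\<eta>\<close> arbitrarily small.\<close>

lemma mean_value_zero_in_progression:
  fixes h :: "nat \<Rightarrow> real" and d q :: nat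
  assumes q: "q > 0" and d: "coprime d q"
    and bound: "\<And>n. \<bar>h n\<bar> \<le> 1"
    and mult: "\<And>p m. prime p \<Longrightarrow> \<not> p dvd m \<Longrightarrow> h (p * m) = h p * h m"
    and prime_sums: "\<And>c. coprime c q \<Longrightarrow>
        (\<lambda>y. (\<Sum>p | prime p \<and> p \<le> y \<and> [p = c] (mod q). h p * ln (real p)) / real y) \<longlonglongrightarrow> 0"
  shows "(\<lambda>x. (\<Sum>n | n \<in> {1..x} \<and> [n = d] (mod q). h n) / real x) \<longlonglongrightarrow> 0"
proof -
  define \<theta> where "\<theta> c y = (\<Sum>p | prime p \<and> p \<le> y \<and> [p = c] (mod q). h p * ln (real p))" for c y
  have \<theta>_mod: "\<theta> c y = \<theta> (c mod q) y" for c y by (simp add: \<theta>_def cong_def)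
  \<comment> \<open>The lengths \<open>x div m\<close> may be small, where the limit says nothing;
    the additive constant \<open>K\<close> absorbs them. One \<open>K\<close> serves all classes
    because there are only finitely many.\<close>
  have unif: "\<exists>K\<ge>0. \<forall>c y. coprime c q \<longrightarrow> \<bar>\<theta> c y\<bar> \<le> \<eta> * real y + K" if \<eta>: "\<eta> > 0" for \<eta>
  proof -
    have "\<exists>K\<ge>0. \<forall>y. \<bar>\<theta> c y\<bar> \<le> \<eta> * real y + K" if c: "coprime c q" for c
    proof -
      from LIMSEQ_D[OF prime_sums[OF c] \<eta>] obtain y0 where
        y0: "\<And>y. y \<ge> y0 \<Longrightarrow> \<bar>\<theta> c y / real y\<bar> < \<eta>" by (auto simp: \<theta>_def)
      define K where "K = (\<Sum>y\<le>y0. \<bar>\<theta> c y\<bar>)"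
      have K0: "K \<ge> 0" by (auto simp: K_def intro!: sum_nonneg)
      have "\<bar>\<theta> c y\<bar> \<le> \<eta> * real y + K" for y
      proof (cases "y \<le> y0")
        case True
        have "\<bar>\<theta> c y\<bar> \<le> K" unfolding K_def using True by (intro member_le_sum) auto
        moreover have "\<eta> * real y \<ge> 0" using \<eta> by simp
        ultimately show ?thesis by linarith
      next
        case False
        hence "\<bar>\<theta> c y\<bar> / real y < \<eta>" using y0[of y] by simp
        hence "\<bar>\<theta> c y\<bar> < \<eta> * real y" using False by (simp add: pos_divide_less_eq)
        thus ?thesis using K0 by linarith
      qed
      with K0 show ?thesis by blast
    qed
    then obtain K where K: "\<And>c. coprime c q \<Longrightarrow> K c \<ge> 0"
      "\<And>c y. coprime c q \<Longrightarrow> \<bar>\<theta> c y\<bar> \<le> \<eta> * real y + K c" by metis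
    define K' where "K' = (\<Sum>c | c < q \<and> coprime c q. K c)"
    have K'0: "K' \<ge> 0" using K by (auto simp: K'_def intro!: sum_nonneg)
    have "\<bar>\<theta> c y\<bar> \<le> \<eta> * real y + K'" if c: "coprime c q" for c y
    proof -
      have c': "coprime (c mod q) q" using c q by (subst coprime_mod_left_iff) simp_all
      have "K (c mod q) \<le> K'" unfolding K'_def
      proof (rule member_le_sum)
        show "c mod q \<in> {c. c < q \<and> coprime c q}" using c' q by simp
      qed (simp_all add: K(1))
      thus ?thesis using K(2)[OF c', of y] \<theta>_mod[of c y] by simp
    qed
    with K'0 show ?thesis by blast
  qed
  define S where "S x = (\<Sum>n | n \<in> {1..x} \<and> [n = d] (mod q). h n)" for x
  define E where "E = (\<Sum>l. if prime l then 0 else mangoldt l / real l :: real)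
      + 2 * (\<Sum>p::nat. ln (real p) / real p ^ 2)"
  have key: "\<bar>S x\<bar> / real x \<le> \<eta> + (\<eta> + K + E + 1) / ln (real x)"
    if K: "\<eta> > 0" "K \<ge> 0" "\<And>c y. coprime c q \<Longrightarrow> \<bar>\<theta> c y\<bar> \<le> \<eta> * real y + K" and x: "x \<ge> 2"
    for \<eta> K x
  proof -
    have "S x * ln (real x) = (\<Sum>n | n \<in> {1..x} \<and> [n = d] (mod q). h n * ln (real n))
       + (\<Sum>n | n \<in> {1..x} \<and> [n = d] (mod q). h n * ln (real x / real n))"
      unfolding S_def sum_distrib_right sum.distrib[symmetric]
      using x by (intro sum.cong) (auto simp: ln_div algebra_simps)
    moreover have "\<bar>\<Sum>n | n \<in> {1..x} \<and> [n = d] (mod q). h n * ln (real n)\<bar>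
      \<le> \<eta> * real x * (1 + ln (real x)) + (K + E) * real x"
      unfolding E_def using K x
      by (intro log_weighted_sum_bound[OF q d bound mult]) (auto simp: \<theta>_def)
    moreover have "\<bar>\<Sum>n | n \<in> {1..x} \<and> [n = d] (mod q). h n * ln (real x / real n)\<bar> \<le> real x"
    proof -
      have "\<bar>\<Sum>n | n \<in> {1..x} \<and> [n = d] (mod q). h n * ln (real x / real n)\<bar>
         \<le> (\<Sum>n | n \<in> {1..x} \<and> [n = d] (mod q). 1 * ln (real x / real n))"
        by (rule order_trans[OF sum_abs])
          (unfold abs_mult, intro sum_mono mult_mono bound, auto)
      also have "\<dots> \<le> (\<Sum>n=1..x. ln (real x / real n))"
        by (simp, intro sum_mono2) auto
      also have "\<dots> \<le> real x" using x by (intro sum_ln_ratio_le) auto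
      finally show ?thesis .
    qed
    ultimately have "\<bar>S x * ln (real x)\<bar> \<le> \<eta> * real x * (1 + ln (real x)) + (K + E) * real x + real x"
      by linarith
    hence "\<bar>S x\<bar> * ln (real x) \<le> (\<eta> * ln (real x) + (\<eta> + K + E + 1)) * real x"
      using x by (simp add: abs_mult algebra_simps)
    hence "\<bar>S x\<bar> / real x \<le> (\<eta> * ln (real x) + (\<eta> + K + E + 1)) / ln (real x)"
      using x by (simp add: divide_le_eq le_divide_eq)
    thus ?thesis using x by (simp add: add_divide_distrib)
  qed
  have "(\<lambda>x. S x / real x) \<longlonglongrightarrow> 0"
  proof (rule LIMSEQ_I)
    fix e :: real assume e: "e > 0"
    from unif[of "e / 2"] e obtain K where
      K: "K \<ge> 0" "\<And>c y. coprime c q \<Longrightarrow> \<bar>\<theta> c y\<bar> \<le> e / 2 * real y + K" by auto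
    have "filterlim (\<lambda>x. ln (real x)) at_top sequentially"
      by (rule filterlim_compose[OF ln_at_top filterlim_real_sequentially])
    hence "(\<lambda>x. (e / 2 + K + E + 1) / ln (real x)) \<longlonglongrightarrow> 0"
      by (intro tendsto_divide_0[OF tendsto_const] filterlim_at_top_imp_at_infinity)
    from LIMSEQ_D[OF this, of "e / 2"] e obtain x0 where
      x0: "\<And>x. x \<ge> x0 \<Longrightarrow> \<bar>(e / 2 + K + E + 1) / ln (real x)\<bar> < e / 2" by auto
    show "\<exists>x0. \<forall>x\<ge>x0. norm (S x / real x - 0) < e"
    proof (intro exI[of _ "max 2 x0"] allI impI)
      fix x assume x: "x \<ge> max 2 x0"
      have "\<bar>S x\<bar> / real x \<le> e / 2 + (e / 2 + K + E + 1) / ln (real x)"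
        using e K x by (intro key) auto
      also have "(e / 2 + K + E + 1) / ln (real x) < e / 2"
        by (rule order.strict_trans1[OF abs_ge_self x0]) (use x in simp)
      finally show "norm (S x / real x - 0) < e" by simp
    qed
  qed
  thus ?thesis by (simp add: S_def)
qed

subsection \<open>Prime sums from Sato--Tate equidistribution\<close>

text \<open>The interior form of the fundamental theorem is used because the square root and
  \<open>arcsin\<close> have no finite derivative at the endpoints \<open>-1\<close> and
  \<open>1\<close>.\<close>

lemma has_integral_semicircle:
  assumes "-1 \<le> u" "u \<le> v" "v \<le> 1"
  shows "((\<lambda>s. 2 / pi * sqrt (1 - s\<^sup>2)) has_integral
    ((v * sqrt (1 - v\<^sup>2) + arcsin v) / pi - (u * sqrt (1 - u\<^sup>2) + arcsin u) / pi)) {u..v}"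
proof (rule fundamental_theorem_of_calculus_interior)
  show "continuous_on {u..v} (\<lambda>s. (s * sqrt (1 - s\<^sup>2) + arcsin s) / pi)"
    using assms by (intro continuous_intros) auto
next
  fix s :: real assume s: "s \<in> {u<..<v}"
  hence s1: "-1 < s" "s < 1" using assms by auto
  hence pos: "1 - s\<^sup>2 > 0" using square_le_1[of s] by (simp add: abs_square_less_1)
  define r where "r = sqrt (1 - s\<^sup>2)"
  have r: "r > 0" "r * r = 1 - s\<^sup>2" using pos by (simp_all add: r_def)
  have "((\<lambda>s. (s * sqrt (1 - s\<^sup>2) + arcsin s) / pi) has_real_derivative
      ((1 * r + (- (2 * s) * (inverse r / 2)) * s) + inverse r) / pi) (at s)"
    unfolding r_def using s1 pos
    by (auto intro!: derivative_eq_intros DERIV_arcsin simp: field_simps)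
  also have "((1 * r + (- (2 * s) * (inverse r / 2)) * s) + inverse r) = 2 * r"
    using r by (simp add: field_simps power2_eq_square)
  finally show "((\<lambda>s. (s * sqrt (1 - s\<^sup>2) + arcsin s) / pi) has_vector_derivative
      2 / pi * sqrt (1 - s\<^sup>2)) (at s)"
    by (simp add: has_real_derivative_iff_has_vector_derivative r_def)
qed (use assms in auto)

lemma measure_sato_tate_Icc:
  assumes "-1 \<le> u" "u \<le> v" "v \<le> 1"
  shows "measure sato_tate {u..v} =
    (v * sqrt (1 - v\<^sup>2) + arcsin v) / pi - (u * sqrt (1 - u\<^sup>2) + arcsin u) / pi" (is "_ = ?I")
proof -
  define f where "f s = (if s \<in> {u..v} then 2 / pi * sqrt (1 - s\<^sup>2) else 0)" for s :: real
  have f_int: "(f has_integral ?I) UNIV"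
    unfolding f_def has_integral_restrict_UNIV by (rule has_integral_semicircle[OF assms])
  have sq: "s\<^sup>2 \<le> 1" if "s \<in> {u..v}" for s using that assms by (simp add: abs_square_le_1 abs_le_iff)
  hence f0: "f s \<ge> 0" for s by (simp add: f_def)
  have "f = (\<lambda>s. indicator {u..v} s * (2 / pi * sqrt (1 - s\<^sup>2)))"
    by (auto simp: f_def indicator_def)
  hence f_meas: "f \<in> borel_measurable borel" by simp
  have I0: "?I \<ge> 0" using has_integral_nonneg[OF f_int] f0 by simp
  have "emeasure sato_tate {u..v} =
      (\<integral>\<^sup>+s. ennreal (2 / pi * sqrt (1 - s\<^sup>2) * indicator {-1..1} s) * indicator {u..v} s \<partial>lborel)"
    unfolding sato_tate_def by (rule emeasure_density) auto
  also have "\<dots> = (\<integral>\<^sup>+s. ennreal (f s) \<partial>lborel)"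
    using assms by (intro nn_integral_cong) (auto simp: f_def indicator_def)
  also have "\<dots> = ennreal ?I" by (rule nn_integral_has_integral_lborel[OF f_meas f0 f_int])
  finally show ?thesis using I0 by (simp add: measure_def)
qed

text \<open>The density is at most \<open>2 / pi\<close>, which is below \<open>1\<close>.\<close>

lemma measure_sato_tate_le:
  assumes "-1 \<le> u" "u \<le> v" "v \<le> 1"
  shows "measure sato_tate {u..v} \<le> v - u"
  unfolding measure_sato_tate_Icc[OF assms]
proof (rule has_integral_le[OF has_integral_semicircle[OF assms]])
  show "((\<lambda>_. 1) has_integral v - u) {u..v}"
    using has_integral_const_real[of "1::real" u v] assms by simp
  fix s assume "s \<in> {u..v}"
  hence "s\<^sup>2 \<le> 1" using assms by (simp add: abs_square_le_1 abs_le_iff)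
  hence "2 / pi * sqrt (1 - s\<^sup>2) \<le> 1 * 1"
    using pi_gt3 by (intro mult_mono) auto
  thus "2 / pi * sqrt (1 - s\<^sup>2) \<le> 1" by simp
qed

text \<open>Total mass \<open>1\<close> serves to bound the number of angles outside
  \<open>{-1..1}\<close>; symmetry cancels the main terms of the two signs.\<close>

lemma measure_sato_tate_values:
  "measure sato_tate {-1..1} = 1" "measure sato_tate {0..1} = measure sato_tate {-1..0}"
  by (simp_all add: measure_sato_tate_Icc field_simps)

lemma prime_pi_bounds:
  assumes "x \<ge> 2" shows "real (prime_pi x) > 0" "real (prime_pi x) \<le> x"
proof -
  have sub: "{p::nat. prime p \<and> real p \<le> x} \<subseteq> {1..nat \<lfloor>x\<rfloor>}"
    using assms by (auto simp: le_nat_iff le_floor_iff Suc_le_eq prime_gt_0_nat)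
  have "prime_pi x \<le> card {1..nat \<lfloor>x\<rfloor>}"
    unfolding prime_pi_def by (rule card_mono[OF _ sub]) simp
  hence "real (prime_pi x) \<le> real (nat \<lfloor>x\<rfloor>)" by simp
  also have "\<dots> \<le> x" using assms by linarith
  finally show "real (prime_pi x) \<le> x" .
  have "2 \<in> {p::nat. prime p \<and> real p \<le> x}" using assms by simp
  moreover have "finite {p::nat. prime p \<and> real p \<le> x}" using sub finite_subset by blast
  ultimately have "prime_pi x \<noteq> 0" unfolding prime_pi_def
    by (metis card_eq_0_iff empty_iff)
  thus "real (prime_pi x) > 0" by simp
qed

lemma finite_nat_le_real: "finite {p::nat. P p \<and> real p \<le> x}"
proof (rule finite_subset)
  show "{p::nat. P p \<and> real p \<le> x} \<subseteq> {..nat \<lfloor>x\<rfloor>}"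
  proof
    fix p assume "p \<in> {p. P p \<and> real p \<le> x}"
    thus "p \<in> {..nat \<lfloor>x\<rfloor>}" by simp linarith
  qed
qed simp

text \<open>
  The Sato--Tate angle \<open>s p\<close> differs from a positive multiple of the value whose sign is wanted by
  at most \<open>1 / (2 * sqrt p)\<close>, so the sign can only be read off outside this set of exceptional primes.
  Values outside \<open>[-1, 1]\<close> are excluded by counting, not by Deligne's bound.
\<close>

definition exceptional :: "(nat \<Rightarrow> real) \<Rightarrow> nat \<Rightarrow> bool" where
  "exceptional s p \<longleftrightarrow> \<bar>s p\<bar> \<le> 1 / (2 * sqrt (real p)) \<or> \<bar>s p\<bar> > 1"

lemma ratio_bounds:
  fixes A m e p :: real
  assumes "p > 0" "\<bar>A / p - m\<bar> \<le> e"
  shows "A \<le> p * (m + e)" "A \<ge> p * (m - e)"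
proof -
  have "A / p \<le> m + e" "m - e \<le> A / p" using assms(2) by linarith+
  with assms(1) show "A \<le> p * (m + e)" "A \<ge> p * (m - e)"
    by (simp_all add: pos_divide_le_eq pos_le_divide_eq mult.commute)
qed

text \<open>There are three kinds of exceptional primes. Angles outside \<open>{-1..1}\<close> are
  counted by \<open>A\<close>, primes up to \<open>sqrt x\<close> by \<open>B\<close>. For the
  others the threshold \<open>1 / (2 * sqrt p)\<close> is at most
  \<open>\<delta> = x powr (- 1 / 4) / 2\<close>, so they lie in \<open>D\<close>, whose interval
  has measure at most \<open>x powr (- 1 / 4)\<close>.\<close>

lemma exceptional_sparse:
  fixes s :: "nat \<Rightarrow> real" and R :: "nat set"
  assumes R: "\<And>p. p \<in> R \<Longrightarrow> prime p" and C: "C > 0" "\<alpha> > 0"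
    and equi: "\<And>u v x. -1 \<le> u \<Longrightarrow> u \<le> v \<Longrightarrow> v \<le> 1 \<Longrightarrow> x \<ge> 2 \<Longrightarrow>
      \<bar>real (card {p\<in>R. real p \<le> x \<and> s p \<in> {u..v}}) / real (prime_pi x) - measure sato_tate {u..v}\<bar>
        \<le> C / x powr \<alpha>"
  shows "\<exists>C' \<beta>. C' > 0 \<and> \<beta> > 0 \<and> (\<forall>x\<ge>2.
      real (card {p\<in>R. exceptional s p \<and> real p \<le> x}) \<le> C' * x powr (1 - \<beta>))"
proof (intro exI conjI allI impI)
  \<comment> \<open>The exponents to be dominated are \<open>1 - \<alpha>\<close> from
    equidistribution, \<open>1 / 2\<close> from \<open>B\<close> and \<open>3 / 4\<close> from
    \<open>D\<close>. The constant adds up \<open>C\<close>, \<open>1\<close> and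
    \<open>1 + C\<close>.\<close>
  define \<beta> where "\<beta> = min \<alpha> (1 / 4)"
  show "2 * C + 2 > 0" "min \<alpha> (1 / 4) > 0" using C by auto
  fix x :: real assume x: "x \<ge> 2"
  define \<pi> where "\<pi> = real (prime_pi x)"
  have \<pi>: "\<pi> > 0" "\<pi> \<le> x" using prime_pi_bounds[OF x] by (simp_all add: \<pi>_def)
  have upper: "real (card {p\<in>R. real p \<le> x \<and> s p \<in> {u..v}}) \<le> \<pi> * (measure sato_tate {u..v} + C / x powr \<alpha>)"
    and lower: "real (card {p\<in>R. real p \<le> x \<and> s p \<in> {u..v}}) \<ge> \<pi> * (measure sato_tate {u..v} - C / x powr \<alpha>)"
    if "-1 \<le> u" "u \<le> v" "v \<le> 1" for u v
    using ratio_bounds[OF \<pi>(1) equi[OF that x, folded \<pi>_def]] by simp_all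
  have powr_mono: "x powr \<gamma> \<le> x powr (1 - \<beta>)" if "\<gamma> \<le> 1 - \<beta>" for \<gamma>
    using x that by (intro powr_mono) auto
  have err: "\<pi> * (C / x powr \<alpha>) \<le> C * x powr (1 - \<beta>)"
  proof -
    have "\<pi> * (C / x powr \<alpha>) \<le> x * (C / x powr \<alpha>)"
      using \<pi> C by (intro mult_right_mono) auto
    also have "\<dots> = C * x powr (1 - \<alpha>)" using x by (simp add: powr_diff)
    also have "\<dots> \<le> C * x powr (1 - \<beta>)" using C by (intro mult_left_mono powr_mono) (auto simp: \<beta>_def)
    finally show ?thesis .
  qed
  define A where "A = {p\<in>R. \<bar>s p\<bar> > 1 \<and> real p \<le> x}"
  define B where "B = {p::nat. 0 < p \<and> real p \<le> sqrt x}"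
  define \<delta> where "\<delta> = x powr (- 1 / 4) / 2"
  define D where "D = {p\<in>R. real p \<le> x \<and> s p \<in> {-\<delta>..\<delta>}}"
  have fin: "finite A" "finite B" "finite D"
    unfolding A_def B_def D_def
    using finite_nat_le_real[of "\<lambda>_. True" x] finite_nat_le_real[of "\<lambda>_. True" "sqrt x"]
    by (auto elim!: rev_finite_subset)
  \<comment> \<open>Since \<open>{-1..1}\<close> has mass \<open>1\<close>, equidistribution places
    all but \<open>\<pi> * (C / x powr \<alpha>)\<close> of all the primes inside, leaving at most
    that many for \<open>A\<close>. This needs the full mass, so it would fail for a set carrying
    only a fraction of the primes.\<close>
  have "real (card A) + real (card {p\<in>R. real p \<le> x \<and> s p \<in> {-1..1}}) \<le> \<pi>"
  proof -
    have "card A + card {p\<in>R. real p \<le> x \<and> s p \<in> {-1..1}} = card (A \<union> {p\<in>R. real p \<le> x \<and> s p \<in> {-1..1}})"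
      by (rule card_Un_disjoint[symmetric])
        (auto simp: A_def intro: finite_subset[OF _ finite_nat_le_real[of "\<lambda>_. True" x]])
    also have "\<dots> \<le> prime_pi x"
      unfolding prime_pi_def using R
      by (intro card_mono finite_nat_le_real) (auto simp: A_def)
    finally show ?thesis unfolding \<pi>_def by linarith
  qed
  with lower[of "-1" 1] have "real (card A) \<le> \<pi> * (C / x powr \<alpha>)"
    by (simp add: measure_sato_tate_values algebra_simps)
  hence cA: "real (card A) \<le> C * x powr (1 - \<beta>)" using err by linarith
  have "card B \<le> card {1..nat \<lfloor>sqrt x\<rfloor>}"
    unfolding B_def using x by (intro card_mono) (auto simp: le_nat_iff le_floor_iff)
  hence "real (card B) \<le> real (nat \<lfloor>sqrt x\<rfloor>)" by simp
  also have "\<dots> \<le> sqrt x" using x by (simp add: of_nat_nat)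
  also have "\<dots> = x powr (1 / 2)" using x by (simp add: powr_half_sqrt)
  also have "\<dots> \<le> x powr (1 - \<beta>)" by (intro powr_mono) (auto simp: \<beta>_def)
  finally have cB: "real (card B) \<le> x powr (1 - \<beta>)" .
  have "x powr (- 1 / 4) \<le> x powr 0" using x by (intro Transcendental.powr_mono) auto
  hence \<delta>: "0 \<le> \<delta>" "\<delta> \<le> 1" using x by (auto simp: \<delta>_def)
  have "real (card D) \<le> \<pi> * (measure sato_tate {-\<delta>..\<delta>} + C / x powr \<alpha>)"
    unfolding D_def using \<delta> by (intro upper) auto
  also have "\<dots> \<le> \<pi> * (2 * \<delta> + C / x powr \<alpha>)"
    using \<delta> \<pi> measure_sato_tate_le[of "-\<delta>" \<delta>] by (intro mult_left_mono add_right_mono) auto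
  also have "\<dots> = \<pi> * x powr (- 1 / 4) + \<pi> * (C / x powr \<alpha>)" by (simp add: \<delta>_def distrib_left)
  also have "\<pi> * x powr (- 1 / 4) \<le> x * x powr (- 1 / 4)" using \<pi> by (intro mult_right_mono) auto
  also have "x * x powr (- 1 / 4) = x powr (3 / 4)"
    using x powr_add[of x 1 "-1/4"] by simp
  also have "\<dots> \<le> x powr (1 - \<beta>)" by (intro powr_mono) (auto simp: \<beta>_def)
  finally have cD: "real (card D) \<le> (1 + C) * x powr (1 - \<beta>)" using err by (simp add: algebra_simps)
  have "{p\<in>R. exceptional s p \<and> real p \<le> x} \<subseteq> A \<union> (B \<union> D)"
  proof
    fix p assume p: "p \<in> {p\<in>R. exceptional s p \<and> real p \<le> x}"
    hence p0: "p > 0" using R prime_gt_0_nat by blast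
    show "p \<in> A \<union> (B \<union> D)"
    proof (cases "\<bar>s p\<bar> > 1 \<or> real p \<le> sqrt x")
      case True
      with p p0 show ?thesis by (auto simp: A_def B_def)
    next
      case False
      hence "\<bar>s p\<bar> \<le> 1 / (2 * sqrt (real p))" using p by (auto simp: exceptional_def)
      also have "\<dots> \<le> 1 / (2 * sqrt (sqrt x))"
        using False x p0 by (intro divide_left_mono mult_left_mono real_sqrt_le_mono) auto
      also have "sqrt (sqrt x) = x powr (1 / 4)"
        using x by (simp add: powr_half_sqrt[symmetric] powr_powr)
      also have "1 / (2 * x powr (1 / 4)) = \<delta>"
        by (simp add: \<delta>_def powr_minus field_simps)
      finally show ?thesis using p by (auto simp: D_def abs_le_iff)
    qed
  qed
  hence "card {p\<in>R. exceptional s p \<and> real p \<le> x} \<le> card (A \<union> (B \<union> D))"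
    using fin by (intro card_mono) auto
  also have "\<dots> \<le> card A + (card B + card D)"
    using card_Un_le[of A "B \<union> D"] card_Un_le[of B D] by linarith
  finally have "real (card {p\<in>R. exceptional s p \<and> real p \<le> x}) \<le> real (card A) + real (card B) + real (card D)"
    by linarith
  also have "\<dots> \<le> (2 * C + 2) * x powr (1 - \<beta>)"
    using cA cB cD by (simp add: algebra_simps)
  finally show "real (card {p\<in>R. exceptional s p \<and> real p \<le> x}) \<le> (2 * C + 2) * x powr (1 - min \<alpha> (1 / 4))"
    by (simp add: \<beta>_def)
qed

section \<open>Power savings in sums over primes\<close>

definition power_saving :: "(nat \<Rightarrow> complex) \<Rightarrow> bool" where
  "power_saving u \<longleftrightarrow> (\<exists>C \<beta>. C > 0 \<and> \<beta> > 0 \<and> (\<forall>n\<ge>2.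
     norm (\<Sum>p | prime p \<and> p \<le> n. u p) \<le> C * real n powr (1 - \<beta>)))"

lemma power_saving_0: "power_saving (\<lambda>_. 0)"
  unfolding power_saving_def by (intro exI[of _ 1]) auto

lemma power_saving_add:
  assumes "power_saving u" "power_saving v"
  shows "power_saving (\<lambda>p. u p + v p)"
proof -
  obtain C \<beta> where u: "C > 0" "\<beta> > 0"
    "\<And>n. n \<ge> 2 \<Longrightarrow> norm (\<Sum>p | prime p \<and> p \<le> n. u p) \<le> C * real n powr (1 - \<beta>)"
    using assms(1) unfolding power_saving_def by metis
  obtain C' \<beta>' where v: "C' > 0" "\<beta>' > 0"
    "\<And>n. n \<ge> 2 \<Longrightarrow> norm (\<Sum>p | prime p \<and> p \<le> n. v p) \<le> C' * real n powr (1 - \<beta>')"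
    using assms(2) unfolding power_saving_def by metis
  have "norm (\<Sum>p | prime p \<and> p \<le> n. u p + v p) \<le> (C + C') * real n powr (1 - min \<beta> \<beta>')"
    if n: "n \<ge> 2" for n
  proof -
    have "norm (\<Sum>p | prime p \<and> p \<le> n. u p + v p) \<le> C * real n powr (1 - \<beta>) + C' * real n powr (1 - \<beta>')"
      unfolding sum.distrib by (intro norm_triangle_le add_mono u v n)
    also have "\<dots> \<le> C * real n powr (1 - min \<beta> \<beta>') + C' * real n powr (1 - min \<beta> \<beta>')"
      using n u(1) v(1) by (intro add_mono mult_left_mono powr_mono) auto
    finally show ?thesis by (simp add: distrib_right)
  qed
  with u(1,2) v(1,2) show ?thesis unfolding power_saving_def
    by (intro exI[of _ "C + C'"] exI[of _ "min \<beta> \<beta>'"]) auto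
qed

lemma power_saving_scale:
  assumes "power_saving u"
  shows "power_saving (\<lambda>p. z * u p)"
proof -
  obtain C \<beta> where *: "C > 0" "\<beta> > 0"
    "\<And>n. n \<ge> 2 \<Longrightarrow> norm (\<Sum>p | prime p \<and> p \<le> n. u p) \<le> C * real n powr (1 - \<beta>)"
    using assms unfolding power_saving_def by metis
  have "norm (\<Sum>p | prime p \<and> p \<le> n. z * u p) \<le> ((norm z + 1) * C) * real n powr (1 - \<beta>)"
    if n: "n \<ge> 2" for n
  proof -
    have "norm (\<Sum>p | prime p \<and> p \<le> n. z * u p) \<le> (norm z + 1) * (C * real n powr (1 - \<beta>))"
      unfolding sum_distrib_left[symmetric] norm_mult
      by (intro mult_mono *(3) n) auto
    thus ?thesis by (simp only: mult.assoc)
  qed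
  moreover have "norm z + 1 > 0" using norm_ge_zero[of z] by linarith
  ultimately show ?thesis using *(1,2) unfolding power_saving_def
    by (intro exI[of _ "(norm z + 1) * C"] exI[of _ \<beta>]) simp
qed

lemma power_saving_sum:
  "finite I \<Longrightarrow> (\<And>i. i \<in> I \<Longrightarrow> power_saving (u i)) \<Longrightarrow> power_saving (\<lambda>p. \<Sum>i\<in>I. u i p)"
  by (induction I rule: finite_induct) (auto intro: power_saving_0 power_saving_add)

text \<open>Off the exceptional primes \<open>h\<close> is the difference of the indicators of
  positive and negative angles, and the two counts share the main term
  \<open>measure sato_tate {0..1} / \<kappa>\<close>. The larger set \<open>R\<close> provides the
  sparsity of exceptional primes, which total mass gives only when no factor \<open>\<kappa>\<close>
  intervenes.\<close>

lemma power_saving_signs: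
  fixes s h :: "nat \<Rightarrow> real" and Q :: "nat set"
  assumes Q: "\<And>p. p \<in> Q \<Longrightarrow> prime p" and C: "C > 0" "\<alpha> > 0"
    and equi: "\<And>u v x. -1 \<le> u \<Longrightarrow> u \<le> v \<Longrightarrow> v \<le> 1 \<Longrightarrow> x \<ge> 2 \<Longrightarrow>
      \<bar>real (card {p\<in>Q. real p \<le> x \<and> s p \<in> {u..v}}) / real (prime_pi x) - measure sato_tate {u..v} / \<kappa>\<bar>
        \<le> C / x powr \<alpha>"
    and QR: "Q \<subseteq> R"
    and sparse: "C' > 0" "\<beta> > 0" "\<And>x. x \<ge> 2 \<Longrightarrow>
      real (card {p\<in>R. exceptional s p \<and> real p \<le> x}) \<le> C' * x powr (1 - \<beta>)"
    and bound: "\<And>p. \<bar>h p\<bar> \<le> 1"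
    and sgn: "\<And>p. p \<in> Q \<Longrightarrow> \<bar>s p\<bar> > 1 / (2 * sqrt (real p)) \<Longrightarrow> h p = sgn (s p)"
  shows "power_saving (\<lambda>p. if p \<in> Q then of_real (h p) else 0)"
proof -
  define \<gamma> where "\<gamma> = min \<alpha> \<beta>"
  have "norm (\<Sum>p | prime p \<and> p \<le> n. if p \<in> Q then complex_of_real (h p) else 0)
      \<le> (2 * C' + 2 * C) * real n powr (1 - \<gamma>)" if n: "n \<ge> 2" for n
  proof -
    define x where "x = real n"
    have x: "x \<ge> 2" using n by (simp add: x_def)
    define \<pi> where "\<pi> = real (prime_pi x)"
    have \<pi>: "\<pi> > 0" "\<pi> \<le> x" using prime_pi_bounds[OF x] by (simp_all add: \<pi>_def)
    define S where "S = {p\<in>Q. real p \<le> x}"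
    have finS: "finite S" unfolding S_def
      by (rule finite_subset[OF _ finite_nat_le_real[of "\<lambda>_. True" x]]) auto
    define P where "P = {p\<in>S. s p \<in> {0..1}}"
    define M where "M = {p\<in>S. s p \<in> {-1..0}}"
    define X where "X = {p\<in>S. exceptional s p}"
    have ind: "(\<Sum>p\<in>S. if p \<in> {p\<in>S. Z p} then 1 else 0) = real (card {p\<in>S. Z p})" for Z
      using finS by (simp flip: sum.inter_filter)
    have "(\<Sum>p | prime p \<and> p \<le> n. if p \<in> Q then complex_of_real (h p) else 0) = of_real (\<Sum>p\<in>S. h p)"
    proof -
      have "finite {p. prime p \<and> p \<le> n}" by (rule finite_subset[of _ "{..n}"]) auto
      hence "(\<Sum>p | prime p \<and> p \<le> n. if p \<in> Q then complex_of_real (h p) else 0) =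
          (\<Sum>p | p \<in> {p. prime p \<and> p \<le> n} \<and> p \<in> Q. complex_of_real (h p))"
        by (rule sum.inter_filter[symmetric])
      also have "{p. p \<in> {p. prime p \<and> p \<le> n} \<and> p \<in> Q} = S" using Q by (auto simp: S_def x_def)
      finally show ?thesis by simp
    qed
    hence "norm (\<Sum>p | prime p \<and> p \<le> n. if p \<in> Q then complex_of_real (h p) else 0) = \<bar>\<Sum>p\<in>S. h p\<bar>"
      by (simp only: norm_of_real)
    \<comment> \<open>An angle equal to \<open>0\<close> is counted in both \<open>P\<close> and
      \<open>M\<close> and cancels; such a prime is exceptional, so the value of \<open>h\<close>
      there costs at most \<open>2\<close> like that of any other prime in \<open>X\<close>.\<close>
    also have "(\<Sum>p\<in>S. h p) = (\<Sum>p\<in>S. h p - (if p \<in> P then 1 else 0) + (if p \<in> M then 1 else 0))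
       + (real (card P) - real (card M))"
      using ind[of "\<lambda>p. s p \<in> {0..1}"] ind[of "\<lambda>p. s p \<in> {-1..0}"]
      by (simp add: sum.distrib sum_subtractf P_def M_def)
    also have "\<bar>\<dots>\<bar> \<le> (\<Sum>p\<in>S. 2 * (if p \<in> X then 1 else 0)) + \<bar>real (card P) - real (card M)\<bar>"
    proof (rule order_trans[OF abs_triangle_ineq], rule add_right_mono,
        rule order_trans[OF sum_abs], rule sum_mono)
      fix p assume p: "p \<in> S"
      show "\<bar>h p - (if p \<in> P then 1 else 0) + (if p \<in> M then 1 else 0)\<bar> \<le> 2 * (if p \<in> X then 1 else 0)"
      proof (cases "p \<in> X")
        case True
        thus ?thesis using bound[of p] by auto
      next
        case False
        hence s: "\<bar>s p\<bar> > 1 / (2 * sqrt (real p))" "\<bar>s p\<bar> \<le> 1"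
          using p by (auto simp: X_def exceptional_def)
        have "1 / (2 * sqrt (real p)) \<ge> 0" by simp
        with s have "s p \<noteq> 0" by linarith
        moreover have "h p = sgn (s p)" using sgn s p by (auto simp: S_def)
        ultimately show ?thesis using s(2) p False by (auto simp: P_def M_def sgn_if)
      qed
    qed
    also have "(\<Sum>p\<in>S. 2 * (if p \<in> X then 1 else 0)) = 2 * real (card X)"
      using ind[of "exceptional s"] by (simp add: X_def sum_distrib_left[symmetric])
    also have "real (card X) \<le> C' * x powr (1 - \<beta>)"
    proof -
      have "card X \<le> card {p\<in>R. exceptional s p \<and> real p \<le> x}"
        unfolding X_def S_def using QR
        by (intro card_mono finite_subset[OF _ finite_nat_le_real[of "\<lambda>_. True" x]]) auto
      thus ?thesis using sparse(3)[OF x] by linarith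
    qed
    also have "\<bar>real (card P) - real (card M)\<bar> \<le> 2 * C * x powr (1 - \<alpha>)"
    proof -
      have PM: "P = {p\<in>Q. real p \<le> x \<and> s p \<in> {0..1}}" "M = {p\<in>Q. real p \<le> x \<and> s p \<in> {-1..0}}"
        by (auto simp: P_def M_def S_def)
      have "\<bar>real (card P) / \<pi> - real (card M) / \<pi>\<bar> \<le> 2 * (C / x powr \<alpha>)"
        using equi[of 0 1 x] equi[of "-1" 0 x] x measure_sato_tate_values(2)
        unfolding PM[symmetric] \<pi>_def[symmetric] by simp
      hence "\<bar>real (card P) - real (card M)\<bar> / \<pi> \<le> 2 * (C / x powr \<alpha>)"
        using \<pi> by (simp flip: diff_divide_distrib)
      hence "\<bar>real (card P) - real (card M)\<bar> \<le> 2 * (C / x powr \<alpha>) * \<pi>"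
        using \<pi> by (simp add: pos_divide_le_eq)
      also have "\<dots> \<le> 2 * (C / x powr \<alpha>) * x" using \<pi> C by (intro mult_left_mono) auto
      also have "\<dots> = 2 * C * x powr (1 - \<alpha>)" using x by (simp add: powr_diff)
      finally show ?thesis .
    qed
    also have "2 * (C' * x powr (1 - \<beta>)) + 2 * C * x powr (1 - \<alpha>)
        \<le> 2 * (C' * x powr (1 - \<gamma>)) + 2 * C * x powr (1 - \<gamma>)"
      using x C sparse by (intro add_mono mult_left_mono powr_mono) (auto simp: \<gamma>_def)
    finally show ?thesis by (simp add: x_def algebra_simps)
  qed
  moreover have "2 * C' + 2 * C > 0" "\<gamma> > 0" using C sparse by (auto simp: \<gamma>_def)
  ultimately show ?thesis unfolding power_saving_def by blast
qed

section \<open>Partial summation\<close>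

lemma sum_by_parts:
  fixes u f :: "nat \<Rightarrow> real"
  shows "n > 0 \<Longrightarrow> (\<Sum>i=1..n. u i * f i) =
    (\<Sum>i=1..n. u i) * f n + (\<Sum>k\<in>{1..<n}. (\<Sum>i=1..k. u i) * (f k - f (Suc k)))"
proof (induction n rule: nat_induct_non_zero)
  case (Suc n)
  thus ?case by (simp add: sum.atLeastLessThan_Suc algebra_simps)
qed simp

text \<open>In partial summation the increments of \<open>ln\<close> telescope, so the weight costs
  only a factor \<open>2 * ln n\<close>, which the power saving absorbs.\<close>

lemma power_saving_imp_log_weighted:
  fixes u :: "nat \<Rightarrow> real"
  assumes "power_saving (\<lambda>p. of_real (u p))"
  shows "(\<lambda>n. (\<Sum>p | prime p \<and> p \<le> n. u p * ln (real p)) / real n) \<longlonglongrightarrow> 0"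
proof -
  define v where "v p = (if prime p then u p else 0)" for p
  have v: "(\<Sum>p | prime p \<and> p \<le> n. u p * g p) = (\<Sum>p=1..n. v p * g p)" for g n
  proof -
    have "(\<Sum>p=1..n. v p * g p) = (\<Sum>p | prime p \<and> p \<le> n. v p * g p)"
      by (intro sum.mono_neutral_right) (auto simp: v_def Suc_le_eq prime_gt_0_nat)
    also have "\<dots> = (\<Sum>p | prime p \<and> p \<le> n. u p * g p)"
      by (intro sum.cong) (auto simp: v_def)
    finally show ?thesis ..
  qed
  obtain C \<beta> where C: "C > 0" "\<beta> > 0" and
    U: "\<And>n. n \<ge> 2 \<Longrightarrow> norm (\<Sum>p | prime p \<and> p \<le> n. complex_of_real (u p)) \<le> C * real n powr (1 - \<beta>)"
    using assms unfolding power_saving_def by metis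
  have V2: "\<bar>\<Sum>p=1..n. v p\<bar> \<le> C * real n powr (1 - \<beta>)" if "n \<ge> 2" for n
  proof -
    have "(\<Sum>p | prime p \<and> p \<le> n. u p) = (\<Sum>p=1..n. v p)" using v[of "\<lambda>_. 1" n] by simp
    with U[OF that] show ?thesis by (simp only: norm_of_real flip: of_real_sum)
  qed
  \<comment> \<open>Capping the saving at \<open>1\<close> makes
    \<open>n powr (1 - \<gamma>)\<close> nondecreasing, so the bound at \<open>n\<close> serves for
    all shorter sums.\<close>
  define \<gamma> where "\<gamma> = min \<beta> 1"
  have \<gamma>: "\<gamma> > 0" "\<gamma> \<le> 1" "\<gamma> \<le> \<beta>" using C by (auto simp: \<gamma>_def)
  have V: "\<bar>\<Sum>p=1..k. v p\<bar> \<le> C * real n powr (1 - \<gamma>)" if "1 \<le> k" "k \<le> n" for k n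
  proof (cases "k = 1")
    case True
    thus ?thesis using C by (simp add: v_def)
  next
    case False
    have "\<bar>\<Sum>p=1..k. v p\<bar> \<le> C * real k powr (1 - \<beta>)" using False that by (intro V2) auto
    also have "\<dots> \<le> C * real k powr (1 - \<gamma>)" using C \<gamma> that by (intro mult_left_mono powr_mono) auto
    also have "\<dots> \<le> C * real n powr (1 - \<gamma>)" using C \<gamma> that by (intro mult_left_mono powr_mono2) auto
    finally show ?thesis .
  qed
  have bound: "\<bar>(\<Sum>p | prime p \<and> p \<le> n. u p * ln (real p)) / real n\<bar> \<le> 2 * C * (ln (real n) / real n powr \<gamma>)"
    if n: "n \<ge> 1" for n
  proof -
    define B where "B = C * real n powr (1 - \<gamma>)"
    have "\<bar>\<Sum>p=1..n. v p * ln (real p)\<bar> \<le> B * ln (real n) + (\<Sum>k\<in>{1..<n}. B * (ln (real (Suc k)) - ln (real k)))"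
    proof -
      have "\<bar>(\<Sum>i=1..n. v i) * ln (real n)\<bar> \<le> B * ln (real n)"
        unfolding abs_mult B_def using n C(1) by (intro mult_mono V) auto
      moreover have "\<bar>\<Sum>k\<in>{1..<n}. (\<Sum>i=1..k. v i) * (ln (real k) - ln (real (Suc k)))\<bar>
          \<le> (\<Sum>k\<in>{1..<n}. B * (ln (real (Suc k)) - ln (real k)))"
      proof (intro order_trans[OF sum_abs] sum_mono)
        fix k assume k: "k \<in> {1..<n}"
        have "\<bar>ln (real k) - ln (real (Suc k))\<bar> = ln (real (Suc k)) - ln (real k)"
          using k by (simp add: abs_if)
        thus "\<bar>(\<Sum>i=1..k. v i) * (ln (real k) - ln (real (Suc k)))\<bar> \<le> B * (ln (real (Suc k)) - ln (real k))"
          unfolding abs_mult B_def using k C(1) V[of k n] by (auto intro!: mult_mono)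
      qed
      ultimately show ?thesis
        using n by (subst sum_by_parts) (auto intro!: order_trans[OF abs_triangle_ineq] add_mono)
    qed
    also have "(\<Sum>k\<in>{1..<n}. B * (ln (real (Suc k)) - ln (real k))) = B * ln (real n)"
      using sum_Suc_diff'[of 1 n "\<lambda>k. ln (real k)"] n
      by (simp del: of_nat_Suc flip: sum_distrib_left)
    also have "B * ln (real n) + B * ln (real n) = 2 * C * (ln (real n) / real n powr \<gamma>) * real n"
      using n by (simp add: B_def powr_diff)
    finally show ?thesis using n by (simp add: v abs_divide divide_le_eq)
  qed
  have "(\<lambda>n. ln (real n) / real n powr \<gamma>) \<longlonglongrightarrow> 0" using \<gamma>(1) by (rule lim_ln_over_power)
  hence lim: "(\<lambda>n. 2 * C * (ln (real n) / real n powr \<gamma>)) \<longlonglongrightarrow> 0"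
    by (rule tendsto_mult_right_zero)
  show ?thesis
    by (rule Lim_null_comparison[OF _ lim])
      (use bound in \<open>auto intro!: eventually_sequentiallyI[of 1]\<close>)
qed

text \<open>Partial summation again: the differences of \<open>1 / k\<close> are at most
  \<open>1 / k ^ 2\<close>, which leaves the convergent series of
  \<open>k powr (- 1 - \<beta>)\<close>.\<close>

lemma summable_reciprocals_of_sparse:
  fixes W :: "nat set"
  assumes "C > 0" "\<beta> > 0" "0 \<notin> W"
    and card: "\<And>n. n \<ge> 2 \<Longrightarrow> real (card {m\<in>W. m \<le> n}) \<le> C * real n powr (1 - \<beta>)"
  shows "summable (\<lambda>m. if m \<in> W then 1 / real m else 0)"
proof -
  define w where "w m = (if m \<in> W then 1 else 0 :: real)" for m
  have w0: "w m \<ge> 0" for m by (simp add: w_def)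
  \<comment> \<open>The maximum with \<open>1\<close> covers \<open>n = 1\<close>, to which the
    counting hypothesis does not extend.\<close>
  define D where "D = max C 1"
  have sum_w: "(\<Sum>m=1..n. w m) = real (card {m\<in>W. m \<le> n})" for n
  proof -
    have "{m \<in> {1..n}. m \<in> W} = {m\<in>W. m \<le> n}" using \<open>0 \<notin> W\<close>
      by (auto simp: Suc_le_eq intro!: Nat.gr0I)
    thus ?thesis unfolding w_def by (simp flip: sum.inter_filter)
  qed
  have W: "(\<Sum>m=1..n. w m) \<le> D * real n powr (1 - \<beta>)" if "n \<ge> 1" for n
  proof (cases "n = 1")
    case True thus ?thesis by (simp add: w_def D_def le_max_iff_disj)
  next
    case False
    have "(\<Sum>m=1..n. w m) \<le> C * real n powr (1 - \<beta>)"
      unfolding sum_w using False that by (intro card) auto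
    also have "\<dots> \<le> D * real n powr (1 - \<beta>)" by (intro mult_right_mono) (auto simp: D_def)
    finally show ?thesis .
  qed
  define Z where "Z = (\<Sum>k. real k powr (- 1 - \<beta>))"
  have summ: "summable (\<lambda>k. real k powr (- 1 - \<beta>))"
    using assms by (simp add: summable_real_powr_iff)
  have bound: "(\<Sum>m=1..n. w m * (1 / real m)) \<le> D + D * Z" if n: "n \<ge> 1" for n
  proof -
    have "(\<Sum>m=1..n. w m * (1 / real m)) = (\<Sum>m=1..n. w m) * (1 / real n) +
        (\<Sum>k\<in>{1..<n}. (\<Sum>m=1..k. w m) * (1 / real k - 1 / real (Suc k)))"
      using n by (intro sum_by_parts) auto
    also have "(\<Sum>m=1..n. w m) * (1 / real n) \<le> D"
    proof -
      have "(\<Sum>m=1..n. w m) * (1 / real n) \<le> (D * real n powr (1 - \<beta>)) * (1 / real n)"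
        using n by (intro mult_right_mono W) auto
      also have "\<dots> = D * real n powr (- \<beta>)" using n by (simp add: powr_diff powr_minus field_simps)
      also have "\<dots> \<le> D * real n powr 0" using n assms by (intro mult_left_mono powr_mono) (auto simp: D_def)
      finally show ?thesis using n by simp
    qed
    also have "(\<Sum>k\<in>{1..<n}. (\<Sum>m=1..k. w m) * (1 / real k - 1 / real (Suc k)))
        \<le> (\<Sum>k\<in>{1..<n}. D * real k powr (- 1 - \<beta>))"
    proof (intro sum_mono)
      fix k assume k: "k \<in> {1..<n}"
      have "(\<Sum>m=1..k. w m) * (1 / real k - 1 / real (Suc k)) \<le> (D * real k powr (1 - \<beta>)) * (1 / real k ^ 2)"
      proof (intro mult_mono W)
        have "1 / real k - 1 / real (Suc k) = 1 / (real k * real (Suc k))"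
          using k by (simp add: field_simps)
        also have "\<dots> \<le> 1 / real k ^ 2"
          unfolding power2_eq_square using k by (intro divide_left_mono mult_left_mono) auto
        finally show "1 / real k - 1 / real (Suc k) \<le> 1 / real k ^ 2" .
        show "0 \<le> 1 / real k - 1 / real (Suc k)" using k by (simp add: field_simps)
      qed (use k in \<open>auto simp: D_def\<close>)
      also have "\<dots> = D * real k powr (1 - \<beta> - 2)"
        using k by (simp only: powr_diff[of _ "1 - \<beta>" 2]) simp
      finally show "(\<Sum>m=1..k. w m) * (1 / real k - 1 / real (Suc k)) \<le> D * real k powr (- 1 - \<beta>)"
        by simp
    qed
    also have "\<dots> = D * (\<Sum>k\<in>{1..<n}. real k powr (- 1 - \<beta>))" by (simp add: sum_distrib_left)
    also have "\<dots> \<le> D * Z" unfolding Z_def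
      by (intro mult_left_mono sum_le_suminf summ) (auto simp: D_def)
    finally show ?thesis by simp
  qed
  have "(\<Sum>m<n. w m * (1 / real m)) \<le> D + D * Z" for n
  proof -
    have "(\<Sum>m<n. w m * (1 / real m)) \<le> (\<Sum>m\<in>insert 0 {1..Suc n}. w m * (1 / real m))"
      by (intro sum_mono2) (auto simp: w0)
    also have "\<dots> = (\<Sum>m=1..Suc n. w m * (1 / real m))" by simp
    finally show ?thesis using bound[of "Suc n"] by simp
  qed
  hence "summable (\<lambda>m. w m * (1 / real m))"
    by (intro summableI_nonneg_bounded) (auto simp: w0)
  moreover have "(\<lambda>m. w m * (1 / real m)) = (\<lambda>m. if m \<in> W then 1 / real m else 0)"
    by (auto simp: w_def)
  ultimately show ?thesis by simp
qed

subsection \<open>Hecke relations\<close>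

lemma dirichlet_character_nonzero:
  "dirichlet_character m \<epsilon> \<Longrightarrow> \<epsilon> n \<noteq> 0 \<longleftrightarrow> coprime n (int m)"
  by (simp add: dirichlet_character_def)

lemma dirichlet_character_mult:
  "dirichlet_character m \<epsilon> \<Longrightarrow> \<epsilon> (x * y) = \<epsilon> x * \<epsilon> y"
  by (simp add: dirichlet_character_def)

lemma finite_character_image:
  assumes "q > 0" "dirichlet_character q \<epsilon>"
  shows "finite (character_image q \<epsilon>)"
proof (rule finite_subset)
  show "character_image q \<epsilon> \<subseteq> \<epsilon> ` {0..<int q}"
  proof
    fix z assume "z \<in> character_image q \<epsilon>"
    then obtain n where n: "z = \<epsilon> n" by (auto simp: character_image_def)
    have "\<epsilon> n = \<epsilon> (n mod int q)"
      by (rule dirichlet_character_cong[OF assms(2)]) (simp add: cong_def)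
    thus "z \<in> \<epsilon> ` {0..<int q}" using n assms(1) by simp
  qed
qed simp

text \<open>Multiplication by the square of a unit preserves both divisibility by \<open>p\<close>
  and being a square modulo \<open>p\<close>; the argument includes \<open>p = 2\<close>.\<close>

lemma Legendre_square_mult:
  assumes "prime p" "\<not> p dvd m"
  shows "Legendre (x * (int m)\<^sup>2) (int p) = Legendre x (int p)"
proof -
  have p: "prime (int p)" "\<not> int p dvd int m" using assms by simp_all
  hence cop: "coprime (int m) (int p)"
    by (metis coprime_commute prime_imp_coprime)
  have zero: "[x * (int m)\<^sup>2 = 0] (mod int p) \<longleftrightarrow> [x = 0] (mod int p)"
    using p by (simp add: cong_0_iff prime_dvd_mult_iff prime_dvd_power_iff)
  have "QuadRes (int p) (x * (int m)\<^sup>2) \<longleftrightarrow> QuadRes (int p) x"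
  proof
    assume "QuadRes (int p) x"
    then obtain y where "[y\<^sup>2 = x] (mod int p)" by (auto simp: QuadRes_def)
    hence "[(y * int m)\<^sup>2 = x * (int m)\<^sup>2] (mod int p)"
      unfolding power_mult_distrib by (intro cong_mult cong_refl)
    thus "QuadRes (int p) (x * (int m)\<^sup>2)" by (auto simp: QuadRes_def)
  next
    assume "QuadRes (int p) (x * (int m)\<^sup>2)"
    then obtain y where y: "[y\<^sup>2 = x * (int m)\<^sup>2] (mod int p)" by (auto simp: QuadRes_def)
    obtain m' where m': "[int m * m' = 1] (mod int p)" using cong_solve_coprime_int[OF cop] by auto
    have "[y\<^sup>2 * m'\<^sup>2 = x * (int m)\<^sup>2 * m'\<^sup>2] (mod int p)" by (intro cong_mult y cong_refl)
    also have "x * (int m)\<^sup>2 * m'\<^sup>2 = x * (int m * m')\<^sup>2" by (simp add: power_mult_distrib)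
    also have "[x * (int m * m')\<^sup>2 = x * 1\<^sup>2] (mod int p)" by (intro cong_mult cong_pow m' cong_refl)
    finally have "[(y * m')\<^sup>2 = x] (mod int p)" by (simp add: power_mult_distrib)
    thus "QuadRes (int p) x" by (auto simp: QuadRes_def)
  qed
  with zero show ?thesis by (simp add: Legendre_def)
qed

text \<open>
  On the square class of a squarefree \<open>t\<close>, Shimura's formula for \<open>T(p\<^sup>2)\<close> is a two-term recursion
  in the exponent of \<open>p\<close> whose coefficients do not depend on the part prime to \<open>p\<close>.
\<close>

lemma hecke_half_prime_power:
  assumes eigen: "hecke_eigenform_half k chi a" and t: "t > 0" "squarefree t"
    and p: "prime p"
  shows "\<exists>c. \<forall>m. m > 0 \<and> \<not> p dvd m \<longrightarrow> a (t * (p ^ j * m)\<^sup>2) = c * a (t * m\<^sup>2)"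
proof -
  obtain ev where ev: "\<And>n. n \<ge> 1 \<Longrightarrow> hecke_half_coeff k chi p a n = ev * a n"
    using eigen p unfolding hecke_eigenform_half_def by blast
  have p0: "p > 0" using p prime_gt_0_nat by blast
  \<comment> \<open>The Legendre term of the Hecke operator at
    \<open>t * (p ^ j * m)\<^sup>2\<close>; the square of \<open>m\<close> drops out, so
    \<open>L\<close> depends on \<open>j\<close> alone.\<close>
  define L where "L j = chi (int p) * of_int (Legendre ((-1) ^ k * int t * (int (p ^ j))\<^sup>2) (int p)) * of_nat p ^ (k - 1)" for j
  have L: "chi (int p) * of_int (Legendre ((-1) ^ k * int (t * (p ^ j * m)\<^sup>2)) (int p)) * of_nat p ^ (k - 1) = L j"
    if "\<not> p dvd m" for m j
    using Legendre_square_mult[OF p that, of "(-1) ^ k * int t * (int (p ^ j))\<^sup>2"]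
    by (simp add: L_def power_mult_distrib mult_ac)
  have base: "a (t * (p ^ Suc 0 * m)\<^sup>2) = (ev - L 0) * a (t * m\<^sup>2)" if m: "m > 0" "\<not> p dvd m" for m
  proof -
    \<comment> \<open>Squarefreeness of \<open>t\<close> kills the third Hecke term, which starts
      the recursion.\<close>
    have "\<not> p\<^sup>2 dvd t * m\<^sup>2"
    proof
      assume "p\<^sup>2 dvd t * m\<^sup>2"
      moreover have "coprime (p\<^sup>2) (m\<^sup>2)" using prime_imp_coprime[OF p m(2)] by simp
      ultimately have "p\<^sup>2 dvd t" by (simp add: coprime_dvd_mult_left_iff)
      hence "p dvd 1" using t(2) by (metis squarefreeD)
      thus False using p by simp
    qed
    moreover have "t * m\<^sup>2 \<ge> 1" using t m by simp
    ultimately have "a (p\<^sup>2 * (t * m\<^sup>2)) + L 0 * a (t * m\<^sup>2) = ev * a (t * m\<^sup>2)"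
      using ev[of "t * m\<^sup>2"] L[OF m(2), of 0] by (simp add: hecke_half_coeff_def)
    thus ?thesis by (simp add: algebra_simps power_mult_distrib)
  qed
  have step: "a (t * (p ^ Suc (Suc j) * m)\<^sup>2) = (ev - L (Suc j)) * a (t * (p ^ Suc j * m)\<^sup>2)
      - chi (int (p\<^sup>2)) * of_nat p ^ (2 * k - 1) * a (t * (p ^ j * m)\<^sup>2)"
    if m: "m > 0" "\<not> p dvd m" for m j
  proof -
    have n: "t * (p ^ Suc j * m)\<^sup>2 = p\<^sup>2 * (t * (p ^ j * m)\<^sup>2)"
      and n': "p\<^sup>2 * (t * (p ^ Suc j * m)\<^sup>2) = t * (p ^ Suc (Suc j) * m)\<^sup>2"
      by (simp_all add: power_mult_distrib mult_ac)
    have "t * (p ^ Suc j * m)\<^sup>2 div p\<^sup>2 = t * (p ^ j * m)\<^sup>2" "p\<^sup>2 dvd t * (p ^ Suc j * m)\<^sup>2"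
      unfolding n using p0 by simp_all
    moreover have "t * (p ^ Suc j * m)\<^sup>2 \<ge> 1" using t m p0 by (simp add: Suc_le_eq)
    ultimately have "a (t * (p ^ Suc (Suc j) * m)\<^sup>2) + L (Suc j) * a (t * (p ^ Suc j * m)\<^sup>2)
       + chi (int (p\<^sup>2)) * of_nat p ^ (2 * k - 1) * a (t * (p ^ j * m)\<^sup>2) = ev * a (t * (p ^ Suc j * m)\<^sup>2)"
      using ev[of "t * (p ^ Suc j * m)\<^sup>2"] L[OF m(2), of "Suc j"]
      unfolding hecke_half_coeff_def n' by (simp only: if_True)
    thus ?thesis by (simp add: algebra_simps)
  qed
  show ?thesis
  proof (induction j rule: induct_nat_012)
    case 0
    show ?case by (intro exI[of _ 1]) simp
  next
    case 1
    show ?case using base by (intro exI[of _ "ev - L 0"]) auto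
  next
    case (ge2 j)
    then obtain c c' where c:
      "\<And>m. m > 0 \<and> \<not> p dvd m \<Longrightarrow> a (t * (p ^ j * m)\<^sup>2) = c * a (t * m\<^sup>2)"
      "\<And>m. m > 0 \<and> \<not> p dvd m \<Longrightarrow> a (t * (p ^ Suc j * m)\<^sup>2) = c' * a (t * m\<^sup>2)"
      by metis
    show ?case
    proof (intro exI allI impI)
      fix m assume m: "m > 0 \<and> \<not> p dvd m"
      show "a (t * (p ^ Suc (Suc j) * m)\<^sup>2) =
          ((ev - L (Suc j)) * c' - chi (int (p\<^sup>2)) * of_nat p ^ (2 * k - 1) * c) * a (t * m\<^sup>2)"
        unfolding step[OF conjunct1[OF m] conjunct2[OF m]] c[OF m]
        by (simp only: left_diff_distrib mult.assoc)
    qed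
  qed
qed

text \<open>Taking \<open>m = 1\<close> identifies the common factor \<open>c\<close> through
  \<open>c * a t\<close>; keeping \<open>a t\<close> on the left avoids a division.\<close>

lemma hecke_half_multiplicative:
  assumes "hecke_eigenform_half k chi a" "t > 0" "squarefree t" "prime p" "m > 0" "\<not> p dvd m"
  shows "a t * a (t * (p ^ j * m)\<^sup>2) = a (t * (p ^ j)\<^sup>2) * a (t * m\<^sup>2)"
proof -
  obtain c where c: "\<And>m. m > 0 \<and> \<not> p dvd m \<Longrightarrow> a (t * (p ^ j * m)\<^sup>2) = c * a (t * m\<^sup>2)"
    using hecke_half_prime_power[OF assms(1-4), of j] by blast
  have "\<not> p dvd 1" using prime_gt_1_nat[OF assms(4)] by auto
  with c[of 1] c[of m] assms show ?thesis by simp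
qed

text \<open>At a prime the divisor sum has two terms. Of the quadratic symbol in the second only its
  size is kept, which bounds the shift between \<open>a (t * p\<^sup>2)\<close> and
  \<open>A p\<close>.\<close>

lemma shimura_lift_prime:
  assumes lift: "shimura_lift k N chi t a F A" and chi: "dirichlet_character N chi" and p: "prime p"
  obtains \<kappa> :: int where "\<bar>\<kappa>\<bar> \<le> 1"
    "A p = a (t * p\<^sup>2) + chi (int p) * of_int \<kappa> * of_nat p ^ (k - 1) * a t"
proof
  define D where "D = (-1) ^ k * (int N)\<^sup>2 * int t"
  show "\<bar>kronecker_prime D p\<bar> \<le> 1"
    by (auto simp: kronecker_prime_def Legendre_def)
  have ks: "kronecker_symbol D 1 = 1" "kronecker_symbol D p = kronecker_prime D p"
    using p by (simp_all add: kronecker_symbol_def prime_factorization_prime)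
  have "{e. e dvd p} = {1, p}" using p by (auto simp: prime_nat_iff)
  moreover have "p \<noteq> 1" "p > 0" using prime_gt_1_nat[OF p] by simp_all
  ultimately have "A p = shimura_character k N chi t 1 * a (p\<^sup>2 * t)
      + shimura_character k N chi t p * of_nat p ^ (k - 1) * a t"
    using lift by (simp add: shimura_lift_def)
  thus "A p = a (t * p\<^sup>2) + chi (int p) * of_int (kronecker_prime D p) * of_nat p ^ (k - 1) * a t"
    using ks dirichlet_character_one[OF chi]
    by (simp add: shimura_character_def D_def mult.commute)
qed

subsection \<open>Equidistribution of signs\<close>

lemma power_saving_cong:
  assumes "\<And>p. prime p \<Longrightarrow> u p = v p" "power_saving u"
  shows "power_saving v"
proof -
  have "(\<Sum>p | prime p \<and> p \<le> n. v p) = (\<Sum>p | prime p \<and> p \<le> n. u p)" for n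
    by (intro sum.cong) (auto simp: assms(1))
  thus ?thesis using assms(2) by (simp add: power_saving_def)
qed

text \<open>For values in \<open>{-1, 0, 1}\<close> the indicator of \<open>h n = 1\<close> is half
  the sum of \<open>h n\<close> and the indicator of \<open>h n \<noteq> 0\<close>; for
  \<open>h n = -1\<close> it is half the difference.\<close>

lemma seq_density_signs:
  fixes h :: "nat \<Rightarrow> real" and T :: "nat set"
  assumes h: "\<And>n. h n \<in> {-1, 0, 1}" and T: "\<And>n. n \<in> T \<Longrightarrow> n > 0"
    and nonzero: "seq_density {n\<in>T. h n \<noteq> 0} \<Delta>"
    and mean: "(\<lambda>x. (\<Sum>n | n \<in> {1..x} \<and> n \<in> T. h n) / real x) \<longlonglongrightarrow> 0"
  shows "seq_density {n\<in>T. h n = 1} (\<Delta> / 2)" "seq_density {n\<in>T. h n = -1} (\<Delta> / 2)"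
proof -
  have cnt: "counting {n\<in>T. P n} x = (\<Sum>n | n \<in> {1..x} \<and> n \<in> T. if P n then 1 else 0)" for P x
  proof -
    have "{m \<in> {n\<in>T. P n}. m \<le> x} = {n \<in> {n \<in> {1..x}. n \<in> T}. P n}"
      using T by (auto simp: Suc_le_eq)
    moreover have "real (card {n \<in> {n \<in> {1..x}. n \<in> T}. P n}) =
        (\<Sum>n\<in>{n \<in> {1..x}. n \<in> T}. if P n then 1 else 0)"
      by (subst sum.inter_filter[symmetric]) simp_all
    ultimately show ?thesis by (simp add: counting_def)
  qed
  have "counting {n\<in>T. h n = 1} x = (counting {n\<in>T. h n \<noteq> 0} x + (\<Sum>n | n \<in> {1..x} \<and> n \<in> T. h n)) / 2"
    and "counting {n\<in>T. h n = -1} x = (counting {n\<in>T. h n \<noteq> 0} x - (\<Sum>n | n \<in> {1..x} \<and> n \<in> T. h n)) / 2" for x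
    unfolding cnt sum.distrib[symmetric] sum_subtractf[symmetric] sum_divide_distrib
    by (intro sum.cong refl; use h in \<open>force\<close>)+
  hence eq: "counting {n\<in>T. h n = 1} x / real x =
      (counting {n\<in>T. h n \<noteq> 0} x / real x + (\<Sum>n | n \<in> {1..x} \<and> n \<in> T. h n) / real x) / 2"
    and eq': "counting {n\<in>T. h n = -1} x / real x =
      (counting {n\<in>T. h n \<noteq> 0} x / real x - (\<Sum>n | n \<in> {1..x} \<and> n \<in> T. h n) / real x) / 2" for x
    by (simp_all add: add_divide_distrib diff_divide_distrib)
  have lim: "(\<lambda>x. (counting {n\<in>T. h n \<noteq> 0} x / real x + (\<Sum>n | n \<in> {1..x} \<and> n \<in> T. h n) / real x) / 2)
      \<longlonglongrightarrow> (\<Delta> + 0) / 2"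
    and lim': "(\<lambda>x. (counting {n\<in>T. h n \<noteq> 0} x / real x - (\<Sum>n | n \<in> {1..x} \<and> n \<in> T. h n) / real x) / 2)
      \<longlonglongrightarrow> (\<Delta> - 0) / 2"
    using nonzero mean unfolding seq_density_def by (intro tendsto_intros; simp)+
  show "seq_density {n\<in>T. h n = 1} (\<Delta> / 2)" "seq_density {n\<in>T. h n = -1} (\<Delta> / 2)"
    unfolding seq_density_def eq eq' using lim lim' by simp_all
qed

definition prime_class :: "nat \<Rightarrow> (int \<Rightarrow> complex) \<Rightarrow> complex \<Rightarrow> nat set" where
  "prime_class N \<epsilon> \<xi> = {p. prime p \<and> \<not> p dvd N \<and> \<epsilon> (int p) = \<xi>}"

text \<open>The analytic core, detached from modular forms: a multiplicative sign function
  \<open>h\<close> and angles \<open>s\<close> that determine it at primes away from a small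
  neighbourhood of \<open>0\<close>.\<close>

lemma multiplicative_signs_equidistributed:
  fixes h s :: "nat \<Rightarrow> real" and N q d :: nat
  assumes N: "N > 0" and q: "q > 0" and d: "coprime d q"
    and h: "\<And>n. h n \<in> {-1, 0, 1}" "h 1 \<noteq> 0" "\<And>p. p dvd N \<Longrightarrow> prime p \<Longrightarrow> h p = 0"
    and mult: "\<And>p j m. prime p \<Longrightarrow> \<not> p dvd m \<Longrightarrow> m > 0 \<Longrightarrow> h (p ^ j * m) = h (p ^ j) * h m"
    and sgn: "\<And>p. prime p \<Longrightarrow> \<not> p dvd N \<Longrightarrow> \<bar>s p\<bar> > 1 / (2 * sqrt (real p)) \<Longrightarrow> h p = sgn (s p)"
    and equi: "\<And>\<epsilon> \<xi>. dirichlet_character q \<epsilon> \<Longrightarrow> \<xi> \<in> character_image q \<epsilon> \<Longrightarrow>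
       \<exists>C>0. \<exists>\<alpha>>0. \<forall>u v x. -1 \<le> u \<and> u \<le> v \<and> v \<le> 1 \<and> x \<ge> 2 \<longrightarrow>
         \<bar>real (card {p\<in>prime_class N \<epsilon> \<xi>. real p \<le> x \<and> s p \<in> {u..v}}) / real (prime_pi x)
           - measure sato_tate {u..v} / real (card (character_image q \<epsilon>))\<bar> \<le> C / x powr \<alpha>"
  defines "T \<equiv> {n. n > 0 \<and> [n = d] (mod q)}"
  shows "\<exists>\<Delta>>0. seq_density {n\<in>T. h n \<noteq> 0} \<Delta> \<and>
    seq_density {n\<in>T. h n = 1} (\<Delta> / 2) \<and> seq_density {n\<in>T. h n = -1} (\<Delta> / 2)"
proof -
  define \<epsilon>0 where "\<epsilon>0 = (\<lambda>n. if coprime n (int q) then 1 else 0 :: complex)"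
  have eps0: "dirichlet_character q \<epsilon>0" unfolding \<epsilon>0_def by (rule dirichlet_character_principal)
  have im0: "character_image q \<epsilon>0 = {1}"
  proof -
    have "coprime 1 (int q)" by simp
    thus ?thesis unfolding character_image_def by (auto simp: \<epsilon>0_def image_iff intro!: exI[of _ 1])
  qed
  \<comment> \<open>The class of the principal character consists of all primes prime to
    \<open>N * q\<close>. Its image is \<open>{1}\<close>, so equidistribution holds there with full
    mass, as the count of exceptional primes requires.\<close>
  define R where "R = prime_class N \<epsilon>0 1"
  have R_prime: "prime p" if "p \<in> R" for p using that by (simp add: R_def prime_class_def)
  have R_iff: "p \<in> R" if "prime p" "\<not> p dvd N" "coprime (int p) (int q)" for p
    using that by (simp add: R_def prime_class_def \<epsilon>0_def)
  have "1 \<in> character_image q \<epsilon>0" by (simp add: im0)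
  from equi[OF eps0 this, folded R_def, unfolded im0]
  have "\<exists>C>0. \<exists>\<alpha>>0. \<forall>u v x. -1 \<le> u \<and> u \<le> v \<and> v \<le> 1 \<and> x \<ge> 2 \<longrightarrow>
         \<bar>real (card {p\<in>R. real p \<le> x \<and> s p \<in> {u..v}}) / real (prime_pi x)
           - measure sato_tate {u..v}\<bar> \<le> C / x powr \<alpha>"
    by simp
  then obtain C0 \<alpha>0 where C0: "C0 > 0" "\<alpha>0 > 0" and
    E0: "\<forall>u v x. -1 \<le> u \<and> u \<le> v \<and> v \<le> 1 \<and> x \<ge> 2 \<longrightarrow>
         \<bar>real (card {p\<in>R. real p \<le> x \<and> s p \<in> {u..v}}) / real (prime_pi x)
           - measure sato_tate {u..v}\<bar> \<le> C0 / x powr \<alpha>0"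
    by (elim exE conjE) (rule that)
  have equi0: "\<bar>real (card {p\<in>R. real p \<le> x \<and> s p \<in> {u..v}}) / real (prime_pi x)
           - measure sato_tate {u..v}\<bar> \<le> C0 / x powr \<alpha>0"
    if "-1 \<le> u" "u \<le> v" "v \<le> 1" "x \<ge> 2" for u v x
    by (rule E0[rule_format]) (intro conjI that)
  have "\<exists>C' \<beta>. C' > 0 \<and> \<beta> > 0 \<and> (\<forall>x\<ge>2.
      real (card {p\<in>R. exceptional s p \<and> real p \<le> x}) \<le> C' * x powr (1 - \<beta>))"
    by (rule exceptional_sparse[OF R_prime C0 equi0])
  then obtain C' \<beta> where C': "C' > 0" "\<beta> > 0" and
    S: "\<forall>x\<ge>2. real (card {p\<in>R. exceptional s p \<and> real p \<le> x}) \<le> C' * x powr (1 - \<beta>)"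
    by (elim exE conjE) (rule that)
  have sparse: "real (card {p\<in>R. exceptional s p \<and> real p \<le> x}) \<le> C' * x powr (1 - \<beta>)"
    if "x \<ge> 2" for x
    using S that by blast
  have bound: "\<bar>h n\<bar> \<le> 1" for n using h(1)[of n] by auto

  have char_sum: "power_saving (\<lambda>p. of_real (h p) * \<epsilon> (int p))" if eps: "dirichlet_character q \<epsilon>" for \<epsilon>
  proof -
    have fin: "finite (character_image q \<epsilon>)" by (rule finite_character_image[OF q eps])
    have "power_saving (\<lambda>p. if p \<in> prime_class N \<epsilon> \<xi> then of_real (h p) else 0)"
      if \<xi>: "\<xi> \<in> character_image q \<epsilon>" for \<xi>
    proof -
      obtain C \<alpha> where C: "C > 0" "\<alpha> > 0" and
        E: "\<forall>u v x. -1 \<le> u \<and> u \<le> v \<and> v \<le> 1 \<and> x \<ge> 2 \<longrightarrow>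
         \<bar>real (card {p\<in>prime_class N \<epsilon> \<xi>. real p \<le> x \<and> s p \<in> {u..v}}) / real (prime_pi x)
           - measure sato_tate {u..v} / real (card (character_image q \<epsilon>))\<bar> \<le> C / x powr \<alpha>"
        using equi[OF eps \<xi>] by (elim exE conjE) (rule that)
      have E': "\<bar>real (card {p\<in>prime_class N \<epsilon> \<xi>. real p \<le> x \<and> s p \<in> {u..v}}) / real (prime_pi x)
           - measure sato_tate {u..v} / real (card (character_image q \<epsilon>))\<bar> \<le> C / x powr \<alpha>"
        if "-1 \<le> u" "u \<le> v" "v \<le> 1" "x \<ge> 2" for u v x
        by (rule E[rule_format]) (intro conjI that)
      have "\<xi> \<noteq> 0" using \<xi> dirichlet_character_nonzero[OF eps] by (auto simp: character_image_def)
      hence sub: "prime_class N \<epsilon> \<xi> \<subseteq> R"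
        using dirichlet_character_nonzero[OF eps] R_iff by (auto simp: prime_class_def)
      show ?thesis
        by (rule power_saving_signs[OF _ C E' sub C' sparse bound])
          (use sgn in \<open>auto simp: prime_class_def\<close>)
    qed
    \<comment> \<open>A prime prime to \<open>N * q\<close> lies in the class of exactly one
      \<open>\<xi>\<close>, namely \<open>\<epsilon> p\<close>, so weighting the classes by
      \<open>\<xi>\<close> reassembles the character sum; at all other primes both sides
      vanish.\<close>
    hence "power_saving (\<lambda>p. \<Sum>\<xi>\<in>character_image q \<epsilon>. \<xi> * (if p \<in> prime_class N \<epsilon> \<xi> then of_real (h p) else 0))"
      by (intro power_saving_sum power_saving_scale fin)
    thus ?thesis
    proof (rule power_saving_cong[rotated])
      fix p :: nat assume p: "prime p"
      show "(\<Sum>\<xi>\<in>character_image q \<epsilon>. \<xi> * (if p \<in> prime_class N \<epsilon> \<xi> then of_real (h p) else 0))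
          = of_real (h p) * \<epsilon> (int p)"
      proof (cases "p dvd N \<or> \<not> coprime (int p) (int q)")
        case True
        hence zero: "p dvd N \<or> \<epsilon> (int p) = 0"
          using dirichlet_character_nonzero[OF eps] by blast
        have "p \<notin> prime_class N \<epsilon> \<xi>" if "\<xi> \<in> character_image q \<epsilon>" for \<xi>
        proof -
          have "\<xi> \<noteq> 0" using that dirichlet_character_nonzero[OF eps] by (auto simp: character_image_def)
          with zero show ?thesis by (auto simp: prime_class_def)
        qed
        hence "(\<Sum>\<xi>\<in>character_image q \<epsilon>. \<xi> * (if p \<in> prime_class N \<epsilon> \<xi> then of_real (h p) else 0)) = 0"
          by (intro sum.neutral) auto
        moreover have "h p = 0 \<or> \<epsilon> (int p) = 0"
          using zero h(3)[OF _ p] by blast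
        ultimately show ?thesis by auto
      next
        case False
        hence "\<epsilon> (int p) \<in> character_image q \<epsilon>" by (auto simp: character_image_def)
        moreover have "\<xi> * (if p \<in> prime_class N \<epsilon> \<xi> then of_real (h p) else 0) =
            (if \<epsilon> (int p) = \<xi> then of_real (h p) * \<epsilon> (int p) else 0)" for \<xi>
          using False p by (simp add: prime_class_def)
        ultimately show ?thesis using fin by simp
      qed
    qed
  qed
  \<comment> \<open>Power savings are stable under sums and scalars, so rule induction carries them
    from characters to the span, and thereby to the indicators of unit classes.\<close>
  have span: "power_saving (\<lambda>p. of_real (h p) * \<phi> (int p))" if "\<phi> \<in> character_span q" for \<phi>
    using that
  proof induction
    case (char \<epsilon>) thus ?case by (rule char_sum)
  next
    case (add \<phi> \<psi>)
    from power_saving_add[OF add.IH] show ?case by (simp add: distrib_left)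
  next
    case (scale \<phi> z)
    from power_saving_scale[OF scale.IH, of z] show ?case by (simp add: mult_ac)
  qed
  have primes_in_class:
    "(\<lambda>y. (\<Sum>p | prime p \<and> p \<le> y \<and> [p = c] (mod q). h p * ln (real p)) / real y) \<longlonglongrightarrow> 0"
    if c: "coprime c q" for c
  proof -
    have "coprime (int c) (int q)" using c by simp
    from span[OF residue_indicator_in_character_span[OF q this]]
    have "power_saving (\<lambda>p. of_real (if [p = c] (mod q) then h p else 0))"
      by (rule power_saving_cong[rotated]) (simp add: cong_int_iff)
    from power_saving_imp_log_weighted[OF this]
    have "(\<lambda>y. (\<Sum>p | prime p \<and> p \<le> y. (if [p = c] (mod q) then h p else 0) * ln (real p)) / real y) \<longlonglongrightarrow> 0" .
    moreover have "(\<Sum>p | prime p \<and> p \<le> y. (if [p = c] (mod q) then h p else 0) * ln (real p)) =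
        (\<Sum>p | prime p \<and> p \<le> y \<and> [p = c] (mod q). h p * ln (real p))" for y
      by (rule sum.mono_neutral_cong_right)
        (auto intro: finite_subset[of _ "{..y}"])
    ultimately show ?thesis by simp
  qed
  have mult1: "h (p * m) = h p * h m" if "prime p" "\<not> p dvd m" for p m
    using mult[OF that, of 1] that by (cases "m = 0") auto
  have mean: "(\<lambda>x. (\<Sum>n | n \<in> {1..x} \<and> n \<in> T. h n) / real x) \<longlonglongrightarrow> 0"
  proof -
    have "{n. n \<in> {1..x} \<and> n \<in> T} = {n. n \<in> {1..x} \<and> [n = d] (mod q)}" for x
      by (auto simp: T_def)
    thus ?thesis using mean_value_zero_in_progression[OF q d bound mult1 primes_in_class] by simp
  qed

  define W where "W = {p\<in>R. exceptional s p}"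
  have "summable (\<lambda>p. if p \<in> W then 1 / real p else 0)"
  proof (rule summable_reciprocals_of_sparse[OF C'])
    show "0 \<notin> W" using R_prime by (force simp: W_def)
    fix n :: nat assume "n \<ge> 2"
    thus "real (card {m\<in>W. m \<le> n}) \<le> C' * real n powr (1 - \<beta>)"
      using sparse[of "real n"] by (simp add: W_def conj_assoc)
  qed
  moreover have "summable (\<lambda>p. if p dvd N * q then 1 / real p else 0)"
    by (rule summable_finite[of "{p. p dvd N * q}"]) (use N q in auto)
  ultimately have "summable (\<lambda>p. (if p \<in> W then 1 / real p else 0) + (if p dvd N * q then 1 / real p else 0))"
    by (rule summable_add)
  hence summ: "summable (\<lambda>p. if prime p \<and> h p = 0 then 1 / real p else 0)"
  proof (rule summable_comparison_test[rotated], intro exI allI impI)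
    fix p :: nat
    \<comment> \<open>For \<open>p\<close> prime to \<open>N * q\<close>, an angle above the
      threshold is nonzero and would force \<open>h p \<noteq> 0\<close>; a zero at such a
      \<open>p\<close> is therefore exceptional.\<close>
    have "p \<in> W \<or> p dvd N * q" if "prime p" "h p = 0"
    proof (rule disjCI)
      assume pNq: "\<not> p dvd N * q"
      hence "\<not> p dvd q" by auto
      hence "coprime (int p) (int q)" using that(1) prime_imp_coprime by auto
      hence "p \<in> R" using pNq that(1) by (intro R_iff) auto
      moreover have "\<bar>s p\<bar> \<le> 1 / (2 * sqrt (real p))"
      proof (rule ccontr)
        assume *: "\<not> \<bar>s p\<bar> \<le> 1 / (2 * sqrt (real p))"
        have "\<not> p dvd N" using pNq by auto
        with * have "sgn (s p) = 0" using sgn[of p] that by simp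
        hence "s p = 0" by (simp add: sgn_zero_iff)
        with * show False by simp
      qed
      ultimately show "p \<in> W" by (simp add: W_def exceptional_def)
    qed
    thus "norm (if prime p \<and> h p = 0 then 1 / real p else 0) \<le>
        (if p \<in> W then 1 / real p else 0) + (if p dvd N * q then 1 / real p else 0)"
      by auto
  qed
  have "h (p ^ j * m) = 0 \<longleftrightarrow> h (p ^ j) = 0 \<or> h m = 0" if "prime p" "\<not> p dvd m" "m > 0" for p j m
    using mult[OF that] by simp
  from seq_density_nonzero_multiplicative[OF this h(2) summ q d]
  obtain \<Delta> where \<Delta>: "\<Delta> > 0" "seq_density {n\<in>T. h n \<noteq> 0} \<Delta>" by (auto simp: T_def conj_assoc)
  have "n > 0" if "n \<in> T" for n using that by (simp add: T_def)
  from seq_density_signs[OF h(1) this \<Delta>(2) mean] \<Delta> show ?thesis by blast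
qed

section \<open>From the coefficients of \<open>f\<close> to a multiplicative sign function\<close>

theorem theorem1:
  fixes k N t q :: nat
    and chi :: "int \<Rightarrow> complex"
    and f F :: "complex \<Rightarrow> complex"
    and a A :: "nat \<Rightarrow> complex"
    and d :: int
  assumes k: "k \<ge> 2"
    and N: "N > 0" "4 dvd N"
    and chi: "dirichlet_character N chi"
    and f: "cusp_form_half k N chi f" "q_expansion f a" "\<exists>z\<in>upper_half_plane. f z \<noteq> 0"
    and eigen: "hecke_eigenform_half k chi a"
    and t: "t > 0" "squarefree t" "a t \<noteq> 0"
    and real_values: "\<And>n. coprime n N \<Longrightarrow> a (t * n\<^sup>2) / chi (int n) \<in> \<real>"
    and lift: "shimura_lift k N chi t a F A"
    and no_CM: "\<not> has_CM A"
    and q: "q > 0"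
    and sato_tate_error:
      "\<forall>\<epsilon>. dirichlet_character q \<epsilon> \<longrightarrow> (\<forall>\<xi>\<in>character_image q \<epsilon>.
         \<exists>C>0. \<exists>\<alpha>>0. \<forall>u v x :: real. -1 \<le> u \<and> u \<le> v \<and> v \<le> 1 \<and> x \<ge> 2 \<longrightarrow>
           \<bar>real (card {p::nat. prime p \<and> real p \<le> x \<and> \<not> p dvd N \<and> \<epsilon> (int p) = \<xi> \<and>
                A p / (2 * a t * of_real (real p powr ((2 * real k - 1) / 2)) * chi (int p))
                  \<in> complex_of_real ` {u..v}})
              / real (prime_pi x)
            - measure sato_tate {u..v} / real (card (character_image q \<epsilon>))\<bar>
           \<le> C / x powr \<alpha>)"
    and d: "coprime d (int q)"
  shows "\<exists>\<delta> \<Delta> :: real. \<delta> > 0 \<and> \<delta> = \<Delta> / 2 \<and>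
     has_natural_density
       {n. coprime n N \<and> [int n = d] (mod int q) \<and> Re (a (t * n\<^sup>2) / chi (int n)) > 0} \<delta> \<and>
     has_natural_density
       {n. coprime n N \<and> [int n = d] (mod int q) \<and> Re (a (t * n\<^sup>2) / chi (int n)) < 0} \<delta> \<and>
     has_natural_density
       {n. coprime n N \<and> [int n = d] (mod int q) \<and> a (t * n\<^sup>2) / chi (int n) \<noteq> 0} \<Delta>"
proof -
  define w where "w n = Re (a (t * n\<^sup>2) / chi (int n))" for n
  \<comment> \<open>Dividing by \<open>w 1\<close>, which equals \<open>a t\<close>, turns the Hecke
    relation into multiplicativity.\<close>
  define h where "h n = (if coprime n N then sgn (w n / w 1) else 0)" for n
  have chi_nz: "chi (int n) \<noteq> 0" if "coprime n N" for n
    using that dirichlet_character_nonzero[OF chi] by simp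
  have w: "a (t * n\<^sup>2) / chi (int n) = of_real (w n)" if "coprime n N" for n
    unfolding w_def using real_values[OF that] by simp
  hence w': "a (t * n\<^sup>2) = of_real (w n) * chi (int n)" if "coprime n N" for n
    using that chi_nz[OF that] by (simp add: divide_eq_eq)
  have at: "a t = of_real (w 1)" using w'[of 1] dirichlet_character_one[OF chi] by simp
  hence w1: "w 1 \<noteq> 0" using t(3) by auto
  \<comment> \<open>Only for \<open>N = 1\<close> would \<open>0\<close> be coprime to
    \<open>N\<close>; this is what makes every \<open>n\<close> in the sets positive.\<close>
  have N1: "N \<noteq> 1" using N by auto
  have h_values: "h n \<in> {-1, 0, 1}" for n by (auto simp: h_def sgn_if)
  have h_one: "h 1 \<noteq> 0" using w1 by (simp add: h_def)
  have h_N: "h p = 0" if "p dvd N" "prime p" for p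
  proof -
    have "\<not> coprime p N" using that by (meson coprime_common_divisor dvd_refl not_prime_unit)
    thus ?thesis by (simp add: h_def)
  qed
  have h_mult: "h (p ^ j * m) = h (p ^ j) * h m" if p: "prime p" "\<not> p dvd m" "m > 0" for p j m
  proof (cases "coprime (p ^ j) N \<and> coprime m N")
    case False
    thus ?thesis by (auto simp: h_def coprime_mult_left_iff)
  next
    case True
    hence cop: "coprime (p ^ j) N" "coprime m N" "coprime (p ^ j * m) N" by simp_all
    have "a t * a (t * (p ^ j * m)\<^sup>2) = a (t * (p ^ j)\<^sup>2) * a (t * m\<^sup>2)"
      by (rule hecke_half_multiplicative[OF eigen t(1,2) p(1,3,2)])
    hence "of_real (w 1) * (of_real (w (p ^ j * m)) * chi (int (p ^ j * m))) =
        (of_real (w (p ^ j)) * chi (int (p ^ j))) * (of_real (w m) * chi (int m))"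
      unfolding at w'[OF cop(1)] w'[OF cop(2)] w'[OF cop(3)] .
    moreover have "chi (int (p ^ j * m)) = chi (int (p ^ j)) * chi (int m)"
      unfolding of_nat_mult by (rule dirichlet_character_mult[OF chi])
    ultimately have "(of_real (w 1 * w (p ^ j * m)) :: complex) * (chi (int (p ^ j)) * chi (int m)) =
        of_real (w (p ^ j) * w m) * (chi (int (p ^ j)) * chi (int m))"
      by (simp only: of_real_mult mult_ac)
    hence "(of_real (w 1 * w (p ^ j * m)) :: complex) = of_real (w (p ^ j) * w m)"
      using chi_nz[OF cop(1)] chi_nz[OF cop(2)] by (simp del: of_real_mult)
    hence "w 1 * w (p ^ j * m) = w (p ^ j) * w m" by (simp only: of_real_eq_iff)
    hence "w (p ^ j * m) / w 1 = (w (p ^ j) / w 1) * (w m / w 1)"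
      using w1 by (simp add: field_simps)
    thus ?thesis using cop by (simp only: h_def if_True sgn_mult)
  qed

  have "\<exists>s. prime p \<and> \<not> p dvd N \<longrightarrow>
      A p / (2 * a t * of_real (real p powr ((2 * real k - 1) / 2)) * chi (int p)) = of_real s \<and>
      (\<bar>s\<bar> > 1 / (2 * sqrt (real p)) \<longrightarrow> h p = sgn s)" for p
  proof (cases "prime p \<and> \<not> p dvd N")
    case True
    hence p: "prime p" "coprime p N" by (auto intro: prime_imp_coprime)
    obtain \<kappa> :: int where \<kappa>: "\<bar>\<kappa>\<bar> \<le> 1"
      "A p = a (t * p\<^sup>2) + chi (int p) * of_int \<kappa> * of_nat p ^ (k - 1) * a t"
      using shimura_lift_prime[OF lift chi p(1)] by metis
    define P where "P = real p ^ (k - 1)"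
    define r where "r = sqrt (real p)"
    define b where "b = 1 / (2 * r)"
    have p0: "real p > 0" using prime_gt_0_nat[OF p(1)] by simp
    hence P: "P > 0" and r: "r > 0" by (simp_all add: P_def r_def)
    hence b: "b > 0" by (simp add: b_def)
    have exponent: "(2 * real k - 1) / 2 = real (k - 1) + 1 / 2" using k by (simp add: field_simps)
    have Pr: "real p powr ((2 * real k - 1) / 2) = P * r"
      unfolding exponent powr_add P_def r_def using p0 by (simp add: powr_realpow powr_half_sqrt)
    \<comment> \<open>The normalised \<open>A p\<close> is a positive multiple of
      \<open>w p / w 1\<close> plus the symbol term: dividing
      \<open>\<kappa> * p ^ (k - 1) * a t\<close> by \<open>2 * a t * p powr (k - 1 / 2)\<close>
      leaves \<open>\<kappa> / (2 * sqrt p)\<close>, that is \<open>\<kappa> * b\<close>.\<close>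
    define s where "s = (w p / w 1) / (2 * P * r) + \<kappa> * b"
    have "A p = of_real (w p + \<kappa> * P * w 1) * chi (int p)"
      unfolding \<kappa>(2) w'[OF p(2)] at by (simp add: P_def algebra_simps)
    hence "A p / (2 * a t * of_real (P * r) * chi (int p)) = of_real ((w p + \<kappa> * P * w 1) / (2 * w 1 * (P * r)))"
      using chi_nz[OF p(2)] by (simp add: at)
    also have "(w p + \<kappa> * P * w 1) / (2 * w 1 * (P * r)) = s"
      using w1 P r by (simp add: s_def b_def field_simps)
    finally have "A p / (2 * a t * of_real (P * r) * chi (int p)) = of_real s" .
    moreover have "h p = sgn s" if "\<bar>s\<bar> > b"
    proof -
      define X where "X = (w p / w 1) / (2 * P * r)"
      have "\<bar>\<kappa> * b\<bar> \<le> 1 * b"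
        unfolding abs_mult using \<kappa>(1) b by (intro mult_mono) auto
      moreover have "s = X + \<kappa> * b" by (simp only: s_def X_def)
      \<comment> \<open>A shift by at most \<open>b\<close> cannot change the sign of a number
        exceeding \<open>b\<close> in absolute value.\<close>
      ultimately have "0 < s \<and> 0 < X \<or> s < 0 \<and> X < 0" using that b by linarith
      hence "sgn s = sgn X" by auto
      also have "X = inverse (2 * P * r) * (w p / w 1)" by (simp only: X_def divide_inverse mult_ac)
      also have "sgn \<dots> = sgn (w p / w 1)"
        using P r by (simp only: sgn_mult sgn_pos positive_imp_inverse_positive mult_pos_pos zero_less_numeral mult_1)
      finally show ?thesis using p(2) by (simp add: h_def)
    qed
    ultimately show ?thesis unfolding Pr by (auto simp: b_def r_def)
  qed blast
  then obtain s where s: "\<And>p. prime p \<Longrightarrow> \<not> p dvd N \<Longrightarrow>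
      A p / (2 * a t * of_real (real p powr ((2 * real k - 1) / 2)) * chi (int p)) = of_real (s p)"
    and s_sgn: "\<And>p. prime p \<Longrightarrow> \<not> p dvd N \<Longrightarrow> \<bar>s p\<bar> > 1 / (2 * sqrt (real p)) \<Longrightarrow> h p = sgn (s p)"
    by metis
  have sets: "{p::nat. prime p \<and> real p \<le> x \<and> \<not> p dvd N \<and> \<epsilon> (int p) = \<xi> \<and>
      A p / (2 * a t * of_real (real p powr ((2 * real k - 1) / 2)) * chi (int p)) \<in> complex_of_real ` {u..v}}
    = {p\<in>prime_class N \<epsilon> \<xi>. real p \<le> x \<and> s p \<in> {u..v}}" for x u v \<epsilon> \<xi>
    by (intro Collect_cong) (auto simp: prime_class_def s)
  have equi: "\<exists>C>0. \<exists>\<alpha>>0. \<forall>u v x. -1 \<le> u \<and> u \<le> v \<and> v \<le> 1 \<and> x \<ge> 2 \<longrightarrow>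
         \<bar>real (card {p\<in>prime_class N \<epsilon> \<xi>. real p \<le> x \<and> s p \<in> {u..v}}) / real (prime_pi x)
           - measure sato_tate {u..v} / real (card (character_image q \<epsilon>))\<bar> \<le> C / x powr \<alpha>"
    if "dirichlet_character q \<epsilon>" "\<xi> \<in> character_image q \<epsilon>" for \<epsilon> \<xi>
    using sato_tate_error[rule_format, OF that] unfolding sets .

  define d' where "d' = nat (d mod int q)"
  have d': "int d' = d mod int q" using q by (simp add: d'_def)
  have "coprime (int d') (int q)" unfolding d' using d q by simp
  hence cop_d': "coprime d' q" by simp
  have d_iff: "[int n = d] (mod int q) \<longleftrightarrow> [n = d'] (mod q)" for n
  proof -
    have "[int n = d] (mod int q) \<longleftrightarrow> [int n = int d'] (mod int q)"
      unfolding d' by (simp add: cong_def)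
    thus ?thesis by (simp add: cong_int_iff)
  qed
  define T where "T = {n. n > 0 \<and> [n = d'] (mod q)}"
  obtain \<Delta> where \<Delta>: "\<Delta> > 0" "seq_density {n\<in>T. h n \<noteq> 0} \<Delta>"
    "seq_density {n\<in>T. h n = 1} (\<Delta> / 2)" "seq_density {n\<in>T. h n = -1} (\<Delta> / 2)"
    using multiplicative_signs_equidistributed[OF N(1) q cop_d' h_values h_one h_N h_mult s_sgn equi]
    unfolding T_def by blast
  have pos: "n > 0" if "coprime n N" for n using that N1 by (cases n) auto
  have nonzero_set: "{n. coprime n N \<and> [int n = d] (mod int q) \<and> a (t * n\<^sup>2) / chi (int n) \<noteq> 0}
      = {n\<in>T. h n \<noteq> 0}"
  proof (intro Collect_cong)
    fix n
    show "coprime n N \<and> [int n = d] (mod int q) \<and> a (t * n\<^sup>2) / chi (int n) \<noteq> 0 \<longleftrightarrow> n \<in> T \<and> h n \<noteq> 0"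
    proof (cases "coprime n N")
      case True
      thus ?thesis unfolding w[OF True] d_iff using w1 pos by (simp add: T_def h_def sgn_zero_iff)
    qed (simp add: h_def)
  qed
  have pos_set: "{n. coprime n N \<and> [int n = d] (mod int q) \<and> Re (a (t * n\<^sup>2) / chi (int n)) > 0}
      = {n\<in>T. h n = sgn (w 1)}"
    and neg_set: "{n. coprime n N \<and> [int n = d] (mod int q) \<and> Re (a (t * n\<^sup>2) / chi (int n)) < 0}
      = {n\<in>T. h n = - sgn (w 1)}"
    unfolding w_def[symmetric] d_iff using w1 pos
    by (auto simp: T_def h_def sgn_if zero_less_divide_iff divide_less_0_iff split: if_splits)
  \<comment> \<open>For \<open>a t < 0\<close> the sets with \<open>h n = 1\<close> and
    \<open>h n = -1\<close> trade places; they have the same density.\<close>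
  have "seq_density {n\<in>T. h n = sgn (w 1)} (\<Delta> / 2)" "seq_density {n\<in>T. h n = - sgn (w 1)} (\<Delta> / 2)"
    using \<Delta>(3,4) w1 by (auto simp: sgn_if)
  with \<Delta>(1,2) show ?thesis
    unfolding pos_set neg_set nonzero_set
    by (intro exI[of _ "\<Delta> / 2"] exI[of _ \<Delta>]) (auto intro: has_natural_densityI)
qed

end
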